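(* Let $T>\pi$ and let $\mathcal{G}_{\mathrm{Burg}}$ and $\mu$ be as in the context. There exists a constant $C>0$ such that for any $\epsilon\in(0,\tfrac12]$ and any grid size $N\ge3$ there exists a (ReLU) FNO $\mathcal{N}^{\mathrm{FNO}}_\epsilon$ with \[ \mathbb{E}_{\bar u\sim\mu}\big[\|\mathcal{G}_{\mathrm{Burg}}(\bar u)-\mathcal{N}^{\mathrm{FNO}}_\epsilon(\bar u)\|_{L^1(\mathbb{T})}\big]\le\epsilon, \] Fourier cut-off $k_{\max}=1$, lifting dimension $d_v\le C$, $\mathrm{depth}(\mathcal{N}^{\mathrm{FNO}}_\epsilon)\le C\log(\epsilon^{-1})^2$ and $\mathrm{size}(\mathcal{N}^{\mathrm{FNO}}_\epsilon)\le C\log(\epsilon^{-1})^2$.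
   Context: $\mathbb{T}=\mathbb{R}/2\pi\mathbb{Z}$. $\mu$ is the law of $\bar u(x)=-\sin(x-\xi)$, $\xi\sim\mathrm{Unif}[0,2\pi]$; $\mathcal{G}_{\mathrm{Burg}}(\bar u)=u(\cdot,T)$ with $u$ the entropy solution of $\partial_tu+\partial_x(u^2/2)=0$ on $\mathbb{T}$, $u(\cdot,0)=\bar u$. FNO with grid size $N$: $x_j=2\pi j/N$, $\mathcal{F}_Nv(k)=\frac1N\sum_{j=1}^Nv(x_j)e^{-ikx_j}$. An FNO with lifting dimension $d_v$, cut-off $k_{\max}$, depth $L$, ReLU activation $\sigma$ is $\mathcal{N}=Q\circ\mathcal{L}_L\circ\dots\circ\mathcal{L}_1\circ R$, $(R\bar u)(x)=R(\bar u(x),x)$ with $R$ a shallow ReLU network into $\mathbb{R}^{d_v}$, $(\mathcal{L}_\ell v)(x)=\sigma(W_\ell v(x)+b_\ell(x)+(K_\ell v)(x))$, $W_\ell\in\mathbb{R}^{d_v\times d_v}$, $(K_\ell v)(x)=\sum_{|k|\le k_{\max}}P_\ell(k)\mathcal{F}_Nv(k)e^{ikx}$, $P_\ell(k)\in\mathbb{C}^{d_v\times d_v}$, real bias $b_\ell(x)=\sum_{|k|\le k_{\max}}\hat b_\ell(k)e^{ikx}$, $Q$ linear pointwise. Outputs are defined for all $x\in\mathbb{T}$. Depth $=L$; size = total number of tunable parameters. *)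

theory Defs
  imports "HOL-Analysis.Analysis"
begin

text \<open>Functions on the torus are represented as 2pi-periodic functions on the reals.
  A space-time function is written u x t.\<close>

definition nonneg_test_fun ::
  "(real \<Rightarrow> real \<Rightarrow> real) \<Rightarrow> (real \<Rightarrow> real \<Rightarrow> real) \<Rightarrow> (real \<Rightarrow> real \<Rightarrow> real) \<Rightarrow> bool" where
  "nonneg_test_fun ph phx pht \<longleftrightarrow>
     (\<forall>x t. 0 \<le> ph x t) \<and>
     (\<forall>x t. ((\<lambda>y. ph y t) has_real_derivative phx x t) (at x)) \<and>
     (\<forall>x t. ((\<lambda>s. ph x s) has_real_derivative pht x t) (at t)) \<and>
     continuous_on UNIV (\<lambda>p. phx (fst p) (snd p)) \<and>
     continuous_on UNIV (\<lambda>p. pht (fst p) (snd p)) \<and>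
     (\<exists>a R. 0 < a \<and> (\<forall>x t. ph x t \<noteq> 0 \<longrightarrow> \<bar>x\<bar> \<le> R \<and> a \<le> t \<and> t \<le> R))"

definition burg_flux :: "real \<Rightarrow> real" where
  "burg_flux v = v ^ 2 / 2"

definition L1_torus_dist :: "(real \<Rightarrow> real) \<Rightarrow> (real \<Rightarrow> real) \<Rightarrow> ennreal" where
  "L1_torus_dist f g = (\<integral>\<^sup>+ x\<in>{0..2*pi}. ennreal \<bar>f x - g x\<bar> \<partial>lborel)"

text \<open>u is the (Kruzhkov) entropy solution of u_t + (u^2/2)_x = 0 on T with u(.,0) = u0,
  taken in its representative that is continuous in time with values in L1(T).\<close>
definition burgers_entropy_solution :: "(real \<Rightarrow> real) \<Rightarrow> (real \<Rightarrow> real \<Rightarrow> real) \<Rightarrow> bool" where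
  "burgers_entropy_solution u0 u \<longleftrightarrow>
     (\<forall>x t. u (x + 2*pi) t = u x t) \<and>
     (\<lambda>p. u (fst p) (snd p)) \<in> borel_measurable lborel \<and>
     (\<forall>t. (\<lambda>x. u x t) \<in> borel_measurable lborel) \<and>
     (\<exists>M. \<forall>x t. 0 \<le> t \<longrightarrow> \<bar>u x t\<bar> \<le> M) \<and>
     (\<forall>t>0. ((\<lambda>s. L1_torus_dist (\<lambda>x. u x s) (\<lambda>x. u x t)) \<longlongrightarrow> 0) (at t within {0<..})) \<and>
     (((\<lambda>s. L1_torus_dist (\<lambda>x. u x s) u0) \<longlongrightarrow> 0) (at_right 0)) \<and>
     (\<forall>k ph phx pht. nonneg_test_fun ph phx pht \<longrightarrow>
        0 \<le> (\<integral>p. (let x = fst p; t = snd p in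
                 \<bar>u x t - k\<bar> * pht x t
                 + sgn (u x t - k) * (burg_flux (u x t) - burg_flux k) * phx x t) \<partial>lborel))"

definition burg_init :: "real \<Rightarrow> real \<Rightarrow> real" where
  "burg_init xi x = - sin (x - xi)"

definition relu :: "real \<Rightarrow> real" where
  "relu y = max 0 y"

definition tor_rep :: "real \<Rightarrow> real" where
  "tor_rep x = x - 2*pi * of_int \<lfloor>x / (2*pi)\<rfloor>"

definition grid_pt :: "nat \<Rightarrow> nat \<Rightarrow> real" where
  "grid_pt N j = 2*pi * real j / real N"

definition dft :: "nat \<Rightarrow> (real \<Rightarrow> real) \<Rightarrow> int \<Rightarrow> complex" where
  "dft N v k = (1 / of_nat N) *
     (\<Sum>j=1..N. complex_of_real (v (grid_pt N j)) * cis (- real_of_int k * grid_pt N j))"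

text \<open>Parameters of an FNO. Vectors in R^dv are functions nat => real (only indices < dv
  matter), matrices nat => nat => _.  Layer index l < depth.
  Lifting R(a,x) = R2 relu(R1 (a,x) + c1) + c2 with hidden width fno_width.\<close>
record fno =
  fno_dv    :: nat
  fno_kmax  :: nat
  fno_depth :: nat
  fno_width :: nat
  fno_R1    :: "nat \<Rightarrow> nat \<Rightarrow> real"
  fno_c1    :: "nat \<Rightarrow> real"
  fno_R2    :: "nat \<Rightarrow> nat \<Rightarrow> real"
  fno_c2    :: "nat \<Rightarrow> real"
  fno_W     :: "nat \<Rightarrow> nat \<Rightarrow> nat \<Rightarrow> real"
  fno_P     :: "nat \<Rightarrow> int \<Rightarrow> nat \<Rightarrow> nat \<Rightarrow> complex"
  fno_bhat  :: "nat \<Rightarrow> int \<Rightarrow> nat \<Rightarrow> complex"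
  fno_Q     :: "nat \<Rightarrow> real"

definition fno_lift :: "fno \<Rightarrow> (real \<Rightarrow> real) \<Rightarrow> real \<Rightarrow> nat \<Rightarrow> real" where
  "fno_lift net ub x = (\<lambda>i. (\<Sum>j<fno_width net. fno_R2 net i j *
       relu (fno_R1 net j 0 * ub x + fno_R1 net j 1 * tor_rep x + fno_c1 net j)) + fno_c2 net i)"

text \<open>Real-valued bias and Fourier kernel (real parts; equivalent to conjugate symmetry).\<close>
definition fno_layer :: "nat \<Rightarrow> fno \<Rightarrow> nat \<Rightarrow> (real \<Rightarrow> nat \<Rightarrow> real) \<Rightarrow> real \<Rightarrow> nat \<Rightarrow> real" where
  "fno_layer N net l v x = (\<lambda>i. relu (
      (\<Sum>j<fno_dv net. fno_W net l i j * v x j)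
    + Re (\<Sum>k\<in>{- int (fno_kmax net)..int (fno_kmax net)}. fno_bhat net l k i * cis (real_of_int k * x))
    + Re (\<Sum>k\<in>{- int (fno_kmax net)..int (fno_kmax net)}. \<Sum>j<fno_dv net.
            fno_P net l k i j * dft N (\<lambda>y. v y j) k * cis (real_of_int k * x))))"

fun fno_hidden :: "nat \<Rightarrow> fno \<Rightarrow> (real \<Rightarrow> real) \<Rightarrow> nat \<Rightarrow> real \<Rightarrow> nat \<Rightarrow> real" where
  "fno_hidden N net ub 0 = fno_lift net ub"
| "fno_hidden N net ub (Suc l) = fno_layer N net l (fno_hidden N net ub l)"

definition fno_eval :: "nat \<Rightarrow> fno \<Rightarrow> (real \<Rightarrow> real) \<Rightarrow> real \<Rightarrow> real" where
  "fno_eval N net ub x = (\<Sum>i<fno_dv net. fno_Q net i * fno_hidden N net ub (fno_depth net) x i)"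

text \<open>Total number of real tunable parameters (complex parameters count twice).\<close>
definition fno_size :: "fno \<Rightarrow> nat" where
  "fno_size net = (let dv = fno_dv net; m = fno_width net; K = 2 * fno_kmax net + 1 in
     3 * m + (m + 1) * dv
     + fno_depth net * (dv * dv + 2 * K * dv * dv + 2 * K * dv)
     + dv)"

end

theory Submission
  imports Defs
begin

text \<open>
  Up to the shift by \<open>\<xi>\<close>, the solution is the profile carried by the characteristics \<open>y - t * sin y\<close>, with a
  stationary shock at 0.  Any entropy solution agrees with it: Kruzhkov's inequality is tested, for each \<open>y\<close>, with
  the constant \<open>k = - sin y\<close> and a bump following the characteristic from \<open>y\<close>, weighted by the Jacobian.
  Integrating over \<open>y\<close> the singular terms form an exact derivative and vanish, which gives the contraction
  inequality away from the shock without doubling of variables.  At the shock one adds the inequality with the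
  constant \<open>k = s(t0)\<close>, \<open>-k\<close> and \<open>k\<close> being the one-sided traces of the profile, and uses that the
  Kruzhkov flux at \<open>-k\<close> is at most the one at \<open>k\<close>.

  For the network, the discrete Fourier coefficient of frequency 1 yields \<open>cos (x - \<xi>)\<close> and \<open>sin (x - \<xi>)\<close>
  exactly, as aliasing needs \<open>N < 3\<close>.  The value of the profile is \<open>- sgn (sin \<theta>) * sin z\<close> with
  \<open>z + T * sin z = arccos (- cos \<theta>)\<close>.  Two bisections in CORDIC style find first the angle and then \<open>z\<close>:
  rotations by constant angles are linear, and each binary decision is a steep ReLU step.  As the steepness
  tends to infinity the network agrees pointwise with the exact algorithm, so dominated convergence
  controls the error; the depth is even linear in \<open>ln (1/\<epsilon>)\<close>.
\<close>

subsection \<open>Characteristics of the sine datum\<close>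

text \<open>The theorem ranges over all families of entropy solutions, known only through
  boundedness, L1-continuity in time and the Kruzhkov inequalities, so \<open>u\<close> offers no
  traces at the shock. Only the explicit profile is evaluated there. Near a fixed time its traces
  are almost constant; freezing them costs an error proportional to the length of the time interval,
  and chaining such estimates and then sending the rate to 0 removes it.

  On the network side, \<open>T\<close> exceeds \<open>pi/2\<close>, and by that time every value of
  the profile comes from some \<open>z\<close> in \<open>[0, pi/2]\<close>. There the sine
  increases, so \<open>z + T * sin z\<close> has slope at least 1 and its inversion does not amplify
  errors. Each bisection digit costs a fixed number of layers and halves the error. The size counts
  parameters and not their magnitude, so the steepness of the decisions is free and may depend on
  \<open>\<epsilon>\<close> without any rate. The network depends on \<open>x\<close> and
  \<open>\<xi>\<close> only through \<open>x - \<xi>\<close>, so the expectation reduces to one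
  integral over the torus.\<close>

definition char_pos :: "real \<Rightarrow> real \<Rightarrow> real" where
  "char_pos y t = y - t * sin y"

text \<open>The characteristic from \<open>y\<close> has not yet run into the shock, which stays at 0 (identified with \<open>2*pi\<close>).\<close>

definition char_alive :: "real \<Rightarrow> real \<Rightarrow> bool" where
  "char_alive t y \<longleftrightarrow> 0 < y \<and> y < 2*pi \<and> 0 < char_pos y t \<and> char_pos y t < 2*pi"

text \<open>The decrease of \<open>sin y / y\<close> in differential form; the derivative of
  \<open>sin z - z * cos z\<close> is \<open>z * sin z\<close>.\<close>

lemma x_cos_less_sin:
  fixes y :: real
  assumes "0 < y" "y \<le> pi"
  shows "y * cos y < sin y"
proof -
  have "(\<lambda>z. sin z - z * cos z) 0 < (\<lambda>z. sin z - z * cos z) y"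
  proof (rule DERIV_pos_imp_increasing_open[OF assms(1)])
    fix z :: real assume z: "0 < z" "z < y"
    have "((\<lambda>z. sin z - z * cos z) has_real_derivative z * sin z) (at z)"
      by (auto intro!: derivative_eq_intros simp: algebra_simps)
    moreover have "0 < z * sin z" using z assms by (intro mult_pos_pos sin_gt_zero) auto
    ultimately show "\<exists>d. ((\<lambda>z. sin z - z * cos z) has_real_derivative d) (at z) \<and> 0 < d" by blast
  qed (auto intro!: continuous_intros)
  thus ?thesis by simp
qed

text \<open>Strict decrease of \<open>sin y / y\<close>, cleared of denominators. It governs
  absorption: for \<open>t \<ge> 0\<close> a label \<open>y\<close> in \<open>(0, pi]\<close>
  survives at time \<open>t\<close> iff \<open>t * (sin y / y) < 1\<close>.\<close>

lemma sin_ratio_strict_decreasing: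
  fixes a b :: real
  assumes "0 < a" "a < b" "b \<le> pi"
  shows "a * sin b < b * sin a"
proof -
  have "(\<lambda>y. y * sin a - a * sin y) a < (\<lambda>y. y * sin a - a * sin y) b"
  proof (rule DERIV_pos_imp_increasing_open[OF assms(2)])
    fix z :: real assume z: "a < z" "z < b"
    have "((\<lambda>y. y * sin a - a * sin y) has_real_derivative (sin a - a * cos z)) (at z)"
      by (auto intro!: derivative_eq_intros simp: algebra_simps)
    moreover have "a * cos z < a * cos a"
      using z assms by (intro mult_strict_left_mono cos_monotone_0_pi) auto
    moreover have "a * cos a < sin a" using x_cos_less_sin[of a] assms by auto
    ultimately show "\<exists>d. ((\<lambda>y. y * sin a - a * sin y) has_real_derivative d) (at z) \<and> 0 < d"
      by (intro exI[of _ "sin a - a * cos z"]) auto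
  qed (auto intro!: continuous_intros)
  thus ?thesis by simp
qed

lemma char_pos_reflect: "char_pos (2*pi - y) t = 2*pi - char_pos y t"
  by (simp add: char_pos_def sin_diff)

lemma char_alive_reflect: "char_alive t (2*pi - y) \<longleftrightarrow> char_alive t y"
  by (auto simp: char_alive_def char_pos_reflect)

text \<open>On the left half, labels nearer to the shock are absorbed earlier, because
  \<open>sin y / y\<close> decreases.\<close>

lemma char_pos_pos_mono:
  assumes "0 \<le> t" "0 < a" "a \<le> y" "y \<le> pi" "0 < char_pos a t"
  shows "0 < char_pos y t"
proof (cases "a = y")
  case False
  have "a * sin y \<le> y * sin a" using sin_ratio_strict_decreasing[of a y] False assms by auto
  hence "t * (a * sin y) \<le> t * (y * sin a)" using assms by (intro mult_left_mono) auto
  also have "\<dots> = y * (t * sin a)" by simp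
  also have "\<dots> < y * a" using assms by (intro mult_strict_left_mono) (auto simp: char_pos_def)
  finally have "a * (t * sin y) < a * y" by (simp add: algebra_simps)
  thus ?thesis using assms by (simp add: char_pos_def)
qed (use assms in auto)

text \<open>Survival means \<open>t * sin y < y\<close>. If \<open>cos y > 0\<close>, multiplying by
  it and using \<open>y * cos y < sin y\<close> leaves a factor \<open>sin y\<close> to cancel.
  Hence the shock absorbs a characteristic before the flow map can fold at its label.\<close>

lemma char_jacobian_pos_left:
  assumes "0 \<le> t" "0 < y" "y \<le> pi" "0 < char_pos y t"
  shows "0 < 1 - t * cos y"
proof (cases "cos y \<le> 0")
  case True
  hence "t * cos y \<le> 0" using assms by (simp add: mult_nonneg_nonpos)
  thus ?thesis by simp
next
  case False
  hence "y < pi" using assms by (cases "y = pi") auto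
  hence s: "0 < sin y" using assms by (auto intro: sin_gt_zero)
  have "t * cos y * sin y = (t * sin y) * cos y" by simp
  also have "\<dots> < y * cos y" using assms False by (intro mult_strict_right_mono) (auto simp: char_pos_def)
  also have "\<dots> < sin y" using x_cos_less_sin assms by auto
  finally have "t * cos y * sin y < 1 * sin y" by simp
  thus ?thesis using s by (simp only: mult_less_cancel_right_pos)
qed

text \<open>Surviving labels form an interval on which the flow map is increasing. The left half
  comes from the ratio argument, the right half from the symmetry about \<open>pi\<close>.\<close>

lemma char_alive_between:
  assumes "0 \<le> t" "char_alive t a" "char_alive t b" "a \<le> y" "y \<le> b"
  shows "char_alive t y" "0 < 1 - t * cos y"
proof -
  have L: "char_alive t y \<and> 0 < 1 - t * cos y"
    if "char_alive t a" "a \<le> y" "y \<le> pi" for a y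
  proof -
    have a: "0 < a" "0 < char_pos a t" using that by (auto simp: char_alive_def)
    have p: "0 < char_pos y t" using char_pos_pos_mono[of t a y] a that assms(1) by auto
    have "0 \<le> t * sin y" using that a assms by (intro mult_nonneg_nonneg sin_ge_zero) auto
    moreover have "0 < pi" by simp
    ultimately have "char_pos y t < 2*pi" using that unfolding char_pos_def by linarith
    thus ?thesis using p char_jacobian_pos_left[of t y] that a assms(1) unfolding char_alive_def
      using \<open>0 < pi\<close> by auto
  qed
  have "char_alive t y \<and> 0 < 1 - t * cos y"
  proof (cases "y \<le> pi")
    case True thus ?thesis using L[of a y] assms by auto
  next
    case False
    have "char_alive t (2*pi - y) \<and> 0 < 1 - t * cos (2*pi - y)"
      using L[of "2*pi - b" "2*pi - y"] assms False by (auto simp: char_alive_reflect)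
    thus ?thesis by (simp add: char_alive_reflect cos_diff)
  qed
  thus "char_alive t y" "0 < 1 - t * cos y" by auto
qed

lemma char_pos_strict_mono:
  assumes "0 \<le> t" "char_alive t a" "char_alive t b" "a < b"
  shows "char_pos a t < char_pos b t"
proof (rule DERIV_pos_imp_increasing[OF assms(4)])
  fix z assume "a \<le> z" "z \<le> b"
  hence "0 < 1 - t * cos z" using char_alive_between assms by blast
  moreover have "((\<lambda>a. char_pos a t) has_real_derivative (1 - t * cos z)) (at z)"
    unfolding char_pos_def by (auto intro!: derivative_eq_intros)
  ultimately show "\<exists>d. ((\<lambda>a. char_pos a t) has_real_derivative d) (at z) \<and> 0 < d" by blast
qed

lemma char_pos_less_iff:
  assumes "0 \<le> t" "char_alive t a" "char_alive t b"
  shows "char_pos a t < char_pos b t \<longleftrightarrow> a < b"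
  using char_pos_strict_mono[of t] assms by (metis linorder_neqE_linordered_idom order_less_asym less_irrefl)

section \<open>Inversion of the flow map on surviving labels\<close>

definition char_foot :: "real \<Rightarrow> real \<Rightarrow> real" where
  "char_foot x t = (THE y. 0 < y \<and> y < 2*pi \<and> char_pos y t = x)"

text \<open>The flow map fixes 0 and \<open>2*pi\<close>, so every \<open>x\<close> between them is
  attained. It need not be injective on the whole cell, but every preimage of such an
  \<open>x\<close> is a surviving label, and among these the map is strictly increasing.\<close>

lemma char_foot_ex1:
  assumes "0 \<le> t" "0 < x" "x < 2*pi"
  shows "\<exists>!y. 0 < y \<and> y < 2*pi \<and> char_pos y t = x"
proof -
  have "\<exists>y. 0 \<le> y \<and> y \<le> 2*pi \<and> char_pos y t = x"
    by (rule IVT'[of "\<lambda>y. char_pos y t"])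
       (use assms in \<open>auto simp: char_pos_def intro!: continuous_intros\<close>)
  then obtain y where y: "0 \<le> y" "y \<le> 2*pi" "char_pos y t = x" by blast
  have "y \<noteq> 0" "y \<noteq> 2*pi" using y assms by (auto simp: char_pos_def)
  hence y': "0 < y \<and> y < 2*pi \<and> char_pos y t = x" using y by auto
  show ?thesis
  proof (rule ex1I[of _ y])
    fix z assume z: "0 < z \<and> z < 2 * pi \<and> char_pos z t = x"
    have "char_alive t z" "char_alive t y" using z y' assms by (auto simp: char_alive_def)
    thus "z = y" using char_pos_less_iff[OF assms(1)] z y'
      by (metis less_irrefl linorder_neqE_linordered_idom)
  qed (use y' in auto)
qed

lemma char_foot:
  assumes "0 \<le> t" "0 < x" "x < 2*pi"
  shows "0 < char_foot x t" "char_foot x t < 2*pi" "char_pos (char_foot x t) t = x"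
    "char_alive t (char_foot x t)"
  using theI'[OF char_foot_ex1[OF assms]] assms unfolding char_foot_def[symmetric]
  by (auto simp: char_alive_def)

lemma char_foot_unique:
  assumes "0 \<le> t" "char_alive t y"
  shows "char_foot (char_pos y t) t = y"
  using char_foot_ex1[of t "char_pos y t"] char_foot[of t "char_pos y t"] assms
  unfolding char_alive_def by blast

lemma char_foot_less_iff:
  assumes "0 \<le> t" "0 < x" "x < 2*pi" "char_alive t y"
  shows "char_foot x t < y \<longleftrightarrow> x < char_pos y t" "y < char_foot x t \<longleftrightarrow> char_pos y t < x"
  using char_pos_less_iff[of t y "char_foot x t"] char_pos_less_iff[of t "char_foot x t" y]
    char_foot[of t x] assms by auto

lemma char_foot_reflect:
  assumes "0 \<le> t" "0 < x" "x < 2*pi"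
  shows "char_foot (2*pi - x) t = 2*pi - char_foot x t"
proof -
  have "char_foot (char_pos (2*pi - char_foot x t) t) t = 2*pi - char_foot x t"
    by (rule char_foot_unique) (use assms char_foot[OF assms] in \<open>auto simp: char_alive_reflect\<close>)
  thus ?thesis by (simp add: char_pos_reflect char_foot[OF assms])
qed

text \<open>Joint continuity by trapping: the foot stays between two fixed surviving labels
  \<open>a\<close> and \<open>b\<close> as long as \<open>x\<close> stays between their positions,
  and these move with speed at most 1.\<close>

lemma char_foot_near:
  assumes "0 \<le> t0" "0 < x0" "x0 < 2*pi" "0 < e"
  shows "\<exists>d>0. \<forall>x t. \<bar>x - x0\<bar> < d \<longrightarrow> \<bar>t - t0\<bar> < d \<longrightarrow> 0 \<le> t \<longrightarrow>
           0 < x \<and> x < 2*pi \<and> \<bar>char_foot x t - char_foot x0 t0\<bar> < e"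
proof -
  define y0 where "y0 = char_foot x0 t0"
  note f = char_foot[OF assms(1-3), folded y0_def]
  have "\<forall>\<^sub>F y in at y0. 0 < y \<and> y < 2*pi \<and> 0 < char_pos y t0 \<and> char_pos y t0 < 2*pi"
  proof -
    have c: "(\<lambda>y. char_pos y t0) \<midarrow>y0\<rightarrow> char_pos y0 t0"
      unfolding char_pos_def by (intro tendsto_intros)
    show ?thesis
      using order_tendstoD(1)[OF tendsto_ident_at, of 0 y0] order_tendstoD(2)[OF tendsto_ident_at, of y0 "2*pi"]
        order_tendstoD(1)[OF c, of 0] order_tendstoD(2)[OF c, of "2*pi"] f assms
      by (auto intro!: eventually_conj)
  qed
  then obtain r where r: "r > 0" "\<And>y. y \<noteq> y0 \<Longrightarrow> \<bar>y - y0\<bar> < r \<Longrightarrow> char_alive t0 y"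
    unfolding eventually_at char_alive_def by (auto simp: dist_real_def)
  define h where "h = min e r / 2"
  have h: "0 < h" "h < e" "h < r" using assms r by (auto simp: h_def min_def)
  define a where "a = y0 - h"
  define b where "b = y0 + h"
  have al: "char_alive t0 a" "char_alive t0 b" using r h by (auto simp: a_def b_def)
  have lt: "char_pos a t0 < x0" "x0 < char_pos b t0"
    using char_foot_less_iff[OF assms(1-3) al(1)] char_foot_less_iff[OF assms(1-3) al(2)] h f
    by (auto simp: a_def b_def y0_def)
  \<comment> \<open>The smallest of the margins. Half of it is spent on the displacement of
    \<open>x\<close>, half on the motion of \<open>a\<close> and \<open>b\<close>; the last two
    entries keep both positions inside the cell.\<close>
  define m where "m = Min {x0 - char_pos a t0, char_pos b t0 - x0, char_pos a t0, 2*pi - char_pos b t0}"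
  have m: "m > 0" "m \<le> x0 - char_pos a t0" "m \<le> char_pos b t0 - x0" "m \<le> char_pos a t0"
     "m \<le> 2*pi - char_pos b t0"
    using lt al unfolding m_def by (auto simp: char_alive_def)
  define d where "d = m / 2"
  have lip: "\<bar>char_pos y t - char_pos y t0\<bar> \<le> \<bar>t - t0\<bar>" for y t
  proof -
    have "\<bar>char_pos y t - char_pos y t0\<bar> = \<bar>t - t0\<bar> * \<bar>sin y\<bar>"
      unfolding char_pos_def abs_mult[symmetric] by (subst abs_minus_cancel[symmetric]) (simp add: algebra_simps)
    also have "\<dots> \<le> \<bar>t - t0\<bar> * 1" by (intro mult_left_mono) auto
    finally show ?thesis by simp
  qed
  show ?thesis
  proof (intro exI[of _ d] conjI allI impI)
    show "0 < d" using m by (simp add: d_def)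
    fix x t assume xt: "\<bar>x - x0\<bar> < d" "\<bar>t - t0\<bar> < d" "0 \<le> t"
    have la: "\<bar>char_pos a t - char_pos a t0\<bar> < m/2" "\<bar>char_pos b t - char_pos b t0\<bar> < m/2"
      using lip[of a t] lip[of b t] xt by (auto simp: d_def)
    have x: "char_pos a t < x" "x < char_pos b t" "0 < char_pos a t" "char_pos b t < 2*pi"
      using la xt m unfolding d_def by linarith+
    show x': "0 < x" "x < 2*pi" using x by auto
    have "char_alive t a" "char_alive t b" using x al x' by (auto simp: char_alive_def)
    hence "a < char_foot x t" "char_foot x t < b"
      using char_foot_less_iff[OF xt(3) x'] x by auto
    thus "\<bar>char_foot x t - char_foot x0 t0\<bar> < e" using h by (auto simp: a_def b_def y0_def)
  qed
qed

text \<open>The junk value 0 off the open cell makes the profile globally Borel.\<close>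

definition burg_profile :: "real \<Rightarrow> real \<Rightarrow> real" where
  "burg_profile x t = (if 0 < x \<and> x < 2*pi \<and> 0 \<le> t then - sin (char_foot x t) else 0)"

lemma burg_profile_eq: "0 \<le> t \<Longrightarrow> 0 < x \<Longrightarrow> x < 2*pi \<Longrightarrow> burg_profile x t = - sin (char_foot x t)"
  by (simp add: burg_profile_def)

lemma burg_profile_bound: "\<bar>burg_profile x t\<bar> \<le> 1"
  by (simp add: burg_profile_def)

lemma burg_profile_reflect:
  assumes "0 \<le> t" "0 < x" "x < 2*pi"
  shows "burg_profile (2*pi - x) t = - burg_profile x t"
  using char_foot_reflect[OF assms] assms by (simp add: burg_profile_def sin_diff)

lemma char_foot_0: "0 < x \<Longrightarrow> x < 2*pi \<Longrightarrow> char_foot x 0 = x"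
  using char_foot(3)[of 0 x] by (simp add: char_pos_def)

lemma abs_sin_diff_le: "\<bar>sin a - sin b\<bar> \<le> \<bar>a - (b::real)\<bar>"
proof -
  have "\<bar>sin a - sin b\<bar> = 2 * \<bar>sin ((a - b)/2)\<bar> * \<bar>cos ((a + b)/2)\<bar>"
    by (simp add: sin_diff_sin abs_mult)
  also have "\<dots> \<le> 2 * \<bar>(a - b)/2\<bar> * 1"
    by (intro mult_mono abs_sin_x_le_abs_x) auto
  finally show ?thesis by simp
qed

lemma continuous_on_burg_profile:
  "continuous_on ({0<..<2*pi} \<times> {0..}) (\<lambda>p. burg_profile (fst p) (snd p))"
proof -
  have "continuous_on ({0<..<2*pi} \<times> {0..}) (\<lambda>p. char_foot (fst p) (snd p))"
    unfolding continuous_on_iff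
  proof (intro ballI allI impI)
    fix p :: "real \<times> real" and e :: real assume p: "p \<in> {0<..<2*pi} \<times> {0..}" "0 < e"
    then obtain d where d: "d > 0" "\<forall>x t. \<bar>x - fst p\<bar> < d \<longrightarrow> \<bar>t - snd p\<bar> < d \<longrightarrow> 0 \<le> t \<longrightarrow>
           0 < x \<and> x < 2*pi \<and> \<bar>char_foot x t - char_foot (fst p) (snd p)\<bar> < e"
      using char_foot_near[of "snd p" "fst p" e] by auto
    show "\<exists>d>0. \<forall>x'\<in>{0<..<2*pi} \<times> {0..}. dist x' p < d \<longrightarrow>
        dist (char_foot (fst x') (snd x')) (char_foot (fst p) (snd p)) < e"
    proof (intro exI[of _ d] conjI ballI impI)
      fix x' assume "x' \<in> {0<..<2*pi} \<times> {0::real..}" "dist x' p < d"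
      thus "dist (char_foot (fst x') (snd x')) (char_foot (fst p) (snd p)) < e"
        using d dist_fst_le[of x' p] dist_snd_le[of x' p] by (auto simp: dist_real_def)
    qed (use d in auto)
  qed
  hence "continuous_on ({0<..<2*pi} \<times> {0..}) (\<lambda>p. - sin (char_foot (fst p) (snd p)))"
    by (intro continuous_intros)
  thus ?thesis by (rule continuous_on_cong[THEN iffD1, OF refl, rotated]) (auto simp: burg_profile_eq)
qed

lemma burg_profile_measurable [measurable]:
  "(\<lambda>p. burg_profile (fst p) (snd p)) \<in> borel_measurable borel"
proof -
  have "{0<..<2*pi} \<times> {0::real..} \<in> sets (borel :: (real \<times> real) measure)"
    by (subst borel_prod[symmetric]) (intro pair_measureI; simp)
  from borel_measurable_continuous_on_indicator[OF this continuous_on_burg_profile]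
  show ?thesis
    by (rule subst[where P="\<lambda>f. f \<in> borel_measurable borel", rotated])
       (auto simp: fun_eq_iff burg_profile_def indicator_def)
qed

text \<open>The traces are \<open>-k\<close> and \<open>k\<close> with \<open>k = sin Y\<close>,
  where \<open>Y\<close> is the infimum of the labels surviving at \<open>t0\<close>. Close to the
  shock the foot is trapped near \<open>Y\<close>: a label slightly above \<open>Y\<close> survives
  with a margin, a label below \<open>Y\<close> is absorbed with a margin, and both margins persist
  for nearby times.\<close>

lemma burg_profile_shock_limit:
  assumes "0 \<le> t0" "0 < e"
  shows "\<exists>k. 0 \<le> k \<and> k \<le> 1 \<and> (\<exists>d>0. \<forall>x t. 0 < x \<longrightarrow> x < d \<longrightarrow> \<bar>t - t0\<bar> < d \<longrightarrow> 0 \<le> t \<longrightarrow>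
           \<bar>burg_profile x t + k\<bar> < e \<and> \<bar>burg_profile (2*pi - x) t - k\<bar> < e)"
proof -
  define Y where "Y = Inf {y. char_alive t0 y}"
  have ne: "char_alive t0 pi" by (auto simp: char_alive_def char_pos_def)
  have bdd: "bdd_below {y. char_alive t0 y}" by (rule bdd_belowI[of _ 0]) (auto simp: char_alive_def)
  have "Y \<le> pi" unfolding Y_def using ne bdd by (intro cInf_lower) auto
  moreover have "0 \<le> Y" unfolding Y_def using ne by (intro cInf_greatest) (auto simp: char_alive_def)
  ultimately have Y: "0 \<le> Y" "Y \<le> pi" by auto
  have up: "\<exists>d>0. d < pi \<and> (\<forall>x t. 0 < x \<longrightarrow> x < d \<longrightarrow> \<bar>t - t0\<bar> < d \<longrightarrow> 0 \<le> t \<longrightarrow> char_foot x t < Y + e)"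
  proof -
    obtain b where b: "char_alive t0 b" "b < Y + e" "b \<le> pi"
    proof -
      have "\<exists>b\<in>{y. char_alive t0 y}. b < Y + e"
        unfolding Y_def using ne assms bdd by (subst cInf_less_iff[symmetric]) auto
      then obtain b where b: "char_alive t0 b" "b < Y + e" by auto
      show ?thesis using that[of "min b pi"] b ne by (auto simp: min_def)
    qed
    define m where "m = char_pos b t0"
    have m: "0 < m" using b by (auto simp: m_def char_alive_def)
    show ?thesis
    proof (intro exI[of _ "min (m/2) 1"] conjI allI impI)
      show "0 < min (m/2) 1" using m by auto
      show "min (m/2) 1 < pi" using pi_gt3 by auto
      fix x t assume xt: "0 < x" "x < min (m/2) 1" "\<bar>t - t0\<bar> < min (m/2) 1" "0 \<le> t"
      have b0: "0 \<le> sin b" using b by (auto intro!: sin_ge_zero simp: char_alive_def)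
      have "char_pos b t = m + (t0 - t) * sin b" by (simp add: m_def char_pos_def algebra_simps)
      moreover have "\<bar>(t0 - t) * sin b\<bar> \<le> \<bar>t0 - t\<bar> * 1" unfolding abs_mult by (intro mult_left_mono) auto
      from abs_le_D2[OF this] have "- ((t0 - t) * sin b) \<le> \<bar>t0 - t\<bar>" by simp
      moreover have "\<bar>t0 - t\<bar> < m/2" using xt by (simp add: abs_minus_commute)
      ultimately have c: "m/2 < char_pos b t" by linarith
      have "char_pos b t \<le> b" using b0 xt by (simp add: char_pos_def)
      hence "char_alive t b" using b c m unfolding char_alive_def using pi_gt3 by auto
      moreover have "x < 2*pi" using xt pi_gt3 by auto
      ultimately have "char_foot x t < b" using char_foot_less_iff[of t x b] xt c by auto
      thus "char_foot x t < Y + e" using b by simp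
    qed
  qed
  have lo: "\<exists>d>0. \<forall>x t. 0 < x \<longrightarrow> x < 2*pi \<longrightarrow> \<bar>t - t0\<bar> < d \<longrightarrow> 0 \<le> t \<longrightarrow> Y - e < char_foot x t"
  proof (cases "Y - e \<le> 0")
    case True
    show ?thesis
    proof (intro exI[of _ 1] conjI allI impI)
      fix x t assume "0 < x" "x < 2*pi" "\<bar>t - t0\<bar> < 1" "0 \<le> t"
      thus "Y - e < char_foot x t" using char_foot(1)[of t x] True by linarith
    qed simp
  next
    case False
    define a where "a = Y - e"
    \<comment> \<open>Absorption of \<open>b\<close> gives only the weak inequality
      \<open>b \<le> t0 * sin b\<close>. The strict decrease of \<open>sin y / y\<close> makes it
      strict at the smaller label \<open>a\<close>, and a strict inequality survives a small change
      of \<open>t\<close>.\<close>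
    define b where "b = Y - e/2"
    have ab: "0 < a" "a < b" "b < Y" "b \<le> pi" using False assms Y by (auto simp: a_def b_def)
    have "\<not> char_alive t0 b"
    proof
      assume "char_alive t0 b"
      hence "Y \<le> b" unfolding Y_def using bdd by (auto intro: cInf_lower)
      thus False using ab by simp
    qed
    moreover have "0 \<le> sin b" using ab by (auto intro!: sin_ge_zero)
    hence "char_pos b t0 \<le> b" using assms by (simp add: char_pos_def)
    ultimately have "char_pos b t0 \<le> 0" using ab pi_gt3 unfolding char_alive_def by auto
    hence bt: "b \<le> t0 * sin b" by (simp add: char_pos_def)
    hence "t0 > 0" using assms ab by (cases "t0 = 0") auto
    have "b * a \<le> t0 * (a * sin b)" using bt ab by (simp add: mult_right_mono mult.commute mult.left_commute)
    also have "\<dots> < t0 * (b * sin a)"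
      using \<open>t0 > 0\<close> sin_ratio_strict_decreasing[OF ab(1,2,4)] by (intro mult_strict_left_mono) auto
    finally have "b * a < b * (t0 * sin a)" by (simp add: algebra_simps)
    hence "a < t0 * sin a" using ab by (simp only: mult_less_cancel_left_pos)
    then have m: "0 < t0 * sin a - a" by simp
    show ?thesis
    proof (intro exI[of _ "t0 * sin a - a"] conjI allI impI m)
      fix x t assume xt: "0 < x" "x < 2*pi" "\<bar>t - t0\<bar> < t0 * sin a - a" "0 \<le> t"
      have "\<bar>(t0 - t) * sin a\<bar> \<le> \<bar>t0 - t\<bar> * 1" unfolding abs_mult by (intro mult_left_mono) auto
      from abs_le_D1[OF this] have "(t0 - t) * sin a \<le> \<bar>t - t0\<bar>" by (simp add: abs_minus_commute)
      moreover have "char_pos a t = a - t0 * sin a + (t0 - t) * sin a" by (simp add: char_pos_def algebra_simps)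
      ultimately have "char_pos a t < 0" using xt by linarith
      note f = char_foot[OF xt(4,1,2)]
      show "Y - e < char_foot x t"
      proof (rule ccontr)
        assume "\<not> Y - e < char_foot x t"
        hence "0 < char_pos a t" using char_pos_pos_mono[of t "char_foot x t" a] f xt ab by (auto simp: a_def)
        thus False using \<open>char_pos a t < 0\<close> by simp
      qed
    qed
  qed
  obtain d1 d2 where d: "d1 > 0" "d1 < pi" "d2 > 0"
    "\<And>x t. 0 < x \<Longrightarrow> x < d1 \<Longrightarrow> \<bar>t - t0\<bar> < d1 \<Longrightarrow> 0 \<le> t \<Longrightarrow> char_foot x t < Y + e"
    "\<And>x t. 0 < x \<Longrightarrow> x < 2*pi \<Longrightarrow> \<bar>t - t0\<bar> < d2 \<Longrightarrow> 0 \<le> t \<Longrightarrow> Y - e < char_foot x t"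
    using up lo by blast
  have "\<bar>burg_profile x t + sin Y\<bar> < e \<and> \<bar>burg_profile (2*pi - x) t - sin Y\<bar> < e"
    if xt: "0 < x" "x < min d1 d2" "\<bar>t - t0\<bar> < min d1 d2" "0 \<le> t" for x t
  proof -
    have x: "x < 2*pi" using xt d pi_gt3 by auto
    have "\<bar>char_foot x t - Y\<bar> < e" using d(4)[of x t] d(5)[of x t] xt x by auto
    moreover have "\<bar>burg_profile x t + sin Y\<bar> \<le> \<bar>char_foot x t - Y\<bar>"
      using abs_sin_diff_le[of Y "char_foot x t"] xt x by (simp add: burg_profile_eq)
    ultimately show ?thesis using burg_profile_reflect[OF xt(4,1) x] by auto
  qed
  moreover have "0 \<le> sin Y" "sin Y \<le> 1" using Y by (auto intro: sin_ge_zero)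
  ultimately show ?thesis
    using d by (intro exI[of _ "sin Y"] conjI exI[of _ "min d1 d2"]) auto
qed

subsection \<open>Averages along characteristics\<close>

definition ppart :: "real \<Rightarrow> real" where "ppart z = max 0 z"

lemma ppart_simps: "z \<le> 0 \<Longrightarrow> ppart z = 0" "0 \<le> z \<Longrightarrow> ppart z = z"
  by (auto simp: ppart_def)

lemma continuous_on_ppart [continuous_intros]:
  "continuous_on S f \<Longrightarrow> continuous_on S (\<lambda>x. ppart (f x))"
  unfolding ppart_def by (intro continuous_intros)

lemma DERIV_ppart_power:
  assumes "2 \<le> n"
  shows "((\<lambda>z. ppart z ^ n) has_real_derivative real n * ppart z ^ (n - 1)) (at z)"
proof -
  consider "z < 0" | "z > 0" | "z = 0" by linarith
  thus ?thesis
  proof cases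
    case 1
    have "((\<lambda>z. 0) has_real_derivative 0) (at z)" by simp
    hence "((\<lambda>z. ppart z ^ n) has_real_derivative 0) (at z)"
      by (rule DERIV_cong_ev[THEN iffD1, OF refl _ refl, rotated])
         (use 1 assms in \<open>auto intro!: eventually_mono[OF eventually_nhds_in_open[of "{..<0}"]] simp: ppart_def\<close>)
    moreover have "ppart z ^ (n - 1) = 0" using 1 assms by (simp add: ppart_def zero_power)
    ultimately show ?thesis by (simp only: mult_zero_right)
  next
    case 2
    have "((\<lambda>z. z ^ n) has_real_derivative real n * z ^ (n - 1)) (at z)"
      by (auto intro!: derivative_eq_intros)
    hence "((\<lambda>z. ppart z ^ n) has_real_derivative real n * z ^ (n - 1)) (at z)"
      by (rule DERIV_cong_ev[THEN iffD1, OF refl _ refl, rotated])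
         (use 2 in \<open>auto intro!: eventually_mono[OF eventually_nhds_in_open[of "{0<..}"]] simp: ppart_def\<close>)
    thus ?thesis using 2 by (simp add: ppart_def)
  next
    case 3
    have "((\<lambda>h. ppart h ^ n / h) \<longlongrightarrow> 0) (at 0)"
    proof (rule Lim_null_comparison)
      have "\<bar>ppart h ^ n / h\<bar> \<le> \<bar>h\<bar>" if "\<bar>h\<bar> < 1" "h \<noteq> 0" for h
      proof -
        have "ppart h ^ n \<le> \<bar>h\<bar> ^ n" by (intro power_mono) (auto simp: ppart_def)
        also have "\<dots> \<le> \<bar>h\<bar> ^ 2" using that assms by (intro power_decreasing) auto
        finally have "\<bar>ppart h ^ n\<bar> \<le> \<bar>h\<bar> * \<bar>h\<bar>" by (simp add: ppart_def power2_eq_square)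
        thus ?thesis using that by (simp add: field_simps)
      qed
      thus "\<forall>\<^sub>F h in at 0. norm (ppart h ^ n / h) \<le> \<bar>h\<bar>"
        unfolding eventually_at by (intro exI[of _ 1]) (auto simp: dist_real_def)
      show "((\<lambda>h. \<bar>h\<bar>) \<longlongrightarrow> 0) (at (0::real))" by (intro tendsto_eq_intros) auto
    qed
    moreover have "ppart 0 = 0" "(0::real) ^ n = 0" "(0::real) ^ (n - 1) = 0"
      using assms by (simp_all add: ppart_def zero_power)
    ultimately show ?thesis unfolding DERIV_def 3 by (simp only: add_0 diff_zero mult_zero_right \<open>((\<lambda>h. ppart h ^ n / h) \<longlongrightarrow> 0) (at 0)\<close>)
  qed
qed

text \<open>The kink of the absolute value is harmless here, as the product is the difference of the
  squares of positive and negative part. It is the primitive through which the entropy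
  \<open>\<bar>v + sin y\<bar>\<close> becomes part of an exact derivative in
  \<open>y\<close>.\<close>

lemma DERIV_abs_mult_self: "((\<lambda>w. \<bar>w\<bar> * w) has_real_derivative 2 * \<bar>w\<bar>) (at w)"
proof -
  have "((\<lambda>w. ppart w ^ 2 - ppart (- w) ^ 2) has_real_derivative
      (real 2 * ppart w ^ (2 - 1)) - (real 2 * ppart (- w) ^ (2 - 1)) * (- 1)) (at w)"
    by (intro DERIV_diff DERIV_ppart_power DERIV_chain2[where f = "\<lambda>z. ppart z ^ 2"]) (auto intro!: derivative_eq_intros)
  moreover have "(\<lambda>w. ppart w ^ 2 - ppart (- w) ^ 2) = (\<lambda>w. \<bar>w\<bar> * w)"
    by (auto simp: ppart_def power2_eq_square max_def fun_eq_iff abs_if)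
  moreover have "(real 2 * ppart w ^ (2 - 1)) - (real 2 * ppart (- w) ^ (2 - 1)) * (- 1) = 2 * \<bar>w\<bar>"
    by (auto simp: ppart_def)
  ultimately show ?thesis by simp
qed

text \<open>The next three functions are the cardinal quadratic B-spline with knots 0, 1, 2, 3
  (\<open>spline_bump\<close>), its primitive rising from 0 to 1 (\<open>spline_step\<close>) and
  its derivative (\<open>spline_slope\<close>). Degree two suffices because test functions only have
  to be continuously differentiable.\<close>

definition spline_step :: "real \<Rightarrow> real" where
  "spline_step z = (ppart z ^ 3 - 3 * ppart (z - 1) ^ 3 + 3 * ppart (z - 2) ^ 3 - ppart (z - 3) ^ 3) / 6"

definition spline_bump :: "real \<Rightarrow> real" where
  "spline_bump z = (ppart z ^ 2 - 3 * ppart (z - 1) ^ 2 + 3 * ppart (z - 2) ^ 2 - ppart (z - 3) ^ 2) / 2"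

definition spline_slope :: "real \<Rightarrow> real" where
  "spline_slope z = ppart z - 3 * ppart (z - 1) + 3 * ppart (z - 2) - ppart (z - 3)"

lemma DERIV_ppart_shift:
  assumes "2 \<le> n"
  shows "((\<lambda>z. ppart (z - c) ^ n) has_real_derivative real n * ppart (z - c) ^ (n - 1)) (at z)"
proof -
  have "((\<lambda>z. ppart (z - c) ^ n) has_real_derivative real n * ppart (z - c) ^ (n - 1) * 1) (at z)"
    by (intro DERIV_ppart_power assms DERIV_chain2[where f = "\<lambda>z. ppart z ^ n"]) (auto intro!: derivative_eq_intros)
  thus ?thesis by simp
qed

lemma DERIV_spline_step: "(spline_step has_real_derivative spline_bump z) (at z)"
proof -
  note d = DERIV_ppart_shift[of 3 _ z, simplified] DERIV_ppart_shift[of 3 0 z, simplified]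
  have "((\<lambda>z. ppart z ^ 3 - 3 * ppart (z - 1) ^ 3 + 3 * ppart (z - 2) ^ 3 - ppart (z - 3) ^ 3) has_real_derivative
    D ) (at z)" if "D = 3 * ppart z ^ 2 - 3 * (3 * ppart (z - 1) ^ 2) + 3 * (3 * ppart (z - 2) ^ 2) - 3 * ppart (z - 3) ^ 2" for D
    unfolding that by (intro DERIV_diff DERIV_add DERIV_cmult d)
  from DERIV_cdivide[OF this[OF refl], of 6] show ?thesis
    unfolding spline_step_def [abs_def] spline_bump_def by (rule DERIV_cong) (simp add: field_simps)
qed

lemma DERIV_spline_bump: "(spline_bump has_real_derivative spline_slope z) (at z)"
proof -
  note d = DERIV_ppart_shift[of 2 _ z, simplified] DERIV_ppart_shift[of 2 0 z, simplified]
  have "((\<lambda>z. ppart z ^ 2 - 3 * ppart (z - 1) ^ 2 + 3 * ppart (z - 2) ^ 2 - ppart (z - 3) ^ 2) has_real_derivative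
    D ) (at z)" if "D = 2 * ppart z - 3 * (2 * ppart (z - 1)) + 3 * (2 * ppart (z - 2)) - 2 * ppart (z - 3)" for D
    unfolding that by (intro DERIV_diff DERIV_add DERIV_cmult d)
  from DERIV_cdivide[OF this[OF refl], of 2] show ?thesis
    unfolding spline_bump_def [abs_def] spline_slope_def by (rule DERIV_cong) (simp add: field_simps)
qed

lemma continuous_on_spline_slope [continuous_intros]:
  "continuous_on S f \<Longrightarrow> continuous_on S (\<lambda>x. spline_slope (f x))"
  unfolding spline_slope_def by (intro continuous_intros)

lemma continuous_on_spline_bump [continuous_intros]:
  "continuous_on S f \<Longrightarrow> continuous_on S (\<lambda>x. spline_bump (f x))"
  unfolding spline_bump_def by (intro continuous_intros) auto

lemma continuous_on_spline_step [continuous_intros]: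
  "continuous_on S f \<Longrightarrow> continuous_on S (\<lambda>x. spline_step (f x))"
  unfolding spline_step_def by (intro continuous_intros) auto

lemma spline_bump_0: "z \<le> 0 \<or> 3 \<le> z \<Longrightarrow> spline_bump z = 0"
  by (auto simp: spline_bump_def ppart_simps power2_eq_square algebra_simps)

lemma spline_bump_bounds: "0 \<le> spline_bump z" "spline_bump z \<le> 1"
proof -
  consider "z \<le> 0" | "0 \<le> z" "z \<le> 1" | "1 \<le> z" "z \<le> 2" | "2 \<le> z" "z \<le> 3" | "3 \<le> z" by linarith
  hence "0 \<le> spline_bump z \<and> spline_bump z \<le> 1"
  proof cases
    case 2
    hence "spline_bump z = z\<^sup>2 / 2" by (simp add: spline_bump_def ppart_simps)
    moreover have "z\<^sup>2 \<le> 1" using 2 by (simp add: power_le_one)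
    ultimately show ?thesis using zero_le_power2[of z] by linarith
  next
    case 3
    hence "spline_bump z = 3/4 - (z - 3/2)\<^sup>2"
      by (simp add: spline_bump_def ppart_simps power2_eq_square field_simps)
    moreover have "\<bar>z - 3/2\<bar> \<le> 1/2" using 3 by linarith
    hence "(z - 3/2)\<^sup>2 \<le> (1/2)\<^sup>2" by (subst abs_le_square_iff[symmetric]) auto
    moreover have "(1/2 :: real)\<^sup>2 = 1/4" by (simp add: power2_eq_square)
    ultimately show ?thesis using zero_le_power2[of "z - 3/2"] by linarith
  next
    case 4
    hence "spline_bump z = (3 - z)\<^sup>2 / 2"
      by (simp add: spline_bump_def ppart_simps power2_eq_square algebra_simps)
    moreover have "(3 - z)\<^sup>2 \<le> 1" using 4 by (simp add: power_le_one)
    ultimately show ?thesis using zero_le_power2[of "3 - z"] by linarith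
  qed (auto simp: spline_bump_0)
  thus "0 \<le> spline_bump z" "spline_bump z \<le> 1" by auto
qed

lemma spline_step_ends: "z \<le> 0 \<Longrightarrow> spline_step z = 0" "3 \<le> z \<Longrightarrow> spline_step z = 1"
  by (auto simp: spline_step_def ppart_simps power3_eq_cube algebra_simps)

lemma spline_step_mono: "z \<le> w \<Longrightarrow> spline_step z \<le> spline_step w"
  by (rule DERIV_nonneg_imp_nondecreasing) (use DERIV_spline_step spline_bump_bounds in blast)+

lemma spline_step_bounds: "0 \<le> spline_step z" "spline_step z \<le> 1"
  using spline_step_mono[of "min z 0" z] spline_step_mono[of z "max z 3"]
    spline_step_ends[of "min z 0"] spline_step_ends[of "max z 3"] by auto

section \<open>The Kruzhkov flux and averaging over labels\<close>

definition kruzkov_flux :: "real \<Rightarrow> real \<Rightarrow> real" where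
  "kruzkov_flux v k = sgn (v - k) * (burg_flux v - burg_flux k)"

text \<open>A form without \<open>sgn\<close>, from which continuity and measurability can be read
  off.\<close>

lemma kruzkov_flux_eq: "kruzkov_flux v k = \<bar>v - k\<bar> * ((v + k) / 2)"
  by (auto simp: kruzkov_flux_def burg_flux_def sgn_if power2_eq_square algebra_simps)

lemma kruzkov_flux_bound:
  assumes "\<bar>v\<bar> \<le> M" "\<bar>k\<bar> \<le> 1"
  shows "\<bar>kruzkov_flux v k\<bar> \<le> (M + 1)\<^sup>2"
proof -
  have "\<bar>v - k\<bar> \<le> M + 1" "\<bar>(v + k)/2\<bar> \<le> M + 1" using assms by auto
  hence "\<bar>kruzkov_flux v k\<bar> \<le> (M + 1) * (M + 1)"
    unfolding kruzkov_flux_eq abs_mult by (intro mult_mono) auto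
  thus ?thesis by (simp add: power2_eq_square)
qed

text \<open>A test function concentrated on the characteristic from \<open>y\<close>; the Jacobian factor makes the
  terms in which \<open>spline_slope\<close> occurs an exact \<open>y\<close>-derivative.\<close>

definition char_kernel :: "real \<Rightarrow> real \<Rightarrow> real \<Rightarrow> real \<Rightarrow> real" where
  "char_kernel h x t y = (1 - t * cos y) * (spline_bump ((x - char_pos y t) / h) / h)"

text \<open>A weighted mean of \<open>g\<close> over the labels whose characteristics pass just to
  the left of \<open>x\<close> at time \<open>t\<close>. As \<open>h\<close> tends to 0 it
  concentrates at the foot of \<open>x\<close>.\<close>

definition char_mean :: "real \<Rightarrow> real \<Rightarrow> real \<Rightarrow> (real \<Rightarrow> real) \<Rightarrow> real" where
  "char_mean h x t g = (\<integral>y. (char_kernel h x t y * g y) * indicator {0..2*pi} y \<partial>lborel)"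

text \<open>The bump is one-sided: it vanishes unless
  \<open>char_pos y t < x < char_pos y t + 3*h\<close>. With \<open>3*h < x < 2*pi\<close> this
  forces the position into the open cell, so only surviving labels are seen.\<close>

lemma char_kernel_support:
  assumes "0 \<le> t" "0 < h" "3*h < x" "x < 2*pi" "0 \<le> y" "y \<le> 2*pi"
    "spline_bump ((x - char_pos y t) / h) \<noteq> 0"
  shows "char_alive t y" "0 < 1 - t * cos y" "\<bar>char_pos y t - x\<bar> < 3*h"
proof -
  have "0 < (x - char_pos y t)/h" "(x - char_pos y t)/h < 3" using spline_bump_0 assms(7) by (meson not_le)+
  hence p: "char_pos y t < x" "x < char_pos y t + 3*h" using assms by (auto simp: field_simps)
  have "y \<noteq> 0" "y \<noteq> 2*pi" using p assms by (auto simp: char_pos_def)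
  thus a: "char_alive t y" using p assms by (auto simp: char_alive_def)
  show "0 < 1 - t * cos y" using char_alive_between(2)[OF assms(1) a a] by simp
  show "\<bar>char_pos y t - x\<bar> < 3*h" using p assms by auto
qed

lemma char_kernel_nonneg:
  assumes "0 \<le> t" "0 < h" "3*h < x" "x < 2*pi" "0 \<le> y" "y \<le> 2*pi"
  shows "0 \<le> char_kernel h x t y"
proof (cases "spline_bump ((x - char_pos y t) / h) = 0")
  case False
  thus ?thesis using char_kernel_support[OF assms False] spline_bump_bounds assms
    unfolding char_kernel_def by (intro mult_nonneg_nonneg divide_nonneg_nonneg) auto
qed (simp add: char_kernel_def)

lemma continuous_char_kernel: "0 < h \<Longrightarrow> continuous_on UNIV (char_kernel h x t)"
  unfolding char_kernel_def char_pos_def by (intro continuous_intros) auto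

text \<open>The Jacobian makes the kernel the exact \<open>y\<close>-derivative of
  \<open>- spline_step ((x - char_pos y t) / h)\<close>. Both ends of the label interval lie outside
  the ramp, one on each side.\<close>

lemma char_kernel_integral:
  assumes "0 \<le> t" "0 < h" "3*h < x" "x < 2*pi"
  shows "(\<integral>y. char_kernel h x t y * indicator {0..2*pi} y \<partial>lborel) = 1"
proof -
  have "(\<integral>y. char_kernel h x t y * indicator {0..2*pi} y \<partial>lborel)
    = - spline_step ((x - char_pos (2*pi) t) / h) - (- spline_step ((x - char_pos 0 t) / h))"
  proof (rule integral_FTC_Icc_real)
    fix y :: real
    have "((\<lambda>y. (x - char_pos y t) / h) has_real_derivative - ((1 - t * cos y) / h)) (at y)"
      unfolding char_pos_def using assms by (auto intro!: derivative_eq_intros simp: field_simps)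
    from DERIV_chain2[OF DERIV_spline_step this]
    show "((\<lambda>y. - spline_step ((x - char_pos y t) / h)) has_real_derivative char_kernel h x t y) (at y)"
      using assms by (auto intro!: derivative_eq_intros simp: char_kernel_def)
    show "isCont (char_kernel h x t) y"
      using continuous_char_kernel[of h x t] assms by (simp add: continuous_on_eq_continuous_at)
  qed simp
  moreover have "spline_step ((x - char_pos (2*pi) t) / h) = 0"
    using assms by (intro spline_step_ends) (auto simp: char_pos_def field_simps)
  moreover have "spline_step ((x - char_pos 0 t) / h) = 1"
    using assms by (intro spline_step_ends) (auto simp: char_pos_def field_simps)
  ultimately show ?thesis by simp
qed

lemma integrable_char_kernel_mult:
  assumes "0 < h" "continuous_on UNIV g"
  shows "integrable lborel (\<lambda>y. (char_kernel h x t y * g y) * indicator {0..2*pi} y)"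
proof -
  have "continuous_on UNIV (\<lambda>y. char_kernel h x t y * g y)"
    by (intro continuous_on_mult continuous_char_kernel assms)
  hence "\<And>y. isCont (\<lambda>y. char_kernel h x t y * g y) y" by (simp add: continuous_on_eq_continuous_at)
  thus ?thesis by (intro borel_integrable_atLeastAtMost) auto
qed

text \<open>The kernel is a probability density in the label, so a bound for \<open>g\<close> on its
  support is a bound for the mean.\<close>

lemma char_mean_diff_le:
  assumes "0 \<le> t" "0 < h" "3*h < x" "x < 2*pi" "continuous_on UNIV g"
    and "\<And>y. 0 \<le> y \<Longrightarrow> y \<le> 2*pi \<Longrightarrow> char_kernel h x t y \<noteq> 0 \<Longrightarrow> \<bar>g y - c\<bar> \<le> e"
  shows "\<bar>char_mean h x t g - c\<bar> \<le> e"
proof -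
  let ?k = "\<lambda>y. char_kernel h x t y * indicator {0..2*pi} y"
  have i1: "integrable lborel ?k" using integrable_char_kernel_mult[OF assms(2), of "\<lambda>_. 1"] by simp
  have c: "c = (\<integral>y. ?k y * c \<partial>lborel)" "e = (\<integral>y. ?k y * e \<partial>lborel)"
    using char_kernel_integral[OF assms(1-4)] by simp_all
  have eq: "char_mean h x t g - c = (\<integral>y. (char_kernel h x t y * g y) * indicator {0..2*pi} y - ?k y * c \<partial>lborel)"
    unfolding char_mean_def
    by (subst (1) c(1), subst Bochner_Integration.integral_diff)
       (use i1 integrable_char_kernel_mult[OF assms(2,5)] in auto)
  have "\<bar>char_mean h x t g - c\<bar> \<le> (\<integral>y. \<bar>(char_kernel h x t y * g y) * indicator {0..2*pi} y - ?k y * c\<bar> \<partial>lborel)"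
    unfolding eq by (rule integral_abs_bound)
  also have "\<dots> \<le> (\<integral>y. ?k y * e \<partial>lborel)"
  proof (rule integral_mono)
    show "integrable lborel (\<lambda>y. ?k y * e)" by (intro integrable_mult_left i1)
    show "integrable lborel (\<lambda>y. \<bar>(char_kernel h x t y * g y) * indicator {0..2*pi} y - ?k y * c\<bar>)"
      by (intro integrable_abs Bochner_Integration.integrable_diff integrable_mult_left i1
          integrable_char_kernel_mult[OF assms(2,5)])
    fix y
    show "\<bar>(char_kernel h x t y * g y) * indicator {0..2*pi} y - ?k y * c\<bar> \<le> ?k y * e"
    proof (cases "y \<in> {0..2*pi} \<and> char_kernel h x t y \<noteq> 0")
      case True
      hence "\<bar>g y - c\<bar> \<le> e" "0 \<le> char_kernel h x t y"
        using assms(6)[of y] char_kernel_nonneg[OF assms(1-4)] by auto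
      hence "\<bar>char_kernel h x t y * (g y - c)\<bar> \<le> char_kernel h x t y * e"
        unfolding abs_mult by (intro mult_mono) auto
      thus ?thesis using True by (simp add: right_diff_distrib)
    qed (auto split: split_indicator)
  qed
  also have "\<dots> = e" using c by simp
  finally show ?thesis .
qed

lemma char_mean_bound:
  assumes "0 \<le> t" "0 < h" "3*h < x" "x < 2*pi" "continuous_on UNIV g" "\<And>y. \<bar>g y\<bar> \<le> B"
  shows "\<bar>char_mean h x t g\<bar> \<le> B"
  using char_mean_diff_le[OF assms(1-5), of 0 B] assms(6) by simp

text \<open>Each label in the support is the foot of its own position, which is within
  \<open>3*h\<close> of \<open>x\<close>. Continuity of the foot in \<open>x\<close> then brings the
  label close to the foot of \<open>x\<close>.\<close>

lemma char_mean_tendsto: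
  assumes "0 \<le> t" "0 < x" "x < 2*pi" "continuous_on UNIV g"
    and "\<And>n. 0 < h n" "h \<longlonglongrightarrow> 0"
  shows "(\<lambda>n. char_mean (h n) x t g) \<longlonglongrightarrow> g (char_foot x t)"
proof (rule LIMSEQ_I)
  fix r :: real assume "0 < r"
  let ?y = "char_foot x t"
  have "isCont g ?y" using assms(4) by (simp add: continuous_on_eq_continuous_at)
  then obtain e where e: "0 < e" "\<And>y. \<bar>y - ?y\<bar> < e \<Longrightarrow> \<bar>g y - g ?y\<bar> < r/2"
    using \<open>0 < r\<close> unfolding continuous_at_eps_delta dist_real_def by (metis half_gt_zero)
  obtain d where d: "d > 0" "\<And>x'. \<bar>x' - x\<bar> < d \<Longrightarrow> \<bar>char_foot x' t - ?y\<bar> < e"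
    using char_foot_near[OF assms(1-3) e(1)] assms(1) by (metis abs_zero diff_self)
  have "\<forall>\<^sub>F n in sequentially. h n < min d x / 3"
    using order_tendstoD(2)[OF assms(6), of "min d x / 3"] d assms(2) by simp
  then obtain N where N: "\<And>n. N \<le> n \<Longrightarrow> h n < min d x / 3" by (auto simp: eventually_sequentially)
  show "\<exists>no. \<forall>n\<ge>no. norm (char_mean (h n) x t g - g ?y) < r"
  proof (intro exI[of _ N] allI impI)
    fix n assume "N \<le> n"
    hence h: "3 * h n < d" "3 * h n < x" using N[of n] by auto
    have "\<bar>char_mean (h n) x t g - g ?y\<bar> \<le> r/2"
    proof (rule char_mean_diff_le[OF assms(1) assms(5) h(2) assms(3,4)])
      fix y assume y: "0 \<le> y" "y \<le> 2*pi" "char_kernel (h n) x t y \<noteq> 0"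
      have s: "spline_bump ((x - char_pos y t) / h n) \<noteq> 0" using y(3) by (auto simp: char_kernel_def)
      note ks = char_kernel_support[OF assms(1) assms(5) h(2) assms(3) y(1,2) s]
      have "char_foot (char_pos y t) t = y" using char_foot_unique assms(1) ks by blast
      thus "\<bar>g y - g ?y\<bar> \<le> r/2" using e(2)[of y] d(2)[of "char_pos y t"] ks h by force
    qed
    thus "norm (char_mean (h n) x t g - g ?y) < r" using \<open>0 < r\<close> by simp
  qed
qed

subsection \<open>Kruzhkov inequalities\<close>

definition c1_bump :: "(real \<Rightarrow> real) \<Rightarrow> (real \<Rightarrow> real) \<Rightarrow> real \<Rightarrow> real \<Rightarrow> bool" where
  "c1_bump f f' a b \<longleftrightarrow> (\<forall>x. (f has_real_derivative f' x) (at x)) \<and> continuous_on UNIV f' \<and>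
     (\<forall>x. 0 \<le> f x) \<and> (\<forall>x. x < a \<or> b < x \<longrightarrow> f x = 0 \<and> f' x = 0)"

lemma c1_bump_continuous:
  assumes "c1_bump f f' a b"
  shows "continuous_on S f" "continuous_on S f'"
proof -
  show "continuous_on S f"
    using assms unfolding c1_bump_def by (intro DERIV_continuous_on) (auto intro: has_field_derivative_at_within)
  show "continuous_on S f'"
    using assms unfolding c1_bump_def by (auto intro: continuous_on_subset)
qed

lemma integrable_compact_support:
  fixes f :: "'a::euclidean_space \<Rightarrow> real"
  assumes "f \<in> borel_measurable borel" "compact K" "\<And>x. x \<notin> K \<Longrightarrow> f x = 0"
    and "\<And>x. x \<in> K \<Longrightarrow> \<bar>f x\<bar> \<le> B"
  shows "integrable lborel f"
proof (rule integrableI_bounded_set[of K _ _ B])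
  show "emeasure lborel K < \<infinity>"
    using emeasure_bounded_finite[OF compact_imp_bounded[OF assms(2)]] by (simp add: less_top)
qed (use assms in \<open>auto intro: borel_compact\<close>)

lemma continuous_compact_bound:
  fixes f :: "'a::topological_space \<Rightarrow> real"
  assumes "compact K" "continuous_on K f"
  obtains B where "\<And>x. x \<in> K \<Longrightarrow> \<bar>f x\<bar> \<le> B" "0 \<le> B"
proof -
  have "bounded (f ` K)" by (intro compact_imp_bounded compact_continuous_image assms)
  then obtain B where "\<forall>x\<in>K. \<bar>f x\<bar> \<le> B" unfolding bounded_iff by auto
  thus ?thesis using that[of "max B 0"] by force
qed

text \<open>With \<open>w = v + sin y\<close> the integrand is the \<open>y\<close>-derivative of
  \<open>- (1/2) * \<bar>w\<bar> * w\<close> times the scaled bump. The term with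
  \<open>cos y\<close> is the time derivative of the Jacobian; the term with
  \<open>spline_slope\<close> joins the entropy times the speed \<open>sin y\<close> and the flux
  \<open>\<bar>w\<bar> * (v - sin y) / 2\<close>. The bump vanishes at both ends.\<close>

lemma char_entropy_exact:
  assumes "0 < h" "3*h < x" "x < 2*pi"
  shows "(\<integral>y. (- \<bar>v + sin y\<bar> * cos y * (spline_bump ((x - char_pos y t)/h) / h)
    + \<bar>v + sin y\<bar> * (v + sin y) / 2 * ((1 - t * cos y) * (spline_slope ((x - char_pos y t)/h) / h^2)))
    * indicator {0..2*pi} y \<partial>lborel) = 0" (is "(\<integral>y. ?D y * _ \<partial>lborel) = 0")
proof -
  let ?G = "\<lambda>y. - (1/2) * (\<bar>v + sin y\<bar> * (v + sin y)) * (spline_bump ((x - char_pos y t)/h) / h)"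
  have "(\<integral>y. ?D y * indicator {0..2*pi} y \<partial>lborel) = ?G (2*pi) - ?G 0"
  proof (rule integral_FTC_Icc_real)
    fix y :: real
    have "((\<lambda>y. v + sin y) has_real_derivative cos y) (at y)" by (auto intro!: derivative_eq_intros)
    note d1 = DERIV_chain2[OF DERIV_abs_mult_self this]
    have "((\<lambda>y. (x - char_pos y t) / h) has_real_derivative - ((1 - t * cos y) / h)) (at y)"
      unfolding char_pos_def using assms by (auto intro!: derivative_eq_intros simp: field_simps)
    note d2 = DERIV_chain2[OF DERIV_spline_bump this]
    show "(?G has_real_derivative ?D y) (at y)"
      by (rule DERIV_cong[OF DERIV_mult[OF DERIV_cmult[OF d1] DERIV_cdivide[OF d2]]])
         (use assms in \<open>simp add: field_simps power2_eq_square\<close>)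
    have "continuous_on UNIV ?D" unfolding char_pos_def using assms by (intro continuous_intros) auto
    thus "isCont ?D y" by (simp add: continuous_on_eq_continuous_at)
  qed simp
  moreover have "spline_bump ((x - char_pos (2*pi) t)/h) = 0"
    using assms by (intro spline_bump_0) (auto simp: char_pos_def field_simps)
  moreover have "spline_bump ((x - char_pos 0 t)/h) = 0"
    using assms by (intro spline_bump_0) (auto simp: char_pos_def field_simps)
  ultimately show ?thesis by simp
qed

text \<open>Only what the contraction inequality consumes. Time continuity and the initial datum
  come in a later extension.\<close>

locale kruzkov_solution =
  fixes u :: "real \<Rightarrow> real \<Rightarrow> real" and M :: real
  assumes periodic: "u (x + 2*pi) t = u x t"
    and measurable_pair [measurable]: "(\<lambda>p. u (fst p) (snd p)) \<in> borel_measurable borel"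
    and bound: "0 \<le> t \<Longrightarrow> \<bar>u x t\<bar> \<le> M"
    and entropy: "nonneg_test_fun ph phx pht \<Longrightarrow>
      0 \<le> (\<integral>p. \<bar>u (fst p) (snd p) - k\<bar> * pht (fst p) (snd p)
            + kruzkov_flux (u (fst p) (snd p)) k * phx (fst p) (snd p) \<partial>lborel)"
begin

text \<open>For each label the Kruzhkov inequality holds with its own constant and test function;
  integrating over the labels removes every term of order \<open>1/h^2\<close>, and only the
  derivatives of the cut-offs \<open>th\<close> and \<open>ch\<close> are left. This makes the limit
  of small \<open>h\<close> possible.\<close>

lemma averaged_entropy:
  assumes th: "c1_bump th th' a b" "0 < a" and ch: "c1_bump ch ch' d (2*pi - d)" "0 < h" "3*h < d"
  shows "0 \<le> (\<integral>p. th' (snd p) * ch (fst p) * char_mean h (fst p) (snd p) (\<lambda>y. \<bar>u (fst p) (snd p) + sin y\<bar>)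
     + th (snd p) * ch' (fst p) * char_mean h (fst p) (snd p) (\<lambda>y. kruzkov_flux (u (fst p) (snd p)) (- sin y)) \<partial>lborel)"
proof -
  note [continuous_intros] = continuous_on_compose2[OF c1_bump_continuous(1)[OF th(1)]]
    continuous_on_compose2[OF c1_bump_continuous(2)[OF th(1)]]
    continuous_on_compose2[OF c1_bump_continuous(1)[OF ch(1)]]
    continuous_on_compose2[OF c1_bump_continuous(2)[OF ch(1)]]
  note thD = th(1)[unfolded c1_bump_def] and chD = ch(1)[unfolded c1_bump_def]
  define J where "J y t = 1 - t * cos y" for y t :: real
  define bu where "bu y x t = spline_bump ((x - char_pos y t) / h) / h" for y x t
  define sl where "sl y x t = spline_slope ((x - char_pos y t) / h) / h^2" for y x t
  define ph where "ph y x t = J y t * th t * ch x * bu y x t" for y x t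
  define phx where "phx y x t = J y t * th t * (ch' x * bu y x t + ch x * sl y x t)" for y x t
  define pht where "pht y x t = ch x * (- cos y * th t * bu y x t
      + J y t * (th' t * bu y x t + th t * (sl y x t * sin y)))" for y x t
  have cont: "continuous_on UNIV (\<lambda>q. phx (fst q) (fst (snd q)) (snd (snd q)))"
     "continuous_on UNIV (\<lambda>q. pht (fst q) (fst (snd q)) (snd (snd q)))"
    unfolding phx_def pht_def J_def bu_def sl_def char_pos_def using ch(2)
    by (auto intro!: continuous_intros)
  have dz: "((\<lambda>x. (x - char_pos y t) / h) has_real_derivative 1 / h) (at x)"
    "((\<lambda>t. (x - char_pos y t) / h) has_real_derivative sin y / h) (at t)" for x y t
    unfolding char_pos_def using ch(2) by (auto intro!: derivative_eq_intros)
  have dbx: "((\<lambda>x. bu y x t) has_real_derivative sl y x t) (at x)" for x y t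
    unfolding bu_def sl_def
    by (rule DERIV_cong[OF DERIV_cdivide[OF DERIV_chain2[OF DERIV_spline_bump dz(1)]]])
       (use ch(2) in \<open>simp add: power2_eq_square\<close>)
  have dbt: "((\<lambda>t. bu y x t) has_real_derivative sl y x t * sin y) (at t)" for x y t
    unfolding bu_def sl_def
    by (rule DERIV_cong[OF DERIV_cdivide[OF DERIV_chain2[OF DERIV_spline_bump dz(2)]]])
       (use ch(2) in \<open>simp add: power2_eq_square\<close>)
  \<comment> \<open>The Jacobian is negative for some absorbed labels. Where \<open>th\<close> and
    \<open>ch\<close> are both nonzero, \<open>3*h < x < 2*pi\<close> holds, so the bump vanishes at
    such labels.\<close>
  have test: "nonneg_test_fun (ph y) (phx y) (pht y)" if y: "0 \<le> y" "y \<le> 2*pi" for y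
    unfolding nonneg_test_fun_def
  proof (intro conjI allI)
    fix x t
    show "0 \<le> ph y x t"
    proof (cases "th t = 0 \<or> ch x = 0")
      case False
      hence "a \<le> t" "d \<le> x" "x \<le> 2*pi - d" using thD chD by (meson not_le)+
      hence "0 \<le> char_kernel h x t y" using th ch y by (intro char_kernel_nonneg) auto
      hence "0 \<le> char_kernel h x t y * (th t * ch x)" using thD chD by simp
      thus ?thesis by (simp add: ph_def char_kernel_def J_def bu_def mult_ac)
    qed (auto simp: ph_def)
    have dch: "(ch has_real_derivative ch' x) (at x)" using chD by blast
    show "((\<lambda>z. ph y z t) has_real_derivative phx y x t) (at x)"
      unfolding ph_def phx_def
      by (rule DERIV_cong[OF DERIV_mult[OF DERIV_cmult[OF dch] dbx]]) (simp add: algebra_simps)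
    have dth: "(th has_real_derivative th' t) (at t)" using thD by blast
    have dJ: "((\<lambda>t. J y t) has_real_derivative - cos y) (at t)"
      unfolding J_def by (auto intro!: derivative_eq_intros)
    show "((\<lambda>s. ph y x s) has_real_derivative pht y x t) (at t)"
      unfolding ph_def pht_def
      by (rule DERIV_cong[OF DERIV_mult[OF DERIV_mult[OF DERIV_mult[OF dJ dth] DERIV_const] dbt]])
         (simp add: algebra_simps)
  next
    have "continuous_on UNIV (\<lambda>p. (\<lambda>q. phx (fst q) (fst (snd q)) (snd (snd q))) (y, p))"
      by (rule continuous_on_compose2[OF cont(1)]) (auto intro!: continuous_intros)
    thus "continuous_on UNIV (\<lambda>p. phx y (fst p) (snd p))" by simp
    have "continuous_on UNIV (\<lambda>p. (\<lambda>q. pht (fst q) (fst (snd q)) (snd (snd q))) (y, p))"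
      by (rule continuous_on_compose2[OF cont(2)]) (auto intro!: continuous_intros)
    thus "continuous_on UNIV (\<lambda>p. pht y (fst p) (snd p))" by simp
  next
    have "\<bar>x\<bar> \<le> max (2*pi) b \<and> a \<le> t \<and> t \<le> max (2*pi) b" if "ph y x t \<noteq> 0" for x t
    proof -
      have "th t \<noteq> 0" "ch x \<noteq> 0" using that by (auto simp: ph_def)
      hence "a \<le> t" "t \<le> b" "d \<le> x" "x \<le> 2*pi - d" using thD chD by (meson not_le)+
      thus ?thesis using ch(2,3) by auto
    qed
    thus "\<exists>a R. 0 < a \<and> (\<forall>x t. ph y x t \<noteq> 0 \<longrightarrow> \<bar>x\<bar> \<le> R \<and> a \<le> t \<and> t \<le> R)"
      using th(2) by blast
  qed
  define F where "F y p = \<bar>u (fst p) (snd p) - (- sin y)\<bar> * pht y (fst p) (snd p)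
            + kruzkov_flux (u (fst p) (snd p)) (- sin y) * phx y (fst p) (snd p)" for y p
  define G where "G y p = F y p * indicator {0..2*pi} y" for y p
  have "0 \<le> (\<integral>y. (\<integral>p. G y p \<partial>lborel) \<partial>lborel)"
  proof (rule integral_nonneg_AE, rule AE_I2)
    fix y :: real
    show "0 \<le> (\<integral>p. G y p \<partial>lborel)"
      using entropy[OF test[of y], of "- sin y"] by (auto simp: G_def F_def split: split_indicator)
  qed
  \<comment> \<open>Fubini: the integrand lives on a compact box in label, space and time. It is
    bounded there because all times in the box are positive, so \<open>bound\<close>
    applies.\<close>
  also have "\<dots> = (\<integral>p. (\<integral>y. G y p \<partial>lborel) \<partial>lborel)"
  proof -
    let ?K = "{0..2*pi} \<times> ({d..2*pi-d} \<times> {a..b})"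
    have K: "compact ?K" by (intro compact_Times compact_Icc)
    obtain B1 where B1: "\<And>q. q \<in> ?K \<Longrightarrow> \<bar>phx (fst q) (fst (snd q)) (snd (snd q))\<bar> \<le> B1" "0 \<le> B1"
      by (rule continuous_compact_bound[OF K continuous_on_subset[OF cont(1) subset_UNIV]]) blast
    obtain B2 where B2: "\<And>q. q \<in> ?K \<Longrightarrow> \<bar>pht (fst q) (fst (snd q)) (snd (snd q))\<bar> \<le> B2" "0 \<le> B2"
      by (rule continuous_compact_bound[OF K continuous_on_subset[OF cont(2) subset_UNIV]]) blast
    have m: "(\<lambda>q. u (fst (snd q)) (snd (snd q))) \<in> borel_measurable (borel :: (real \<times> real \<times> real) measure)"
    proof -
      have "snd \<in> borel_measurable (borel :: (real \<times> real \<times> real) measure)"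
        by (intro borel_measurable_continuous_onI continuous_intros)
      from measurable_compose[OF this measurable_pair] show ?thesis .
    qed
    have sm: "(\<lambda>q. sin (fst q)) \<in> borel_measurable (borel :: (real \<times> real \<times> real) measure)"
      by (intro borel_measurable_continuous_onI continuous_intros)
    have im: "(\<lambda>q. indicator {0..2*pi} (fst q) :: real) \<in> borel_measurable (borel :: (real \<times> real \<times> real) measure)"
    proof -
      have "fst \<in> borel_measurable (borel :: (real \<times> real \<times> real) measure)"
        by (intro borel_measurable_continuous_onI continuous_intros)
      from measurable_compose[OF this borel_measurable_indicator[of "{0..2*pi}" borel]] show ?thesis by simp
    qed
    have "integrable lborel (\<lambda>q. G (fst q) (snd q))"
    proof (rule integrable_compact_support[OF _ K])
      show "(\<lambda>q. G (fst q) (snd q)) \<in> borel_measurable borel"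
        unfolding G_def F_def kruzkov_flux_eq using m sm im
          borel_measurable_continuous_onI[OF cont(1)] borel_measurable_continuous_onI[OF cont(2)]
        by (intro borel_measurable_times borel_measurable_add borel_measurable_abs borel_measurable_diff
            borel_measurable_divide borel_measurable_uminus borel_measurable_const)
      fix q :: "real \<times> real \<times> real"
      obtain y x t where q: "q = (y, x, t)" by (cases q) auto
      show "G (fst q) (snd q) = 0" if "q \<notin> ?K"
      proof (cases "y \<in> {0..2*pi}")
        case True
        hence "(th t = 0 \<and> th' t = 0) \<or> (ch x = 0 \<and> ch' x = 0)"
          using that thD chD unfolding q by (auto simp: not_le)
        thus ?thesis by (auto simp: q G_def F_def phx_def pht_def)
      qed (auto simp: q G_def)
      show "\<bar>G (fst q) (snd q)\<bar> \<le> (M + 1) * B2 + (M + 1)\<^sup>2 * B1" if qK: "q \<in> ?K"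
      proof -
        have "0 \<le> t" using qK th(2) unfolding q by auto
        hence ub: "\<bar>u x t\<bar> \<le> M" using bound by blast
        have "\<bar>u x t + sin y\<bar> \<le> M + 1" using ub abs_sin_le_one[of y] by linarith
        moreover have "\<bar>kruzkov_flux (u x t) (- sin y)\<bar> \<le> (M + 1)\<^sup>2"
          using kruzkov_flux_bound[OF ub, of "- sin y"] by simp
        ultimately have "\<bar>\<bar>u x t + sin y\<bar> * pht y x t\<bar> \<le> (M + 1) * B2"
           "\<bar>kruzkov_flux (u x t) (- sin y) * phx y x t\<bar> \<le> (M + 1)\<^sup>2 * B1"
          unfolding abs_mult using B1(1)[OF qK] B2(1)[OF qK] ub by (auto intro!: mult_mono simp: q)
        hence "\<bar>F y (x, t)\<bar> \<le> (M + 1) * B2 + (M + 1)\<^sup>2 * B1"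
          unfolding F_def by simp
        thus ?thesis using qK by (auto simp: q G_def)
      qed
    qed
    hence "integrable (lborel \<Otimes>\<^sub>M lborel) (case_prod G)"
      by (simp add: lborel_prod case_prod_beta')
    from lborel_pair.Fubini_integral[OF this] show ?thesis by simp
  qed
  also have "\<dots> = (\<integral>p. th' (snd p) * ch (fst p) * char_mean h (fst p) (snd p) (\<lambda>y. \<bar>u (fst p) (snd p) + sin y\<bar>)
     + th (snd p) * ch' (fst p) * char_mean h (fst p) (snd p) (\<lambda>y. kruzkov_flux (u (fst p) (snd p)) (- sin y)) \<partial>lborel)"
  proof (rule Bochner_Integration.integral_cong[OF refl])
    fix p :: "real \<times> real"
    obtain x t where p: "p = (x, t)" by (cases p)
    define v where "v = u x t"
    define D where "D y = - \<bar>v + sin y\<bar> * cos y * (spline_bump ((x - char_pos y t)/h) / h)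
    + \<bar>v + sin y\<bar> * (v + sin y) / 2 * ((1 - t * cos y) * (spline_slope ((x - char_pos y t)/h) / h^2))" for y
    \<comment> \<open>The contributions in which neither cut-off is differentiated are collected in
      \<open>D\<close>, whose label integral vanishes wherever \<open>ch x\<close> does not.\<close>
    have "G y p = th' t * ch x * (char_kernel h x t y * \<bar>v + sin y\<bar> * indicator {0..2*pi} y)
       + th t * ch' x * (char_kernel h x t y * kruzkov_flux v (- sin y) * indicator {0..2*pi} y)
       + th t * ch x * (D y * indicator {0..2*pi} y)" for y
      unfolding G_def F_def p pht_def phx_def J_def bu_def sl_def D_def char_kernel_def kruzkov_flux_eq v_def
      by (simp add: algebra_simps add_divide_distrib diff_divide_distrib)
    moreover have "integrable lborel (\<lambda>y. char_kernel h x t y * \<bar>v + sin y\<bar> * indicator {0..2*pi} y)"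
      by (intro integrable_char_kernel_mult ch continuous_intros)
    moreover have "integrable lborel (\<lambda>y. char_kernel h x t y * kruzkov_flux v (- sin y) * indicator {0..2*pi} y)"
      unfolding kruzkov_flux_eq by (intro integrable_char_kernel_mult ch continuous_intros) auto
    moreover have "integrable lborel (\<lambda>y. D y * indicator {0..2*pi} y)"
    proof -
      have "continuous_on UNIV D" unfolding D_def char_pos_def using ch(2) by (intro continuous_intros) auto
      thus ?thesis by (intro borel_integrable_atLeastAtMost) (simp add: continuous_on_eq_continuous_at)
    qed
    ultimately have eq: "(\<integral>y. G y p \<partial>lborel) = th' t * ch x * char_mean h x t (\<lambda>y. \<bar>v + sin y\<bar>)
       + th t * ch' x * char_mean h x t (\<lambda>y. kruzkov_flux v (- sin y))
       + th t * ch x * (\<integral>y. D y * indicator {0..2*pi} y \<partial>lborel)"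
      unfolding char_mean_def by simp
    have "th t * ch x * (\<integral>y. D y * indicator {0..2*pi} y \<partial>lborel) = 0"
    proof (cases "ch x = 0")
      case False
      hence "d \<le> x" "x \<le> 2*pi - d" using chD by (meson not_le)+
      thus ?thesis using char_entropy_exact[of h x v t] ch unfolding D_def by simp
    qed simp
    with eq show "(\<integral>y. G y p \<partial>lborel) = th' (snd p) * ch (fst p) * char_mean h (fst p) (snd p) (\<lambda>y. \<bar>u (fst p) (snd p) + sin y\<bar>)
     + th (snd p) * ch' (fst p) * char_mean h (fst p) (snd p) (\<lambda>y. kruzkov_flux (u (fst p) (snd p)) (- sin y))"
      by (simp add: p v_def)
  qed
  finally show ?thesis .
qed

end

text \<open>The slope in \<open>k\<close> is \<open>- sgn (v - k) * k\<close>, of modulus at most 1.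
  When \<open>v\<close> lies between the two constants, each flux is bounded by the distance of
  \<open>v\<close> to its constant, and the two distances add up.\<close>

lemma kruzkov_flux_lipschitz:
  assumes "\<bar>k\<bar> \<le> 1" "\<bar>l\<bar> \<le> 1"
  shows "\<bar>kruzkov_flux v k - kruzkov_flux v l\<bar> \<le> \<bar>k - l\<bar>"
proof -
  have *: "\<bar>kruzkov_flux v k - kruzkov_flux v l\<bar> \<le> \<bar>k - l\<bar>" if "\<bar>k\<bar> \<le> 1" "\<bar>l\<bar> \<le> 1" "k \<le> l" for k l
  proof -
    have sq: "\<bar>(k\<^sup>2 - l\<^sup>2) / 2\<bar> \<le> \<bar>k - l\<bar>"
    proof -
      have "\<bar>(k\<^sup>2 - l\<^sup>2) / 2\<bar> = \<bar>k - l\<bar> * (\<bar>k + l\<bar> / 2)"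
        by (simp add: abs_mult[symmetric] power2_eq_square algebra_simps abs_divide)
      also have "\<dots> \<le> \<bar>k - l\<bar> * 1" using that by (intro mult_left_mono) auto
      finally show ?thesis by simp
    qed
    consider "v \<le> k" | "l \<le> v" | "k \<le> v" "v \<le> l" by linarith
    thus ?thesis
    proof cases
      case 1
      hence "kruzkov_flux v k - kruzkov_flux v l = (k\<^sup>2 - l\<^sup>2) / 2"
        using that by (simp add: kruzkov_flux_eq power2_eq_square field_simps)
      thus ?thesis using sq by (simp only:)
    next
      case 2
      hence "kruzkov_flux v k - kruzkov_flux v l = - ((k\<^sup>2 - l\<^sup>2) / 2)"
        using that by (simp add: kruzkov_flux_eq power2_eq_square field_simps)
      thus ?thesis using sq by (simp only: abs_minus_cancel)
    next
      case 3
      have "\<bar>(v - k) * ((v + k) / 2)\<bar> \<le> (v - k) * 1" "\<bar>(l - v) * ((v + l) / 2)\<bar> \<le> (l - v) * 1"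
        using 3 that mult_left_mono[of "\<bar>(v + k)/2\<bar>" 1 "v - k"] mult_left_mono[of "\<bar>(v + l)/2\<bar>" 1 "l - v"]
        by (auto simp: abs_mult)
      moreover have "kruzkov_flux v k = (v - k) * ((v + k) / 2)" "kruzkov_flux v l = (l - v) * ((v + l) / 2)"
        using 3 by (simp_all add: kruzkov_flux_eq)
      ultimately have "\<bar>kruzkov_flux v k\<bar> \<le> v - k" "\<bar>kruzkov_flux v l\<bar> \<le> l - v" by simp_all
      thus ?thesis using that by linarith
    qed
  qed
  show ?thesis using *[of k l] *[of l k] assms by (cases "k \<le> l") (auto simp: abs_minus_commute)
qed

text \<open>The entropy condition of a shock with left state \<open>k\<close> and right state
  \<open>-k\<close>. Outside \<open>[-k, k]\<close> both fluxes agree because the Burgers flux is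
  even; inside, one is nonpositive and the other nonnegative.\<close>

lemma kruzkov_flux_neg_le:
  assumes "0 \<le> k"
  shows "kruzkov_flux v (- k) \<le> kruzkov_flux v k"
proof -
  consider "k \<le> v" | "v \<le> - k" | "- k \<le> v" "v \<le> k" by linarith
  thus ?thesis
  proof cases
    case 3
    have "(v + k) * ((v - k)/2) \<le> 0" "0 \<le> (k - v) * ((v + k) / 2)"
      using 3 by (auto intro: mult_nonneg_nonpos)
    moreover have "kruzkov_flux v (- k) = (v + k) * ((v - k)/2)" "kruzkov_flux v k = (k - v) * ((v + k)/2)"
      using 3 by (simp_all add: kruzkov_flux_eq)
    ultimately show ?thesis by linarith
  qed (use assms in \<open>auto simp: kruzkov_flux_eq algebra_simps\<close>)
qed

context kruzkov_solution
begin

lemma M_nonneg: "0 \<le> M"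
  using bound[of 0 0] by simp

lemma char_mean_measurable:
  assumes "0 < h" "continuous_on UNIV (\<lambda>(v, y). g v y)"
  shows "(\<lambda>p. char_mean h (fst p) (snd p) (g (u (fst p) (snd p)))) \<in> borel_measurable borel"
proof -
  have S: "sets (borel \<Otimes>\<^sub>M lborel) = sets (borel :: ((real \<times> real) \<times> real) measure)"
    using sets_pair_measure_cong[OF refl sets_lborel, of "borel :: (real \<times> real) measure"] borel_prod by metis
  have k: "(\<lambda>q. char_kernel h (fst (fst q)) (snd (fst q)) (snd q)) \<in> borel_measurable borel"
    unfolding char_kernel_def char_pos_def
    using assms(1) by (intro borel_measurable_continuous_onI continuous_intros) auto
  have f: "fst \<in> borel_measurable (borel :: ((real \<times> real) \<times> real) measure)"
      "snd \<in> borel_measurable (borel :: ((real \<times> real) \<times> real) measure)"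
    by (intro borel_measurable_continuous_onI continuous_intros)+
  have g: "(\<lambda>q. g (u (fst (fst q)) (snd (fst q))) (snd q)) \<in> borel_measurable (borel :: ((real \<times> real) \<times> real) measure)"
  proof -
    have "(\<lambda>q. (u (fst (fst q)) (snd (fst q)), snd q)) \<in> borel_measurable (borel :: ((real \<times> real) \<times> real) measure)"
      using measurable_compose[OF f(1) measurable_pair] f(2) by (intro borel_measurable_Pair) auto
    from measurable_compose[OF this borel_measurable_continuous_onI[OF assms(2)]] show ?thesis by simp
  qed
  have i: "(\<lambda>q. indicator {0..2*pi} (snd q) :: real) \<in> borel_measurable (borel :: ((real \<times> real) \<times> real) measure)"
    using measurable_compose[OF f(2) borel_measurable_indicator[of "{0..2*pi}" borel]] by simp
  have "(\<lambda>q. (char_kernel h (fst (fst q)) (snd (fst q)) (snd q) * g (u (fst (fst q)) (snd (fst q))) (snd q))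
       * indicator {0..2*pi} (snd q)) \<in> borel_measurable borel"
    by (intro borel_measurable_times k g i)
  hence "(\<lambda>(p, y). (char_kernel h (fst p) (snd p) y * g (u (fst p) (snd p)) y)
       * indicator {0..2*pi} y) \<in> borel_measurable (borel \<Otimes>\<^sub>M lborel)"
    unfolding measurable_cong_sets[OF S refl] by (simp add: case_prod_beta')
  from lborel.borel_measurable_lebesgue_integral[OF this] show ?thesis
    unfolding char_mean_def by simp
qed

text \<open>The limit of vanishing bandwidth: the means over labels converge to their values at the
  foot, where \<open>- sin y\<close> is the profile. The result is the Kruzhkov inequality between
  two solutions, valid away from the shock because \<open>ch\<close> is supported in
  \<open>[d, 2*pi - d]\<close>.\<close>

lemma smooth_comparison:
  assumes th: "c1_bump th th' a b" "0 < a" and ch: "c1_bump ch ch' d (2*pi - d)" "0 < d"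
  shows "0 \<le> (\<integral>p. th' (snd p) * ch (fst p) * \<bar>u (fst p) (snd p) - burg_profile (fst p) (snd p)\<bar>
     + th (snd p) * ch' (fst p) * kruzkov_flux (u (fst p) (snd p)) (burg_profile (fst p) (snd p)) \<partial>lborel)"
proof -
  define h where "h n = d / (4 * real (Suc n))" for n
  have h: "0 < h n" "3 * h n < d" for n
  proof -
    show "0 < h n" using ch(2) by (simp add: h_def)
    have "3 * d < d * (4 * real (Suc n))" using ch(2) by (simp add: algebra_simps add_pos_nonneg)
    thus "3 * h n < d" using ch(2) by (simp add: h_def field_simps)
  qed
  have h0: "h \<longlonglongrightarrow> 0"
    using tendsto_mult_right_zero[OF LIMSEQ_inverse_real_of_nat, of "d/4"] by (simp add: h_def [abs_def] field_simps)
  note thD = th(1)[unfolded c1_bump_def] and chD = ch(1)[unfolded c1_bump_def]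
  define A where "A n p = char_mean (h n) (fst p) (snd p) (\<lambda>y. \<bar>u (fst p) (snd p) + sin y\<bar>)" for n p
  define B where "B n p = char_mean (h n) (fst p) (snd p) (\<lambda>y. kruzkov_flux (u (fst p) (snd p)) (- sin y))" for n p
  define s where "s n p = th' (snd p) * ch (fst p) * A n p + th (snd p) * ch' (fst p) * B n p" for n p
  define f where "f p = th' (snd p) * ch (fst p) * \<bar>u (fst p) (snd p) - burg_profile (fst p) (snd p)\<bar>
     + th (snd p) * ch' (fst p) * kruzkov_flux (u (fst p) (snd p)) (burg_profile (fst p) (snd p))" for p
  define w where "w p = \<bar>th' (snd p) * ch (fst p)\<bar> * (M + 1) + \<bar>th (snd p) * ch' (fst p)\<bar> * (M + 1)\<^sup>2" for p
  have comp: "continuous_on UNIV (\<lambda>p. th (snd p))" "continuous_on UNIV (\<lambda>p. th' (snd p))"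
      "continuous_on UNIV (\<lambda>p. ch (fst p))" "continuous_on UNIV (\<lambda>p. ch' (fst p))"
    by (auto intro!: continuous_on_compose2[OF c1_bump_continuous(1)[OF th(1)]]
      continuous_on_compose2[OF c1_bump_continuous(2)[OF th(1)]]
      continuous_on_compose2[OF c1_bump_continuous(1)[OF ch(1)]]
      continuous_on_compose2[OF c1_bump_continuous(2)[OF ch(1)]] continuous_intros)
  note cm = comp[THEN borel_measurable_continuous_onI]
  have zero: "(th t = 0 \<and> th' t = 0) \<or> (ch x = 0 \<and> ch' x = 0)" if "(x, t) \<notin> {d..2*pi-d} \<times> {a..b}" for x t
    using that thD chD by (auto simp: not_le)
  have smeas: "s n \<in> borel_measurable borel" for n
    unfolding s_def A_def B_def
    by (intro borel_measurable_add borel_measurable_times cm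
        char_mean_measurable[OF h(1), of "\<lambda>v y. \<bar>v + sin y\<bar>"]
        char_mean_measurable[OF h(1), of "\<lambda>v y. kruzkov_flux v (- sin y)"])
      (auto simp: case_prod_beta' kruzkov_flux_eq intro!: continuous_intros)
  have fmeas: "f \<in> borel_measurable borel"
    unfolding f_def kruzkov_flux_eq
    by (intro borel_measurable_add borel_measurable_times cm borel_measurable_abs borel_measurable_diff
        borel_measurable_divide borel_measurable_const measurable_pair burg_profile_measurable)
  have wint: "integrable lborel w"
  proof -
    have c: "continuous_on UNIV w" unfolding w_def by (intro continuous_intros comp)
    have K: "compact ({d..2*pi-d} \<times> {a..b})" by (intro compact_Times compact_Icc)
    obtain C where "\<And>p. p \<in> {d..2*pi-d} \<times> {a..b} \<Longrightarrow> \<bar>w p\<bar> \<le> C"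
      using continuous_compact_bound[OF K continuous_on_subset[OF c subset_UNIV]] by blast
    moreover have "w p = 0" if "p \<notin> {d..2*pi-d} \<times> {a..b}" for p
      using zero[of "fst p" "snd p"] that by (auto simp: w_def)
    ultimately show ?thesis using K borel_measurable_continuous_onI[OF c] by (intro integrable_compact_support)
  qed
  have "(\<lambda>n. \<integral>p. s n p \<partial>lborel) \<longlonglongrightarrow> (\<integral>p. f p \<partial>lborel)"
  proof (rule integral_dominated_convergence[where w = w])
    show "AE p in lborel. (\<lambda>n. s n p) \<longlonglongrightarrow> f p"
    proof (rule AE_I2)
      fix p :: "real \<times> real"
      obtain x t where p: "p = (x, t)" by (cases p)
      show "(\<lambda>n. s n p) \<longlonglongrightarrow> f p"
      proof (cases "(x, t) \<in> {d..2*pi-d} \<times> {a..b}")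
        case False
        from zero[OF this] show ?thesis by (auto simp: s_def f_def p)
      next
        case True
        hence xt: "0 < x" "x < 2*pi" "0 \<le> t" using ch(2) th(2) by auto
        have "(\<lambda>n. A n p) \<longlonglongrightarrow> \<bar>u x t + sin (char_foot x t)\<bar>"
          unfolding A_def p fst_conv snd_conv
          by (rule char_mean_tendsto[OF xt(3,1,2) _ h(1) h0]) (intro continuous_intros)
        moreover have "(\<lambda>n. B n p) \<longlonglongrightarrow> kruzkov_flux (u x t) (- sin (char_foot x t))"
          unfolding B_def p fst_conv snd_conv
          by (rule char_mean_tendsto[OF xt(3,1,2) _ h(1) h0]) (auto simp: kruzkov_flux_eq intro!: continuous_intros)
        ultimately show ?thesis
          unfolding s_def f_def using burg_profile_eq[OF xt(3,1,2)]
          by (auto simp: p intro!: tendsto_intros)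
      qed
    qed
    fix n
    show "AE p in lborel. norm (s n p) \<le> w p"
    proof (rule AE_I2)
      fix p :: "real \<times> real"
      obtain x t where p: "p = (x, t)" by (cases p)
      show "norm (s n p) \<le> w p"
      proof (cases "(x, t) \<in> {d..2*pi-d} \<times> {a..b}")
        case False
        from zero[OF this] show ?thesis by (auto simp: s_def w_def p)
      next
        case True
        hence xt: "3 * h n < x" "x < 2*pi" "0 \<le> t" using ch(2) th(2) h(2)[of n] by auto
        have ub: "\<bar>u x t\<bar> \<le> M" using bound xt by blast
        have "\<bar>A n p\<bar> \<le> M + 1"
          unfolding A_def p fst_conv snd_conv
        proof (rule char_mean_bound[OF xt(3) h(1) xt(1,2)])
          show "\<bar>\<bar>u x t + sin y\<bar>\<bar> \<le> M + 1" for y using ub abs_sin_le_one[of y] by linarith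
        qed (intro continuous_intros)
        moreover have "\<bar>B n p\<bar> \<le> (M + 1)\<^sup>2"
          unfolding B_def p fst_conv snd_conv
          by (rule char_mean_bound[OF xt(3) h(1) xt(1,2)])
             (use kruzkov_flux_bound[OF ub, of "- sin _"] in \<open>auto simp: kruzkov_flux_eq intro!: continuous_intros\<close>)
        ultimately have "\<bar>th' t * ch x * A n p\<bar> \<le> \<bar>th' t * ch x\<bar> * (M + 1)"
            "\<bar>th t * ch' x * B n p\<bar> \<le> \<bar>th t * ch' x\<bar> * (M + 1)\<^sup>2"
          unfolding abs_mult[of "th' t * ch x"] abs_mult[of "th t * ch' x"] by (intro mult_left_mono; simp)+
        thus ?thesis by (simp add: s_def w_def p)
      qed
    qed
  qed (use fmeas smeas wint in auto)
  moreover have "0 \<le> (\<integral>p. s n p \<partial>lborel)" for n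
    unfolding s_def A_def B_def by (rule averaged_entropy[OF th ch(1) h])
  ultimately show ?thesis unfolding f_def by (intro LIMSEQ_le_const) auto
qed

text \<open>Here the spatial bump may straddle the shock, at the price of comparing with a constant
  instead of the profile.\<close>

lemma const_comparison:
  assumes th: "c1_bump th th' a b" "0 < a" and ch: "c1_bump ch ch' c d"
  shows "0 \<le> (\<integral>p. th' (snd p) * ch (fst p) * \<bar>u (fst p) (snd p) - k\<bar>
     + th (snd p) * ch' (fst p) * kruzkov_flux (u (fst p) (snd p)) k \<partial>lborel)"
proof -
  note thD = th(1)[unfolded c1_bump_def] and chD = ch(1)[unfolded c1_bump_def]
  have "nonneg_test_fun (\<lambda>x t. th t * ch x) (\<lambda>x t. th t * ch' x) (\<lambda>x t. th' t * ch x)"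
    unfolding nonneg_test_fun_def
  proof (intro conjI allI)
    fix x t
    have dch: "(ch has_real_derivative ch' x) (at x)" using chD by blast
    have dth: "(th has_real_derivative th' t) (at t)" using thD by blast
    show "0 \<le> th t * ch x" using thD chD by simp
    show "((\<lambda>y. th t * ch y) has_real_derivative th t * ch' x) (at x)" by (rule DERIV_cmult[OF dch])
    show "((\<lambda>s. th s * ch x) has_real_derivative th' t * ch x) (at t)" by (rule DERIV_cmult_right[OF dth])
    show "continuous_on UNIV (\<lambda>p. th (snd p) * ch' (fst p))" "continuous_on UNIV (\<lambda>p. th' (snd p) * ch (fst p))"
      by (auto intro!: continuous_on_compose2[OF c1_bump_continuous(1)[OF th(1)]]
          continuous_on_compose2[OF c1_bump_continuous(2)[OF th(1)]]
          continuous_on_compose2[OF c1_bump_continuous(1)[OF ch]]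
          continuous_on_compose2[OF c1_bump_continuous(2)[OF ch]] continuous_intros)
  next
    have "\<bar>x\<bar> \<le> Max {\<bar>c\<bar>, \<bar>d\<bar>, b} \<and> a \<le> t \<and> t \<le> Max {\<bar>c\<bar>, \<bar>d\<bar>, b}" if "th t * ch x \<noteq> 0" for x t
    proof -
      have "a \<le> t" "t \<le> b" "c \<le> x" "x \<le> d" using that thD chD by (metis mult_eq_0_iff not_le)+
      thus ?thesis by (auto simp: max_def)
    qed
    thus "\<exists>a R. 0 < a \<and> (\<forall>x t. th t * ch x \<noteq> 0 \<longrightarrow> \<bar>x\<bar> \<le> R \<and> a \<le> t \<and> t \<le> R)"
      using th(2) by blast
  qed
  from entropy[OF this, of k] show ?thesis by (simp add: mult_ac)
qed

end

subsection \<open>The contraction inequality across the shock\<close>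

definition spline_hat :: "real \<Rightarrow> real \<Rightarrow> real \<Rightarrow> real" where
  "spline_hat p d x = spline_bump ((x - p) / d) / d"

text \<open>It rises on \<open>[p, p + 3*d]\<close> and falls on \<open>[q, q + 3*d]\<close>. Its
  derivative is a difference of two translated hats of mass one, so edges of different plateaus can
  be matched exactly.\<close>

definition plateau :: "real \<Rightarrow> real \<Rightarrow> real \<Rightarrow> real \<Rightarrow> real" where
  "plateau p q d x = spline_step ((x - p) / d) - spline_step ((x - q) / d)"

lemma spline_hat_nonneg: "0 < d \<Longrightarrow> 0 \<le> spline_hat p d x"
  by (simp add: spline_hat_def spline_bump_bounds)

lemma spline_hat_0: "0 < d \<Longrightarrow> x \<le> p \<or> p + 3*d \<le> x \<Longrightarrow> spline_hat p d x = 0"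
  unfolding spline_hat_def by (subst spline_bump_0) (auto simp: field_simps)

lemma continuous_on_spline_hat [continuous_intros]:
  "continuous_on S f \<Longrightarrow> continuous_on S (\<lambda>x. spline_hat p d (f x))"
  unfolding spline_hat_def divide_inverse by (intro continuous_intros)

lemma DERIV_plateau:
  assumes "0 < d"
  shows "(plateau p q d has_real_derivative spline_hat p d x - spline_hat q d x) (at x)"
proof -
  have "((\<lambda>x. (x - c) / d) has_real_derivative 1 / d) (at x)" for c
    using assms by (auto intro!: derivative_eq_intros)
  from DERIV_diff[OF DERIV_chain2[OF DERIV_spline_step this] DERIV_chain2[OF DERIV_spline_step this]]
  show ?thesis unfolding plateau_def [abs_def] spline_hat_def by simp
qed

lemma plateau_bounds:
  assumes "0 < d" "p \<le> q"
  shows "0 \<le> plateau p q d x" "plateau p q d x \<le> 1"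
proof -
  have "spline_step ((x - q) / d) \<le> spline_step ((x - p) / d)"
    using assms by (intro spline_step_mono divide_right_mono) auto
  thus "0 \<le> plateau p q d x" by (simp add: plateau_def)
  show "plateau p q d x \<le> 1"
    unfolding plateau_def using spline_step_bounds(1)[of "(x - q)/d"] spline_step_bounds(2)[of "(x - p)/d"] by linarith
qed

lemma plateau_values:
  assumes "0 < d" "p \<le> q"
  shows "x \<le> p \<Longrightarrow> plateau p q d x = 0" "q + 3*d \<le> x \<Longrightarrow> plateau p q d x = 0"
    "p + 3*d \<le> x \<Longrightarrow> x \<le> q \<Longrightarrow> plateau p q d x = 1"
  unfolding plateau_def using assms
  by (auto simp: spline_step_ends field_simps)

lemma c1_bump_plateau:
  assumes "0 < d" "p \<le> q"
  shows "c1_bump (plateau p q d) (\<lambda>x. spline_hat p d x - spline_hat q d x) p (q + 3*d)"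
  unfolding c1_bump_def
proof (intro conjI allI impI)
  show "continuous_on UNIV (\<lambda>x. spline_hat p d x - spline_hat q d x)" by (intro continuous_intros)
  fix x assume x: "x < p \<or> q + 3*d < x"
  show "plateau p q d x = 0" using plateau_values[OF assms, of x] x by auto
  show "spline_hat p d x - spline_hat q d x = 0"
    using x assms by (subst (1 2) spline_hat_0) auto
qed (use DERIV_plateau plateau_bounds assms in auto)

lemma spline_hat_integral:
  assumes "0 < d"
  shows "integrable lborel (spline_hat p d)" "(\<integral>x. spline_hat p d x \<partial>lborel) = 1"
proof -
  have "has_bochner_integral lborel (\<lambda>x. spline_hat p d x * indicator {p..p+3*d} x)
     (spline_step ((p + 3*d - p)/d) - spline_step ((p - p)/d))"
  proof (rule has_bochner_integral_FTC_Icc_real)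
    fix x
    have "((\<lambda>x. (x - p) / d) has_real_derivative 1 / d) (at x)"
      using assms by (auto intro!: derivative_eq_intros)
    from DERIV_chain2[OF DERIV_spline_step this]
    show "((\<lambda>x. spline_step ((x - p)/d)) has_real_derivative spline_hat p d x) (at x)"
      by (simp add: spline_hat_def)
    have "continuous_on UNIV (spline_hat p d)" by (intro continuous_intros)
    thus "isCont (spline_hat p d) x" by (simp add: continuous_on_eq_continuous_at)
  qed (use assms in simp)
  moreover have "spline_hat p d x * indicator {p..p+3*d} x = spline_hat p d x" for x
    by (cases "x \<in> {p..p+3*d}") (use spline_hat_0[OF assms, of x p] in auto)
  moreover have "spline_step ((p + 3*d - p)/d) - spline_step ((p - p)/d) = 1"
    using assms by (simp add: spline_step_ends)
  ultimately have "has_bochner_integral lborel (spline_hat p d) 1" by simp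
  thus "integrable lborel (spline_hat p d)" "(\<integral>x. spline_hat p d x \<partial>lborel) = 1"
    by (auto simp: has_bochner_integral_iff)
qed

lemma integrable_lborel_pairI:
  fixes f :: "real \<times> real \<Rightarrow> real"
  assumes "integrable lborel f"
  shows "(\<integral>x. (\<integral>t. f (x, t) \<partial>lborel) \<partial>lborel) = (\<integral>p. f p \<partial>lborel)"
    "(\<integral>t. (\<integral>x. f (x, t) \<partial>lborel) \<partial>lborel) = (\<integral>p. f p \<partial>lborel)"
proof -
  have i: "integrable (lborel \<Otimes>\<^sub>M lborel) (case_prod (\<lambda>x t. f (x, t)))"
    using assms by (simp add: lborel_prod case_prod_beta')
  show "(\<integral>x. (\<integral>t. f (x, t) \<partial>lborel) \<partial>lborel) = (\<integral>p. f p \<partial>lborel)"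
    using lborel_pair.integral_fst[OF i] by (simp add: lborel_prod case_prod_beta')
  show "(\<integral>t. (\<integral>x. f (x, t) \<partial>lborel) \<partial>lborel) = (\<integral>p. f p \<partial>lborel)"
    using lborel_pair.integral_snd[OF i] by (simp add: lborel_prod case_prod_beta')
qed

lemma measurable_fst_snd_real:
  "fst \<in> borel_measurable (borel :: (real \<times> real) measure)"
  "snd \<in> borel_measurable (borel :: (real \<times> real) measure)"
  by (intro borel_measurable_continuous_onI continuous_intros)+

text \<open>The bound on \<open>w\<close> is asked only from time \<open>a\<close> on, since
  \<open>u\<close> is controlled only at nonnegative times.\<close>

lemma integrable_bump_mult:
  fixes f g :: "real \<Rightarrow> real" and w :: "real \<times> real \<Rightarrow> real"
  assumes "continuous_on UNIV f" "continuous_on UNIV g" "w \<in> borel_measurable borel"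
    and "\<And>t. t < a \<or> b < t \<Longrightarrow> f t = 0" "\<And>x. x < c \<or> d < x \<Longrightarrow> g x = 0"
    and "\<And>p. a \<le> snd p \<Longrightarrow> \<bar>w p\<bar> \<le> B"
  shows "integrable lborel (\<lambda>p. f (snd p) * g (fst p) * w p)"
proof -
  have fg: "continuous_on UNIV (\<lambda>p::real\<times>real. f (snd p) * g (fst p))"
    by (intro continuous_intros continuous_on_compose2[OF assms(1)] continuous_on_compose2[OF assms(2)]) auto
  have K: "compact ({c..d} \<times> {a..b})" by (intro compact_Times compact_Icc)
  obtain C where C: "\<And>p. p \<in> {c..d} \<times> {a..b} \<Longrightarrow> \<bar>f (snd p) * g (fst p)\<bar> \<le> C" "0 \<le> C"
    using continuous_compact_bound[OF K continuous_on_subset[OF fg subset_UNIV]] by blast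
  show ?thesis
  proof (rule integrable_compact_support[OF _ K])
    show "(\<lambda>p. f (snd p) * g (fst p) * w p) \<in> borel_measurable borel"
      by (intro borel_measurable_times[OF borel_measurable_continuous_onI[OF fg] assms(3)])
    fix p :: "real \<times> real"
    show "f (snd p) * g (fst p) * w p = 0" if "p \<notin> {c..d} \<times> {a..b}"
      using that assms(4)[of "snd p"] assms(5)[of "fst p"] by (cases p) (auto simp: not_le)
    show "\<bar>f (snd p) * g (fst p) * w p\<bar> \<le> C * B" if p: "p \<in> {c..d} \<times> {a..b}"
      unfolding abs_mult[of "f (snd p) * g (fst p)"]
      using C(1)[OF p] C(2) assms(6)[of p] p by (intro mult_mono) auto
  qed
qed

lemma integral_bump_product:
  fixes f g :: "real \<Rightarrow> real"
  assumes "continuous_on UNIV f" "continuous_on UNIV g"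
    and "\<And>t. t < a \<or> b < t \<Longrightarrow> f t = 0" "\<And>x. x < c \<or> d < x \<Longrightarrow> g x = 0"
  shows "integrable lborel (\<lambda>p. f (snd p) * g (fst p))"
    "(\<integral>p. f (snd p) * g (fst p) \<partial>lborel) = (\<integral>t. f t \<partial>lborel) * (\<integral>x. g x \<partial>lborel)"
proof -
  show *: "integrable lborel (\<lambda>p. f (snd p) * g (fst p))"
    using integrable_bump_mult[OF assms(1,2), of "\<lambda>_. 1" a b c d 1] assms(3,4) by simp
  show "(\<integral>p. f (snd p) * g (fst p) \<partial>lborel) = (\<integral>t. f t \<partial>lborel) * (\<integral>x. g x \<partial>lborel)"
    unfolding integrable_lborel_pairI(2)[OF *, symmetric] by simp
qed

context kruzkov_solution
begin

definition L1_gap :: "real \<Rightarrow> real" where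
  "L1_gap t = (\<integral>x. \<bar>u x t - burg_profile x t\<bar> * indicator {0<..<2*pi} x \<partial>lborel)"

lemma flux_measurable:
  assumes "w \<in> borel_measurable borel"
  shows "(\<lambda>p. kruzkov_flux (u (fst p) (snd p)) (w p)) \<in> borel_measurable borel"
  unfolding kruzkov_flux_eq
  by (intro borel_measurable_times borel_measurable_abs borel_measurable_diff borel_measurable_add
      borel_measurable_divide borel_measurable_const measurable_pair assms)

text \<open>The cut-off inside the cell leaves flux terms at its two edges. A second cut-off across
  the shock, with the constant \<open>k\<close>, has edges at the same places up to a period, with
  opposite signs. What remains at each edge is at most \<open>e\<close> times a unit mass, and the
  strip itself, of width at most \<open>8*d\<close>, contributes the term with
  \<open>M + 1\<close>.\<close>

lemma strip_inequality:
  assumes th: "c1_bump th th' a b" "0 < a" and k: "0 \<le> k" "k \<le> 1" and e: "0 \<le> e" and d: "0 < d" "5*d < 2*pi"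
    and near: "\<And>x t. 0 < x \<Longrightarrow> x < 4*d \<Longrightarrow> a \<le> t \<Longrightarrow> t \<le> b \<Longrightarrow>
           \<bar>burg_profile x t + k\<bar> \<le> e \<and> \<bar>burg_profile (2*pi - x) t - k\<bar> \<le> e"
  shows "0 \<le> (\<integral>p. th' (snd p) * plateau d (2*pi - 4*d) d (fst p) *
              \<bar>u (fst p) (snd p) - burg_profile (fst p) (snd p)\<bar> \<partial>lborel)
            + (M + 1) * 8 * d * (\<integral>t. \<bar>th' t\<bar> \<partial>lborel) + 2 * e * (\<integral>t. th t \<partial>lborel)"
proof -
  note thD = th(1)[unfolded c1_bump_def]
  note thc = c1_bump_continuous[OF th(1), of UNIV]
  have tz: "\<And>t. t < a \<or> b < t \<Longrightarrow> th t = 0" "\<And>t. t < a \<or> b < t \<Longrightarrow> th' t = 0" using thD by auto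
  have pq: "d \<le> 2*pi - 4*d" "2*pi - 4*d \<le> 2*pi + d" using d by auto
  \<comment> \<open>The rising edge of \<open>?bet\<close> is the falling edge \<open>?L\<close> of
    \<open>?chi\<close>; its falling edge \<open>?R'\<close> is the rising edge \<open>?R\<close> of
    \<open>?chi\<close> moved by one period. Both edges lie within \<open>4*d\<close> of the shock,
    where \<open>near\<close> controls the profile.\<close>
  let ?chi = "plateau d (2*pi - 4*d) d" and ?bet = "plateau (2*pi - 4*d) (2*pi + d) d"
  let ?R = "spline_hat d d" and ?L = "spline_hat (2*pi - 4*d) d" and ?R' = "spline_hat (2*pi + d) d"
  let ?V = "\<lambda>p. burg_profile (fst p) (snd p)" and ?u = "\<lambda>p. u (fst p) (snd p)"
  have chi: "c1_bump ?chi (\<lambda>x. ?R x - ?L x) d (2*pi - d)"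
    using c1_bump_plateau[OF d(1) pq(1)] by simp
  have bet: "c1_bump ?bet (\<lambda>x. ?L x - ?R' x) (2*pi - 4*d) (2*pi + 4*d)"
    using c1_bump_plateau[OF d(1) pq(2)] by (simp add: add.assoc)
  have chic: "continuous_on UNIV ?chi" "continuous_on UNIV ?bet"
    using c1_bump_continuous(1)[OF chi] c1_bump_continuous(1)[OF bet] by auto
  have hc: "continuous_on UNIV (spline_hat p d)" for p by (intro continuous_intros)
  have hz: "spline_hat p d x = 0" if "x < p \<or> p + 3*d < x" for p x
    using spline_hat_0[OF d(1), of x p] that by auto
  have kb: "\<bar>k\<bar> \<le> 1" using k by simp
  have ub: "\<bar>?u p\<bar> \<le> M" if "a \<le> snd p" for p using bound[of "snd p" "fst p"] that th(2) by simp
  have wb: "\<bar>\<bar>?u p - ?V p\<bar>\<bar> \<le> M + 1" "\<bar>\<bar>?u p - k\<bar>\<bar> \<le> M + 1"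
      "\<bar>kruzkov_flux (?u p) (?V p)\<bar> \<le> (M+1)\<^sup>2" "\<bar>kruzkov_flux (?u p) k\<bar> \<le> (M+1)\<^sup>2" if "a \<le> snd p" for p
    using ub[OF that] burg_profile_bound[of "fst p" "snd p"] kb
      kruzkov_flux_bound[OF ub[OF that] burg_profile_bound[of "fst p" "snd p"]]
      kruzkov_flux_bound[OF ub[OF that] kb] by auto
  have wm: "(\<lambda>p. \<bar>?u p - ?V p\<bar>) \<in> borel_measurable borel" "(\<lambda>p. \<bar>?u p - k\<bar>) \<in> borel_measurable borel"
    "(\<lambda>p. kruzkov_flux (?u p) (?V p)) \<in> borel_measurable borel" "(\<lambda>p. kruzkov_flux (?u p) k) \<in> borel_measurable borel"
    using measurable_pair burg_profile_measurable by (auto intro!: flux_measurable)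
  define a1 where "a1 p = th' (snd p) * ?chi (fst p) * \<bar>?u p - ?V p\<bar>" for p
  define a2 where "a2 p = th (snd p) * ?R (fst p) * kruzkov_flux (?u p) (?V p)" for p
  define a3 where "a3 p = th (snd p) * ?L (fst p) * kruzkov_flux (?u p) (?V p)" for p
  define b1 where "b1 p = th' (snd p) * ?bet (fst p) * \<bar>?u p - k\<bar>" for p
  define b2 where "b2 p = th (snd p) * ?L (fst p) * kruzkov_flux (?u p) k" for p
  define b3 where "b3 p = th (snd p) * ?R' (fst p) * kruzkov_flux (?u p) k" for p
  define b4 where "b4 p = th (snd p) * ?R (fst p) * kruzkov_flux (?u p) k" for p
  define c1 where "c1 p = \<bar>th' (snd p)\<bar> * ?bet (fst p)" for p :: "real \<times> real"
  define c2 where "c2 p = th (snd p) * ?R (fst p)" for p :: "real \<times> real"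
  define c3 where "c3 p = th (snd p) * ?L (fst p)" for p :: "real \<times> real"
  have int: "integrable lborel a1" "integrable lborel a2" "integrable lborel a3"
      "integrable lborel b1" "integrable lborel b2" "integrable lborel b3" "integrable lborel b4"
    unfolding a1_def a2_def a3_def b1_def b2_def b3_def b4_def
    by (rule integrable_bump_mult[OF thc(2) chic(1) wm(1) tz(2) _ wb(1), where c = d and d = "2*pi - d"],
          use chi in \<open>auto simp: c1_bump_def\<close>)
       (rule integrable_bump_mult[OF thc(1) hc wm(3) tz(1) hz wb(3)]
          integrable_bump_mult[OF thc(1) hc wm(4) tz(1) hz wb(4)]
          integrable_bump_mult[OF thc(2) chic(2) wm(2) tz(2) _ wb(2), where c = "2*pi - 4*d" and d = "2*pi + 4*d"],
          (use bet in \<open>auto simp: c1_bump_def\<close>)?)+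
  have i1: "0 \<le> (\<integral>p. a1 p \<partial>lborel) + (\<integral>p. a2 p \<partial>lborel) - (\<integral>p. a3 p \<partial>lborel)"
  proof -
    have "0 \<le> (\<integral>p. a1 p + (a2 p - a3 p) \<partial>lborel)"
      using smooth_comparison[OF th chi d(1)]
      by (simp add: a1_def a2_def a3_def left_diff_distrib right_diff_distrib)
    thus ?thesis using int by simp
  qed
  have i2: "0 \<le> (\<integral>p. b1 p \<partial>lborel) + (\<integral>p. b2 p \<partial>lborel) - (\<integral>p. b3 p \<partial>lborel)"
  proof -
    have "0 \<le> (\<integral>p. b1 p + (b2 p - b3 p) \<partial>lborel)"
      using const_comparison[OF th bet, of k]
      by (simp add: b1_def b2_def b3_def left_diff_distrib right_diff_distrib)
    thus ?thesis using int by simp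
  qed
  \<comment> \<open>Periodicity of \<open>u\<close> brings the edge beyond \<open>2*pi\<close> back
    to the edge just right of 0.\<close>
  have i3: "(\<integral>p. b3 p \<partial>lborel) = (\<integral>p. b4 p \<partial>lborel)"
  proof -
    have "(\<integral>p. b3 p \<partial>lborel) = (\<integral>p. b3 p \<partial>distr lborel borel ((+) (2*pi, 0)))"
      by (simp add: lborel_distr_plus)
    also have "\<dots> = (\<integral>p. b3 ((2*pi, 0) + p) \<partial>lborel)"
      using int(6) by (intro integral_distr) (auto intro: borel_measurable_continuous_onI continuous_intros)
    also have "(\<lambda>p. b3 ((2*pi, 0) + p)) = b4"
      unfolding b3_def b4_def using periodic by (auto simp: fun_eq_iff spline_hat_def add.commute)
    finally show ?thesis .
  qed
  have betz: "\<And>x. x < 2*pi - 4*d \<or> 2*pi + 4*d < x \<Longrightarrow> ?bet x = 0" using bet by (auto simp: c1_bump_def)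
  have atc: "continuous_on UNIV (\<lambda>t. \<bar>th' t\<bar>)" by (intro continuous_intros thc)
  have atz: "\<And>t. t < a \<or> b < t \<Longrightarrow> \<bar>th' t\<bar> = 0" using tz by auto
  have c1i: "integrable lborel c1" "(\<integral>p. c1 p \<partial>lborel) = (\<integral>t. \<bar>th' t\<bar> \<partial>lborel) * (\<integral>x. ?bet x \<partial>lborel)"
    unfolding c1_def by (rule integral_bump_product[OF atc chic(2) atz betz]; assumption)+
  have c2i: "integrable lborel c2" "(\<integral>p. c2 p \<partial>lborel) = (\<integral>t. th t \<partial>lborel)"
    unfolding c2_def using integral_bump_product[OF thc(1) hc tz(1) hz[where p = d]] spline_hat_integral[OF d(1)] by simp_all
  have c3i: "integrable lborel c3" "(\<integral>p. c3 p \<partial>lborel) = (\<integral>t. th t \<partial>lborel)"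
    unfolding c3_def using integral_bump_product[OF thc(1) hc tz(1) hz[where p = "2*pi - 4*d"]] spline_hat_integral[OF d(1)] by simp_all
  have le1: "(\<integral>p. b1 p \<partial>lborel) \<le> (M + 1) * (\<integral>p. c1 p \<partial>lborel)"
  proof -
    have "(\<integral>p. b1 p \<partial>lborel) \<le> (\<integral>p. (M + 1) * c1 p \<partial>lborel)"
    proof (rule integral_mono)
      fix p :: "real \<times> real"
      show "b1 p \<le> (M + 1) * c1 p"
      proof (cases "a \<le> snd p")
        case True
        have "b1 p \<le> \<bar>th' (snd p)\<bar> * ?bet (fst p) * (M + 1)"
          unfolding b1_def using wb(2)[OF True] plateau_bounds(1)[OF d(1) pq(2)] by (intro mult_mono) auto
        thus ?thesis by (simp add: c1_def mult_ac)
      qed (use tz in \<open>simp add: b1_def c1_def\<close>)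
    qed (use int c1i in auto)
    thus ?thesis by simp
  qed
  have le1': "(\<integral>x. ?bet x \<partial>lborel) \<le> 8 * d"
  proof -
    have "(\<integral>x. ?bet x \<partial>lborel) \<le> (\<integral>x. indicator {2*pi - 4*d..2*pi+4*d} x \<partial>lborel)"
    proof (rule integral_mono)
      show "integrable lborel ?bet"
        by (rule integrable_compact_support[OF borel_measurable_continuous_onI[OF chic(2)], of "{2*pi - 4*d..2*pi+4*d}" 1])
           (use betz plateau_bounds[OF d(1) pq(2)] in \<open>auto simp: not_le\<close>)
      show "?bet x \<le> indicator {2*pi - 4*d..2*pi+4*d} x" for x
        using betz[of x] plateau_bounds[OF d(1) pq(2)] by (auto simp: indicator_def not_le)
    qed (use d in auto)
    also have "\<dots> = 8 * d" using d by simp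
    finally show ?thesis .
  qed
  \<comment> \<open>Right of the shock the profile is close to \<open>-k\<close>, but the constant
    is \<open>k\<close>; the entropy condition of the shock gives the inequality in the required
    direction.\<close>
  have le2: "a2 p - b4 p \<le> e * c2 p" for p
  proof (cases "th (snd p) = 0 \<or> ?R (fst p) = 0")
    case False
    hence t: "a \<le> snd p" "snd p \<le> b" and x: "d < fst p" "fst p < 4*d"
      using tz(1)[of "snd p"] spline_hat_0[OF d(1), of "fst p" d] by force+
    have "\<bar>?V p - (- k)\<bar> \<le> e" using near[of "fst p" "snd p"] t x d by simp
    moreover have "\<bar>kruzkov_flux (?u p) (?V p) - kruzkov_flux (?u p) (- k)\<bar> \<le> \<bar>?V p - (- k)\<bar>"
      using burg_profile_bound kb by (intro kruzkov_flux_lipschitz) auto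
    moreover have "kruzkov_flux (?u p) (- k) \<le> kruzkov_flux (?u p) k" by (rule kruzkov_flux_neg_le[OF k(1)])
    ultimately have "kruzkov_flux (?u p) (?V p) - kruzkov_flux (?u p) k \<le> e" by linarith
    hence "c2 p * (kruzkov_flux (?u p) (?V p) - kruzkov_flux (?u p) k) \<le> c2 p * e"
      using thD spline_hat_nonneg[OF d(1)] by (intro mult_left_mono) (auto simp: c2_def)
    thus ?thesis by (simp add: a2_def b4_def c2_def algebra_simps)
  qed (auto simp: a2_def b4_def c2_def)
  \<comment> \<open>Left of the shock the profile is already close to the constant \<open>k\<close>,
    so the Lipschitz bound suffices.\<close>
  have le3: "b2 p - a3 p \<le> e * c3 p" for p
  proof (cases "th (snd p) = 0 \<or> ?L (fst p) = 0")
    case False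
    hence t: "a \<le> snd p" "snd p \<le> b" and x: "2*pi - 4*d < fst p" "fst p < 2*pi - d"
      using tz(1)[of "snd p"] spline_hat_0[OF d(1), of "fst p" "2*pi - 4*d"] by force+
    have "\<bar>?V p - k\<bar> \<le> e" using near[of "2*pi - fst p" "snd p"] t x d by simp
    moreover have "\<bar>kruzkov_flux (?u p) k - kruzkov_flux (?u p) (?V p)\<bar> \<le> \<bar>k - ?V p\<bar>"
      using burg_profile_bound kb by (intro kruzkov_flux_lipschitz) auto
    ultimately have "kruzkov_flux (?u p) k - kruzkov_flux (?u p) (?V p) \<le> e" by linarith
    hence "c3 p * (kruzkov_flux (?u p) k - kruzkov_flux (?u p) (?V p)) \<le> c3 p * e"
      using thD spline_hat_nonneg[OF d(1)] by (intro mult_left_mono) (auto simp: c3_def)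
    thus ?thesis by (simp add: b2_def a3_def c3_def algebra_simps)
  qed (auto simp: b2_def a3_def c3_def)
  have l2: "(\<integral>p. a2 p \<partial>lborel) - (\<integral>p. b4 p \<partial>lborel) \<le> e * (\<integral>t. th t \<partial>lborel)"
    using integral_mono[OF Bochner_Integration.integrable_diff[OF int(2,7)] integrable_mult_right[OF c2i(1)] le2] int c2i by simp
  have l3: "(\<integral>p. b2 p \<partial>lborel) - (\<integral>p. a3 p \<partial>lborel) \<le> e * (\<integral>t. th t \<partial>lborel)"
    using integral_mono[OF Bochner_Integration.integrable_diff[OF int(5,3)] integrable_mult_right[OF c3i(1)] le3] int c3i by simp
  have "(M + 1) * (\<integral>p. c1 p \<partial>lborel) \<le> (M + 1) * 8 * d * (\<integral>t. \<bar>th' t\<bar> \<partial>lborel)"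
  proof -
    have "(\<integral>t. \<bar>th' t\<bar> \<partial>lborel) * (\<integral>x. ?bet x \<partial>lborel) \<le> (\<integral>t. \<bar>th' t\<bar> \<partial>lborel) * (8 * d)"
      by (intro mult_left_mono le1') auto
    hence "(M + 1) * (\<integral>p. c1 p \<partial>lborel) \<le> (M + 1) * ((\<integral>t. \<bar>th' t\<bar> \<partial>lborel) * (8 * d))"
      unfolding c1i(2) by (rule mult_left_mono) (use M_nonneg in simp)
    thus ?thesis by (simp only: mult_ac)
  qed
  with i1 i2 i3 le1 l2 l3 show ?thesis unfolding a1_def by linarith
qed

lemma gap_measurable [measurable]:
  "(\<lambda>p. \<bar>u (fst p) (snd p) - burg_profile (fst p) (snd p)\<bar> * indicator {0<..<2*pi} (fst p)) \<in> borel_measurable borel"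
proof -
  have "(\<lambda>p. indicator {0<..<2*pi} (fst p) :: real) \<in> borel_measurable (borel :: (real \<times> real) measure)"
    using measurable_compose[OF measurable_fst_snd_real(1) borel_measurable_indicator[of "{0<..<2*pi}" borel]] by simp
  thus ?thesis using measurable_pair burg_profile_measurable by auto
qed

text \<open>Shrinking the strip sends its cost to 0, while the plateaus converge to the indicator of
  the open cell. The edge error \<open>2 * e\<close> does not shrink and is left for the time
  argument.\<close>

lemma gap_inequality:
  assumes th: "c1_bump th th' a b" "0 < a" and k: "0 \<le> k" "k \<le> 1" and e: "0 \<le> e" and d: "0 < d"
    and near: "\<And>x t. 0 < x \<Longrightarrow> x < d \<Longrightarrow> a \<le> t \<Longrightarrow> t \<le> b \<Longrightarrow>
           \<bar>burg_profile x t + k\<bar> \<le> e \<and> \<bar>burg_profile (2*pi - x) t - k\<bar> \<le> e"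
  shows "0 \<le> (\<integral>t. th' t * L1_gap t \<partial>lborel) + 2 * e * (\<integral>t. th t \<partial>lborel)"
proof -
  note thD = th(1)[unfolded c1_bump_def]
  note thc = c1_bump_continuous[OF th(1), of UNIV]
  have tz: "\<And>t. t < a \<or> b < t \<Longrightarrow> th' t = 0" using thD by auto
  \<comment> \<open>The bound \<open>d/4\<close> keeps both edges in the region where the traces are
    controlled; the bound 1 keeps \<open>5 * r n\<close> below \<open>2*pi\<close>.\<close>
  define c where "c = min (d/4) 1"
  have c: "0 < c" "4 * c \<le> d" "c \<le> 1" using d by (auto simp: c_def)
  define r where "r n = c / real (Suc n)" for n
  have r: "0 < r n" "4 * r n \<le> d" "r n \<le> 1" for n
  proof -
    show "0 < r n" using c by (simp add: r_def)
    have "r n \<le> c / 1" unfolding r_def by (rule divide_left_mono) (use c in auto)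
    thus "4 * r n \<le> d" "r n \<le> 1" using c by auto
  qed
  have r0: "r \<longlonglongrightarrow> 0"
    using tendsto_mult_right_zero[OF LIMSEQ_inverse_real_of_nat, of c]
    unfolding r_def [abs_def] divide_inverse .
  let ?g = "\<lambda>p. \<bar>u (fst p) (snd p) - burg_profile (fst p) (snd p)\<bar>"
  let ?gi = "\<lambda>p. ?g p * indicator {0<..<2*pi} (fst p)"
  define s where "s n p = th' (snd p) * plateau (r n) (2*pi - 4 * r n) (r n) (fst p) * ?g p" for n p
  have pq: "r n \<le> 2*pi - 4 * r n" for n using r(3)[of n] pi_gt3 by linarith
  have gb: "?g p \<le> M + 1" if "a \<le> snd p" for p
    using bound[of "snd p" "fst p"] burg_profile_bound[of "fst p" "snd p"] th(2) that by auto
  obtain C where C: "\<And>t. t \<in> {a..b} \<Longrightarrow> \<bar>th' t\<bar> \<le> C" "0 \<le> C"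
    using continuous_compact_bound[OF compact_Icc continuous_on_subset[OF thc(2) subset_UNIV]] by blast
  have gim: "integrable lborel (\<lambda>p. th' (snd p) * ?gi p)"
  proof (rule integrable_compact_support)
    show "compact ({0..2*pi} \<times> {a..b})" by (intro compact_Times compact_Icc)
    fix p :: "real \<times> real"
    show "th' (snd p) * ?gi p = 0" if "p \<notin> {0..2*pi} \<times> {a..b}"
      using that tz[of "snd p"] by (cases p) (auto simp: not_le indicator_def)
    show "\<bar>th' (snd p) * ?gi p\<bar> \<le> C * (M + 1)" if "p \<in> {0..2*pi} \<times> {a..b}"
      using that C gb[of p] M_nonneg unfolding abs_mult by (intro mult_mono) (auto simp: indicator_def)
  next
    show "(\<lambda>p. th' (snd p) * ?gi p) \<in> borel_measurable borel"
      by (rule borel_measurable_times[OF measurable_compose[OF measurable_fst_snd_real(2)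
            borel_measurable_continuous_onI[OF thc(2)]] gap_measurable])
  qed
  have "(\<lambda>n. \<integral>p. s n p \<partial>lborel) \<longlonglongrightarrow> (\<integral>p. th' (snd p) * ?gi p \<partial>lborel)"
  proof (rule integral_dominated_convergence[where w = "\<lambda>p. \<bar>th' (snd p) * ?gi p\<bar>"])
    show "integrable lborel (\<lambda>p. \<bar>th' (snd p) * ?gi p\<bar>)" by (intro integrable_abs gim)
    show "(\<lambda>p. th' (snd p) * ?gi p) \<in> borel_measurable lborel" using gim by (rule borel_measurable_integrable)
    have pc: "continuous_on UNIV (plateau p q c)" for p q c
      unfolding plateau_def divide_inverse by (intro continuous_intros)
    show "s n \<in> borel_measurable lborel" for n
      using measurable_compose[OF measurable_fst_snd_real(2) borel_measurable_continuous_onI[OF thc(2)]]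
        measurable_compose[OF measurable_fst_snd_real(1) borel_measurable_continuous_onI[OF pc]]
        measurable_pair burg_profile_measurable
      unfolding s_def by (intro borel_measurable_times) auto
    show "AE p in lborel. (\<lambda>n. s n p) \<longlonglongrightarrow> th' (snd p) * ?gi p"
    proof (rule AE_I2)
      fix p :: "real \<times> real"
      have "(\<lambda>n. plateau (r n) (2*pi - 4 * r n) (r n) (fst p)) \<longlonglongrightarrow> indicator {0<..<2*pi} (fst p)"
      proof (cases "0 < fst p \<and> fst p < 2*pi")
        case True
        have "\<forall>\<^sub>F n in sequentially. r n < min (fst p) (2*pi - fst p) / 4"
          by (rule order_tendstoD(2)[OF r0]) (use True in auto)
        hence "\<forall>\<^sub>F n in sequentially. plateau (r n) (2*pi - 4 * r n) (r n) (fst p) = 1"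
        proof (rule eventually_mono)
          fix n assume "r n < min (fst p) (2*pi - fst p) / 4"
          thus "plateau (r n) (2*pi - 4 * r n) (r n) (fst p) = 1"
            by (intro plateau_values(3)[OF r(1) pq]) (auto simp: field_simps)
        qed
        thus ?thesis using True by (simp add: tendsto_eventually)
      next
        case False
        have "plateau (r n) (2*pi - 4 * r n) (r n) (fst p) = 0" for n
        proof (cases "0 < fst p")
          case True
          thus ?thesis using False r(1)[of n] by (intro plateau_values(2)[OF r(1) pq]) auto
        next
          case False
          thus ?thesis using r(1)[of n] by (intro plateau_values(1)[OF r(1) pq]) auto
        qed
        moreover have "indicator {0<..<2*pi} (fst p) = (0::real)" using False by (auto simp: indicator_def)
        ultimately show ?thesis by simp
      qed
      thus "(\<lambda>n. s n p) \<longlonglongrightarrow> th' (snd p) * ?gi p"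
        unfolding s_def by (auto intro!: tendsto_eq_intros)
    qed
    show "AE p in lborel. norm (s n p) \<le> \<bar>th' (snd p) * ?gi p\<bar>" for n
    proof (rule AE_I2)
      fix p :: "real \<times> real"
      have "\<bar>plateau (r n) (2*pi - 4 * r n) (r n) (fst p)\<bar> \<le> indicator {0<..<2*pi} (fst p)"
        using plateau_bounds[OF r(1)[of n] pq[of n], of "fst p"] plateau_values(1)[OF r(1)[of n] pq[of n], of "fst p"]
          plateau_values(2)[OF r(1)[of n] pq[of n], of "fst p"] r(1)[of n]
        by (auto simp: indicator_def)
      hence "\<bar>th' (snd p)\<bar> * \<bar>plateau (r n) (2*pi - 4 * r n) (r n) (fst p)\<bar> * ?g p
          \<le> \<bar>th' (snd p)\<bar> * indicator {0<..<2*pi} (fst p) * ?g p"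
        by (intro mult_right_mono mult_left_mono) auto
      thus "norm (s n p) \<le> \<bar>th' (snd p) * ?gi p\<bar>" by (simp add: s_def abs_mult mult_ac)
    qed
  qed
  moreover have "(\<lambda>n. (M + 1) * 8 * r n * (\<integral>t. \<bar>th' t\<bar> \<partial>lborel)) \<longlonglongrightarrow> 0"
    by (rule tendsto_eq_intros r0 refl)+ simp
  ultimately have "(\<lambda>n. (\<integral>p. s n p \<partial>lborel) + (M + 1) * 8 * r n * (\<integral>t. \<bar>th' t\<bar> \<partial>lborel) + 2 * e * (\<integral>t. th t \<partial>lborel))
      \<longlonglongrightarrow> (\<integral>p. th' (snd p) * ?gi p \<partial>lborel) + 0 + 2 * e * (\<integral>t. th t \<partial>lborel)"
    by (intro tendsto_intros)
  moreover have "0 \<le> (\<integral>p. s n p \<partial>lborel) + (M + 1) * 8 * r n * (\<integral>t. \<bar>th' t\<bar> \<partial>lborel) + 2 * e * (\<integral>t. th t \<partial>lborel)" for n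
    unfolding s_def
  proof (rule strip_inequality[OF th k e r(1)])
    show "5 * r n < 2 * pi" using r(3)[of n] pi_gt3 by linarith
    fix x t assume "0 < x" "x < 4 * r n" "a \<le> t" "t \<le> b"
    thus "\<bar>burg_profile x t + k\<bar> \<le> e \<and> \<bar>burg_profile (2*pi - x) t - k\<bar> \<le> e"
      using near[of x t] r(2)[of n] by auto
  qed
  ultimately have "0 \<le> (\<integral>p. th' (snd p) * ?gi p \<partial>lborel) + 0 + 2 * e * (\<integral>t. th t \<partial>lborel)"
    by (intro LIMSEQ_le_const) auto
  moreover have "(\<integral>p. th' (snd p) * ?gi p \<partial>lborel) = (\<integral>t. th' t * L1_gap t \<partial>lborel)"
    unfolding integrable_lborel_pairI(2)[OF gim, symmetric] L1_gap_def by simp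
  ultimately show ?thesis by simp
qed

end

subsection \<open>Uniqueness\<close>

lemma integrable_slice_gap:
  fixes f :: "real \<Rightarrow> real"
  assumes "f \<in> borel_measurable borel" "\<And>x. \<bar>f x\<bar> \<le> B"
  shows "integrable lborel (\<lambda>x. \<bar>f x\<bar> * indicator {0<..<2*pi} x)"
proof (rule integrable_compact_support[of _ "{0..2*pi}" B])
  show "(\<lambda>x. \<bar>f x\<bar> * indicator {0<..<2*pi} x) \<in> borel_measurable borel"
    using assms(1) by auto
  show "\<bar>\<bar>f x\<bar> * indicator {0<..<2*pi} x\<bar> \<le> B" for x
    using assms(2)[of x] by (auto simp: indicator_def)
qed (auto simp: indicator_def)

lemma L1_slice_le_torus:
  assumes "f \<in> borel_measurable borel" "g \<in> borel_measurable borel" "\<And>x. \<bar>f x - g x\<bar> \<le> B"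
  shows "ennreal (\<integral>x. \<bar>f x - g x\<bar> * indicator {0<..<2*pi} x \<partial>lborel) \<le> L1_torus_dist f g"
proof -
  have "integrable lborel (\<lambda>x. \<bar>f x - g x\<bar> * indicator {0<..<2*pi} x)"
    using assms by (intro integrable_slice_gap[of "\<lambda>x. f x - g x" B]) auto
  hence "ennreal (\<integral>x. \<bar>f x - g x\<bar> * indicator {0<..<2*pi} x \<partial>lborel)
     = (\<integral>\<^sup>+x. ennreal (\<bar>f x - g x\<bar> * indicator {0<..<2*pi} x) \<partial>lborel)"
    by (intro nn_integral_eq_integral[symmetric]) auto
  also have "\<dots> \<le> L1_torus_dist f g"
    unfolding L1_torus_dist_def by (intro nn_integral_mono) (auto simp: indicator_def)
  finally show ?thesis .
qed

lemma tendsto_slice_gap: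
  assumes "((\<lambda>s. L1_torus_dist (f s) g) \<longlongrightarrow> 0) F"
    and "\<forall>\<^sub>F s in F. f s \<in> borel_measurable borel \<and> (\<forall>x. \<bar>f s x - g x\<bar> \<le> B)" "g \<in> borel_measurable borel"
  shows "((\<lambda>s. \<integral>x. \<bar>f s x - g x\<bar> * indicator {0<..<2*pi} x \<partial>lborel) \<longlongrightarrow> 0) F"
proof -
  let ?a = "\<lambda>s. \<integral>x. \<bar>f s x - g x\<bar> * indicator {0<..<2*pi} x \<partial>lborel"
  have "((\<lambda>s. ennreal (?a s)) \<longlongrightarrow> ennreal 0) F"
  proof (rule tendsto_sandwich[OF _ _ tendsto_const])
    show "\<forall>\<^sub>F s in F. ennreal (?a s) \<le> L1_torus_dist (f s) g"
      using assms(2) by eventually_elim (use assms(3) L1_slice_le_torus in blast)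
  qed (use assms(1) in auto)
  thus ?thesis by (subst (asm) tendsto_ennreal_iff) (auto intro!: always_eventually integral_nonneg_AE)
qed

lemma slice_measurable:
  assumes "(\<lambda>p. w (fst p) (snd p)) \<in> borel_measurable (borel :: (real \<times> real) measure)"
  shows "(\<lambda>x. w x t) \<in> borel_measurable borel"
proof -
  have "(\<lambda>x. (x, t)) \<in> borel_measurable borel"
    by (intro borel_measurable_continuous_onI continuous_intros)
  from measurable_compose[OF this assms] show ?thesis by simp
qed

lemma burg_profile_L1_continuous:
  assumes "0 \<le> t"
  shows "((\<lambda>s. \<integral>x. \<bar>burg_profile x s - burg_profile x t\<bar> * indicator {0<..<2*pi} x \<partial>lborel) \<longlongrightarrow> 0) (at t within {0..})"
  unfolding tendsto_at_iff_sequentially comp_def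
proof (intro allI impI)
  fix X assume X: "\<forall>i. X i \<in> {0..} - {t}" "X \<longlonglongrightarrow> t"
  note sm = slice_measurable[OF burg_profile_measurable]
  have m: "(\<lambda>x. \<bar>burg_profile x s - burg_profile x t\<bar> * indicator {0<..<2*pi} x) \<in> borel_measurable lborel" for s
    using sm[of s] sm[of t] by auto
  have "(\<lambda>i. \<integral>x. \<bar>burg_profile x (X i) - burg_profile x t\<bar> * indicator {0<..<2*pi} x \<partial>lborel) \<longlonglongrightarrow> integral\<^sup>L lborel (\<lambda>x::real. 0::real)"
  proof (rule integral_dominated_convergence[where w = "\<lambda>x. 2 * indicator {0<..<2*pi} x"])
    show "AE x in lborel. (\<lambda>i. \<bar>burg_profile x (X i) - burg_profile x t\<bar> * indicator {0<..<2*pi} x) \<longlonglongrightarrow> 0"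
    proof (rule AE_I2)
      fix x :: real
      show "(\<lambda>i. \<bar>burg_profile x (X i) - burg_profile x t\<bar> * indicator {0<..<2*pi} x) \<longlonglongrightarrow> 0"
      proof (cases "x \<in> {0<..<2*pi}")
        case True
        have "(\<lambda>i. (\<lambda>p. burg_profile (fst p) (snd p)) (x, X i)) \<longlonglongrightarrow> (\<lambda>p. burg_profile (fst p) (snd p)) (x, t)"
          by (rule continuous_on_tendsto_compose[OF continuous_on_burg_profile])
             (use True X assms in \<open>auto intro!: tendsto_intros always_eventually\<close>)
        hence "(\<lambda>i. burg_profile x (X i)) \<longlonglongrightarrow> burg_profile x t" by simp
        hence "(\<lambda>i. \<bar>burg_profile x (X i) - burg_profile x t\<bar>) \<longlonglongrightarrow> 0"
          using tendsto_rabs_zero LIM_zero by blast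
        thus ?thesis using True by simp
      qed simp
    qed
    show "AE x in lborel. norm (\<bar>burg_profile x (X i) - burg_profile x t\<bar> * indicator {0<..<2*pi} x) \<le> 2 * indicator {0<..<2*pi} x" for i
      using burg_profile_bound[of _ "X i"] burg_profile_bound[of _ t]
      by (intro AE_I2) (auto simp: indicator_def intro: order_trans[OF abs_triangle_ineq4] add_mono[of _ "1::real" _ 1, simplified])
  qed (use m in auto)
  thus "(\<lambda>i. \<integral>x. \<bar>burg_profile x (X i) - burg_profile x t\<bar> * indicator {0<..<2*pi} x \<partial>lborel) \<longlonglongrightarrow> 0" by simp
qed

text \<open>Test functions produce time averages of the gap; this recovers its value at a single
  time.\<close>

lemma hat_average:
  fixes F :: "real \<Rightarrow> real"
  assumes "F \<in> borel_measurable borel" "0 < d" "\<And>s. a \<le> s \<Longrightarrow> s \<le> a + 3*d \<Longrightarrow> \<bar>F s - c\<bar> \<le> r"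
  shows "integrable lborel (\<lambda>s. spline_hat a d s * F s)" "\<bar>(\<integral>s. spline_hat a d s * F s \<partial>lborel) - c\<bar> \<le> r"
proof -
  note hi = spline_hat_integral[OF assms(2), of a]
  have hc: "continuous_on UNIV (spline_hat a d)" by (intro continuous_intros)
  have b: "\<bar>spline_hat a d s * (F s - c)\<bar> \<le> spline_hat a d s * r" for s
  proof (cases "a \<le> s \<and> s \<le> a + 3*d")
    case True
    thus ?thesis using assms(3)[of s] spline_hat_nonneg[OF assms(2), of a s]
      by (simp add: abs_mult mult_left_mono)
  next
    case False
    thus ?thesis using spline_hat_0[OF assms(2), of s a] by auto
  qed
  have i: "integrable lborel (\<lambda>s. spline_hat a d s * (F s - c))"
  proof (rule Bochner_Integration.integrable_bound)
    show "integrable lborel (\<lambda>s. spline_hat a d s * r)" using hi by simp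
    show "(\<lambda>s. spline_hat a d s * (F s - c)) \<in> borel_measurable lborel"
      using assms(1) borel_measurable_continuous_onI[OF hc] by simp
    show "AE s in lborel. norm (spline_hat a d s * (F s - c)) \<le> norm (spline_hat a d s * r)"
      using order_trans[OF b abs_ge_self] by (intro AE_I2) simp
  qed
  have eq: "(\<lambda>s. spline_hat a d s * F s) = (\<lambda>s. spline_hat a d s * (F s - c) + spline_hat a d s * c)"
    by (simp add: algebra_simps)
  show "integrable lborel (\<lambda>s. spline_hat a d s * F s)"
    unfolding eq using i hi by (intro Bochner_Integration.integrable_add) auto
  have "(\<integral>s. spline_hat a d s * F s \<partial>lborel) - c = (\<integral>s. spline_hat a d s * (F s - c) \<partial>lborel)"
    unfolding eq using i hi by simp
  moreover have "\<bar>(\<integral>s. spline_hat a d s * (F s - c) \<partial>lborel)\<bar> \<le> (\<integral>s. \<bar>spline_hat a d s * (F s - c)\<bar> \<partial>lborel)"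
    by (rule integral_abs_bound)
  moreover have "(\<integral>s. \<bar>spline_hat a d s * (F s - c)\<bar> \<partial>lborel) \<le> (\<integral>s. spline_hat a d s * r \<partial>lborel)"
    by (intro integral_mono integrable_abs i b integrable_mult_left hi)
  moreover have "(\<integral>s. spline_hat a d s * r \<partial>lborel) = r" using hi by simp
  ultimately show "\<bar>(\<integral>s. spline_hat a d s * F s \<partial>lborel) - c\<bar> \<le> r" by linarith
qed

text \<open>Stated for phase 0 only; a general phase is translated to it below.\<close>

locale burgers_solution = kruzkov_solution +
  assumes L1_continuous: "0 < t \<Longrightarrow> ((\<lambda>s. L1_torus_dist (\<lambda>x. u x s) (\<lambda>x. u x t)) \<longlongrightarrow> 0) (at t within {0<..})"
    and L1_initial: "((\<lambda>s. L1_torus_dist (\<lambda>x. u x s) (burg_init 0)) \<longlongrightarrow> 0) (at_right 0)"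
begin

lemmas u_slice = slice_measurable[OF measurable_pair]
lemmas v_slice = slice_measurable[OF burg_profile_measurable]

lemma L1_gap_measurable: "L1_gap \<in> borel_measurable borel"
proof -
  have sw: "(\<lambda>p. (snd p, fst p)) \<in> measurable (borel :: (real \<times> real) measure) borel"
    by (intro borel_measurable_continuous_onI continuous_intros)
  have S: "sets (borel \<Otimes>\<^sub>M lborel) = sets (borel :: (real \<times> real) measure)"
    using sets_pair_measure_cong[OF refl sets_lborel, of "borel :: real measure"] borel_prod by metis
  have "(\<lambda>(t, x). \<bar>u x t - burg_profile x t\<bar> * indicator {0<..<2*pi} x) \<in> borel_measurable (borel \<Otimes>\<^sub>M lborel)"
    unfolding measurable_cong_sets[OF S refl]
    using measurable_compose[OF sw gap_measurable] by (simp add: case_prod_beta')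
  from lborel.borel_measurable_lebesgue_integral[OF this] show ?thesis
    unfolding L1_gap_def [abs_def] by simp
qed

lemma L1_gap_nonneg: "0 \<le> L1_gap t"
  unfolding L1_gap_def by (intro integral_nonneg_AE) auto

lemma gap_integrable:
  assumes "0 \<le> t"
  shows "integrable lborel (\<lambda>x. \<bar>u x t - burg_profile x t\<bar> * indicator {0<..<2*pi} x)"
proof (rule integrable_slice_gap[where B = "M + 1"])
  show "(\<lambda>x. u x t - burg_profile x t) \<in> borel_measurable borel" using u_slice v_slice by auto
  show "\<bar>u x t - burg_profile x t\<bar> \<le> M + 1" for x
    using bound[OF assms, of x] burg_profile_bound[of x t] by auto
qed

text \<open>The comparison pair \<open>g\<close>, \<open>g'\<close> is left open so that the lemma
  serves both continuity at positive times and the limit at time 0, where \<open>g\<close> is the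
  initial datum.\<close>

lemma L1_gap_triangle:
  assumes "0 \<le> s" "g \<in> borel_measurable borel" "g' \<in> borel_measurable borel" "\<And>x. \<bar>g x\<bar> \<le> B" "\<And>x. \<bar>g' x\<bar> \<le> B"
  shows "\<bar>L1_gap s - (\<integral>x. \<bar>g x - g' x\<bar> * indicator {0<..<2*pi} x \<partial>lborel)\<bar> \<le>
     (\<integral>x. \<bar>u x s - g x\<bar> * indicator {0<..<2*pi} x \<partial>lborel)
     + (\<integral>x. \<bar>burg_profile x s - g' x\<bar> * indicator {0<..<2*pi} x \<partial>lborel)"
proof -
  note us = u_slice[of s] and vs = v_slice[of s]
  have i: "integrable lborel (\<lambda>x. \<bar>g x - g' x\<bar> * indicator {0<..<2*pi} x)"
    "integrable lborel (\<lambda>x. \<bar>u x s - g x\<bar> * indicator {0<..<2*pi} x)"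
    "integrable lborel (\<lambda>x. \<bar>burg_profile x s - g' x\<bar> * indicator {0<..<2*pi} x)"
  proof -
    have "\<bar>g x - g' x\<bar> \<le> B + B" "\<bar>u x s - g x\<bar> \<le> M + B" "\<bar>burg_profile x s - g' x\<bar> \<le> 1 + B" for x
      using assms(4)[of x] assms(5)[of x] bound[OF assms(1), of x] burg_profile_bound[of x s] by auto
    thus "integrable lborel (\<lambda>x. \<bar>g x - g' x\<bar> * indicator {0<..<2*pi} x)"
      "integrable lborel (\<lambda>x. \<bar>u x s - g x\<bar> * indicator {0<..<2*pi} x)"
      "integrable lborel (\<lambda>x. \<bar>burg_profile x s - g' x\<bar> * indicator {0<..<2*pi} x)"
      using assms(2,3) us vs by (auto intro!: integrable_slice_gap)
  qed
  note gi = gap_integrable[OF assms(1)]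
  let ?I = "\<lambda>x. indicator {0<..<2*pi} x :: real"
  have "\<bar>L1_gap s - (\<integral>x. \<bar>g x - g' x\<bar> * ?I x \<partial>lborel)\<bar>
     = \<bar>\<integral>x. \<bar>u x s - burg_profile x s\<bar> * ?I x - \<bar>g x - g' x\<bar> * ?I x \<partial>lborel\<bar>"
    unfolding L1_gap_def using i gi by simp
  also have "\<dots> \<le> (\<integral>x. \<bar>\<bar>u x s - burg_profile x s\<bar> * ?I x - \<bar>g x - g' x\<bar> * ?I x\<bar> \<partial>lborel)"
    by (rule integral_abs_bound)
  also have "\<dots> \<le> (\<integral>x. \<bar>u x s - g x\<bar> * ?I x + \<bar>burg_profile x s - g' x\<bar> * ?I x \<partial>lborel)"
    by (intro integral_mono integrable_abs Bochner_Integration.integrable_diff Bochner_Integration.integrable_add i gi)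
       (auto simp: indicator_def)
  also have "\<dots> = (\<integral>x. \<bar>u x s - g x\<bar> * ?I x \<partial>lborel) + (\<integral>x. \<bar>burg_profile x s - g' x\<bar> * ?I x \<partial>lborel)"
    using i by simp
  finally show ?thesis .
qed

lemma L1_gap_tendsto:
  assumes "0 < t"
  shows "(L1_gap \<longlongrightarrow> L1_gap t) (at t within {0<..})"
proof -
  have pos: "\<forall>\<^sub>F s in at t within {0<..}. 0 < s" by (auto simp: eventually_at_filter)
  have 1: "((\<lambda>s. \<integral>x. \<bar>u x s - u x t\<bar> * indicator {0<..<2*pi} x \<partial>lborel) \<longlongrightarrow> 0) (at t within {0<..})"
  proof (intro tendsto_slice_gap[OF L1_continuous[OF assms], of "M + M"] u_slice eventually_mono[OF pos] conjI allI)
    fix s x :: real assume "0 < s"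
    thus "\<bar>u x s - u x t\<bar> \<le> M + M" using bound[of s x] bound[of t x] assms by auto
  qed
  have 2: "((\<lambda>s. \<integral>x. \<bar>burg_profile x s - burg_profile x t\<bar> * indicator {0<..<2*pi} x \<partial>lborel) \<longlongrightarrow> 0) (at t within {0<..})"
    by (rule tendsto_within_subset[OF burg_profile_L1_continuous]) (use assms in auto)
  have "((\<lambda>s. L1_gap s - L1_gap t) \<longlongrightarrow> 0) (at t within {0<..})"
  proof (rule Lim_null_comparison[OF _ tendsto_add_zero[OF 1 2]])
    show "\<forall>\<^sub>F s in at t within {0<..}. norm (L1_gap s - L1_gap t) \<le>
     (\<integral>x. \<bar>u x s - u x t\<bar> * indicator {0<..<2*pi} x \<partial>lborel)
     + (\<integral>x. \<bar>burg_profile x s - burg_profile x t\<bar> * indicator {0<..<2*pi} x \<partial>lborel)"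
      using pos
    proof eventually_elim
      case (elim s)
      have B: "\<bar>u x t\<bar> \<le> M + 1" "\<bar>burg_profile x t\<bar> \<le> M + 1" for x
        using bound[of t x] burg_profile_bound[of x t] assms M_nonneg by auto
      show ?case
        unfolding real_norm_def L1_gap_def[of t]
        by (rule L1_gap_triangle[OF less_imp_le[OF elim] u_slice v_slice B])
    qed
  qed
  thus ?thesis by (rule LIM_zero_cancel)
qed

lemma L1_gap_initial: "(L1_gap \<longlongrightarrow> 0) (at_right 0)"
proof -
  have pos: "\<forall>\<^sub>F s in at_right (0::real). 0 < s" by (auto simp: eventually_at_filter)
  have im: "burg_init 0 \<in> borel_measurable borel"
    unfolding burg_init_def by (intro borel_measurable_continuous_onI continuous_intros)
  have ib: "\<bar>burg_init 0 x\<bar> \<le> 1" for x by (simp add: burg_init_def)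
  have 1: "((\<lambda>s. \<integral>x. \<bar>u x s - burg_init 0 x\<bar> * indicator {0<..<2*pi} x \<partial>lborel) \<longlongrightarrow> 0) (at_right 0)"
  proof (intro tendsto_slice_gap[OF L1_initial, of "M + 1"] im u_slice eventually_mono[OF pos] conjI allI)
    fix s x :: real assume "0 < s"
    thus "\<bar>u x s - burg_init 0 x\<bar> \<le> M + 1" using bound[of s x] ib[of x] by auto
  qed
  have 2: "((\<lambda>s. \<integral>x. \<bar>burg_profile x s - burg_profile x 0\<bar> * indicator {0<..<2*pi} x \<partial>lborel) \<longlongrightarrow> 0) (at_right 0)"
    by (rule tendsto_within_subset[OF burg_profile_L1_continuous]) auto
  have z: "(\<integral>x. \<bar>burg_init 0 x - burg_profile x 0\<bar> * indicator {0<..<2*pi} x \<partial>lborel) = 0"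
  proof -
    have "(\<lambda>x. \<bar>burg_init 0 x - burg_profile x 0\<bar> * indicator {0<..<2*pi} x) = (\<lambda>x. 0)"
      by (auto simp: fun_eq_iff indicator_def burg_init_def burg_profile_eq char_foot_0)
    thus ?thesis by simp
  qed
  show ?thesis
  proof (rule Lim_null_comparison[OF _ tendsto_add_zero[OF 1 2]])
    show "\<forall>\<^sub>F s in at_right 0. norm (L1_gap s) \<le>
     (\<integral>x. \<bar>u x s - burg_init 0 x\<bar> * indicator {0<..<2*pi} x \<partial>lborel)
     + (\<integral>x. \<bar>burg_profile x s - burg_profile x 0\<bar> * indicator {0<..<2*pi} x \<partial>lborel)"
      using pos
    proof eventually_elim
      case (elim s)
      have "\<bar>L1_gap s - (\<integral>x. \<bar>burg_init 0 x - burg_profile x 0\<bar> * indicator {0<..<2*pi} x \<partial>lborel)\<bar> \<le>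
         (\<integral>x. \<bar>u x s - burg_init 0 x\<bar> * indicator {0<..<2*pi} x \<partial>lborel)
         + (\<integral>x. \<bar>burg_profile x s - burg_profile x 0\<bar> * indicator {0<..<2*pi} x \<partial>lborel)"
        by (rule L1_gap_triangle[OF _ im v_slice, where B = 1])
           (use elim ib burg_profile_bound in auto)
      thus ?case by (simp add: z)
    qed
  qed
qed

text \<open>Near \<open>t0\<close> the traces stay within \<open>e\<close> of \<open>-k\<close> and
  \<open>k\<close> for one fixed \<open>k\<close>, so each unit of time costs at most
  \<open>2 * e\<close>. A time plateau rising at \<open>a\<close> and falling after \<open>b\<close>
  compares averages of the gap at both ends, which continuity turns into values.\<close>

lemma L1_gap_local:
  assumes "0 < t0" "0 < e"
  shows "\<exists>d>0. \<forall>a b. 0 < a \<longrightarrow> t0 - d < a \<longrightarrow> a < b \<longrightarrow> b < t0 + d \<longrightarrow> L1_gap b \<le> L1_gap a + 2 * e * (b - a)"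
proof -
  obtain k d where k: "0 \<le> k" "k \<le> 1" and d: "0 < d"
    and near: "\<And>x t. 0 < x \<Longrightarrow> x < d \<Longrightarrow> \<bar>t - t0\<bar> < d \<Longrightarrow> 0 \<le> t \<Longrightarrow>
           \<bar>burg_profile x t + k\<bar> < e \<and> \<bar>burg_profile (2*pi - x) t - k\<bar> < e"
    using burg_profile_shock_limit[of t0 e] assms by auto
  show ?thesis
  proof (intro exI[of _ d] conjI allI impI d)
    fix a b assume ab: "0 < a" "t0 - d < a" "a < b" "b < t0 + d"
    show "L1_gap b \<le> L1_gap a + 2 * e * (b - a)"
    proof (rule field_le_epsilon)
      fix r' :: real assume r': "0 < r'"
      \<comment> \<open>The tolerance \<open>r'\<close> pays for two averages replaced by values,
        each costing \<open>r\<close>, and for the excess length \<open>3*w \<le> 3*r\<close> of the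
        time plateau at rate \<open>2 * e\<close>.\<close>
      define q where "q = 2 + 6 * e"
      define r where "r = r' / q"
      have "0 < q" using assms by (simp add: q_def)
      hence "0 < r" "r * q = r'" using r' by (auto simp: r_def)
      hence r: "0 < r" "2 * r + 6 * e * r = r'" by (auto simp: q_def algebra_simps)
      have cont: "\<exists>w>0. \<forall>s. c \<le> s \<longrightarrow> s < c + w \<longrightarrow> \<bar>L1_gap s - L1_gap c\<bar> \<le> r" if "0 < c" for c
      proof -
        have "\<forall>\<^sub>F s in at c within {0<..}. \<bar>L1_gap s - L1_gap c\<bar> < r"
          using tendstoD[OF L1_gap_tendsto[OF that] r(1)] by (simp add: dist_real_def)
        then obtain w where w: "w > 0" "\<And>s. s > 0 \<Longrightarrow> s \<noteq> c \<Longrightarrow> \<bar>s - c\<bar> < w \<Longrightarrow> \<bar>L1_gap s - L1_gap c\<bar> < r"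
          unfolding eventually_at by (auto simp: dist_real_def)
        show ?thesis
        proof (intro exI[of _ w] conjI allI impI w(1))
          fix s assume "c \<le> s" "s < c + w"
          thus "\<bar>L1_gap s - L1_gap c\<bar> \<le> r" using w(2)[of s] that r(1) by (cases "s = c") auto
        qed
      qed
      obtain w1 w2 where w: "0 < w1" "0 < w2"
        "\<And>s. a \<le> s \<Longrightarrow> s < a + w1 \<Longrightarrow> \<bar>L1_gap s - L1_gap a\<bar> \<le> r"
        "\<And>s. b \<le> s \<Longrightarrow> s < b + w2 \<Longrightarrow> \<bar>L1_gap s - L1_gap b\<bar> \<le> r"
        using cont[of a] cont[of b] ab by auto
      define w where "w = Min {w1/4, w2/4, (t0 + d - b)/4, r}"
      have w': "0 < w" "3*w < w1" "3*w < w2" "3*w < t0 + d - b" "w \<le> r"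
        using w ab r by (auto simp: w_def min_def)
      let ?th = "plateau a b w"
      note th = c1_bump_plateau[OF w'(1) less_imp_le[OF ab(3)]]
      have ha: "integrable lborel (\<lambda>s. spline_hat a w s * L1_gap s)"
          "\<bar>(\<integral>s. spline_hat a w s * L1_gap s \<partial>lborel) - L1_gap a\<bar> \<le> r"
        by (rule hat_average[OF L1_gap_measurable w'(1)]; use w(3) w'(2) in force)+
      have hb: "integrable lborel (\<lambda>s. spline_hat b w s * L1_gap s)"
          "\<bar>(\<integral>s. spline_hat b w s * L1_gap s \<partial>lborel) - L1_gap b\<bar> \<le> r"
        by (rule hat_average[OF L1_gap_measurable w'(1)]; use w(4) w'(3) in force)+
      have "0 \<le> (\<integral>t. (spline_hat a w t - spline_hat b w t) * L1_gap t \<partial>lborel) + 2 * e * (\<integral>t. ?th t \<partial>lborel)"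
      proof (rule gap_inequality[OF th ab(1) k less_imp_le[OF assms(2)] d])
        fix x t assume "0 < x" "x < d" "a \<le> t" "t \<le> b + 3 * w"
        thus "\<bar>burg_profile x t + k\<bar> \<le> e \<and> \<bar>burg_profile (2*pi - x) t - k\<bar> \<le> e"
          using near[of x t] ab w'(4) by (auto simp: abs_less_iff)
      qed
      also have "(\<integral>t. (spline_hat a w t - spline_hat b w t) * L1_gap t \<partial>lborel)
         = (\<integral>s. spline_hat a w s * L1_gap s \<partial>lborel) - (\<integral>s. spline_hat b w s * L1_gap s \<partial>lborel)"
        using ha hb by (simp add: left_diff_distrib)
      finally have main: "(\<integral>s. spline_hat b w s * L1_gap s \<partial>lborel) \<le> (\<integral>s. spline_hat a w s * L1_gap s \<partial>lborel)
         + 2 * e * (\<integral>t. ?th t \<partial>lborel)" by simp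
      have "(\<integral>t. ?th t \<partial>lborel) \<le> (\<integral>t. indicator {a..b + 3*w} t \<partial>lborel)"
      proof (rule integral_mono)
        have z: "\<And>t. t \<notin> {a..b+3*w} \<Longrightarrow> ?th t = 0" using th by (auto simp: c1_bump_def not_le)
        note pb = plateau_bounds[OF w'(1) less_imp_le[OF ab(3)]]
        show "integrable lborel ?th"
          by (rule integrable_compact_support[OF borel_measurable_continuous_onI[OF c1_bump_continuous(1)[OF th]] compact_Icc z, where B = 1])
             (use pb in auto)
        show "?th t \<le> indicator {a..b + 3*w} t" for t using z[of t] pb by (auto simp: indicator_def)
      qed (use ab w' in auto)
      also have "\<dots> = b + 3*w - a" using ab w' by simp
      finally have "(\<integral>t. ?th t \<partial>lborel) \<le> b - a + 3 * r" using w' by simp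
      hence "2 * e * (\<integral>t. ?th t \<partial>lborel) \<le> 2 * e * (b - a + 3 * r)" using assms by (intro mult_left_mono) auto
      also have "\<dots> = 2 * e * (b - a) + 6 * e * r" by (simp add: algebra_simps)
      finally have m2: "2 * e * (\<integral>t. ?th t \<partial>lborel) \<le> 2 * e * (b - a) + 6 * e * r" .
      show "L1_gap b \<le> L1_gap a + 2 * e * (b - a) + r'"
        using ha(2) hb(2) main m2 r(2) by linarith
    qed
  qed
qed

text \<open>The local estimates have errors additive in the interval length, so they chain over any
  compact interval of positive times; choosing the rate \<open>e = r / (2 * c)\<close> makes the
  total equal to \<open>r\<close>.\<close>

lemma L1_gap_antimono:
  assumes "0 < a" "a < b"
  shows "L1_gap b \<le> L1_gap a"
proof (rule field_le_epsilon)
  fix r :: real assume r: "0 < r"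
  define c where "c = b - a"
  define e where "e = r / (2 * c)"
  have "0 < c" using assms by (simp add: c_def)
  hence "0 < e" "2 * e * c = r" using r by (auto simp: e_def)
  hence e: "0 < e" "2 * e * (b - a) = r" by (simp_all only: c_def)
  \<comment> \<open>The guard is part of the predicate, since the small intervals supplied around a
    point may begin at a nonpositive time.\<close>
  have "0 < a \<longrightarrow> L1_gap b \<le> L1_gap a + 2 * e * (b - a)"
    using less_imp_le[OF assms(2)]
  proof (induction rule: Bolzano)
    case (trans x y z)
    thus ?case by (auto simp: algebra_simps)
  next
    case (local t0)
    hence "0 < t0" using assms by simp
    then obtain d where d: "d > 0" "\<And>a b. 0 < a \<Longrightarrow> t0 - d < a \<Longrightarrow> a < b \<Longrightarrow> b < t0 + d \<Longrightarrow> L1_gap b \<le> L1_gap a + 2 * e * (b - a)"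
      using L1_gap_local[of t0 e] e by blast
    show ?case
    proof (intro exI[of _ d] conjI allI impI d(1))
      fix x y assume xy: "x \<le> t0 \<and> t0 \<le> y \<and> y - x < d" "0 < x"
      show "L1_gap y \<le> L1_gap x + 2 * e * (y - x)"
        using d(2)[of x y] xy d(1) by (cases "x = y") auto
    qed
  qed
  thus "L1_gap b \<le> L1_gap a + r" using e assms by simp
qed

lemma L1_gap_zero:
  assumes "0 < t"
  shows "L1_gap t = 0"
proof -
  have "L1_gap t \<le> 0"
  proof (rule tendsto_lowerbound[OF L1_gap_initial])
    have "\<forall>\<^sub>F s in at_right 0. s < t" using assms eventually_at_right_real[OF assms] by (auto elim: eventually_mono)
    moreover have "\<forall>\<^sub>F s in at_right (0::real). 0 < s" by (auto simp: eventually_at_filter)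
    ultimately show "\<forall>\<^sub>F s in at_right 0. L1_gap t \<le> L1_gap s"
      by eventually_elim (rule L1_gap_antimono)
  qed simp
  thus ?thesis using L1_gap_nonneg[of t] by simp
qed

lemma entropy_solution_eq_profile:
  assumes "0 < t"
  shows "AE x in lborel. 0 < x \<and> x < 2*pi \<longrightarrow> u x t = burg_profile x t"
proof -
  have "AE x in lborel. \<bar>u x t - burg_profile x t\<bar> * indicator {0<..<2*pi} x = 0"
    using integral_nonneg_eq_0_iff_AE[OF gap_integrable[of t]] L1_gap_zero[OF assms] assms
    by (simp add: L1_gap_def)
  thus ?thesis by (rule eventually_mono) (auto simp: indicator_def)
qed

end

section \<open>Reduction of a general phase to phase zero\<close>

lemma nn_integral_shift:
  fixes f :: "real \<Rightarrow> ennreal"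
  assumes "f \<in> borel_measurable borel"
  shows "(\<integral>\<^sup>+x. f (x + c) \<partial>lborel) = (\<integral>\<^sup>+x. f x \<partial>lborel)"
  using nn_integral_real_affine[OF assms, of 1 c] by (simp add: add.commute)

text \<open>The translated period is cut at \<open>2*pi\<close> and the part beyond is moved back.
  The pieces match up to two points of measure zero.\<close>

lemma nn_integral_periodic_shift:
  fixes h :: "real \<Rightarrow> ennreal"
  assumes m: "h \<in> borel_measurable borel" and per: "\<And>x. h (x + 2*pi) = h x" and c: "0 \<le> c" "c \<le> 2*pi"
  shows "(\<integral>\<^sup>+x\<in>{0..2*pi}. h (x + c) \<partial>lborel) = (\<integral>\<^sup>+x\<in>{0..2*pi}. h x \<partial>lborel)"
proof -
  have mi: "(\<lambda>x. h x * indicator A x) \<in> borel_measurable borel" if "A \<in> sets borel" for A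
    using m that by auto
  have "(\<integral>\<^sup>+x\<in>{0..2*pi}. h (x + c) \<partial>lborel) = (\<integral>\<^sup>+x. h (x + c) * indicator {c..c+2*pi} (x + c) \<partial>lborel)"
    by (intro nn_integral_cong) (auto simp: indicator_def)
  also have "\<dots> = (\<integral>\<^sup>+x. h x * indicator {c..c+2*pi} x \<partial>lborel)"
    by (rule nn_integral_shift[OF mi]) simp
  also have "\<dots> = (\<integral>\<^sup>+x. h x * indicator {c..<2*pi} x + h x * indicator {2*pi..c+2*pi} x \<partial>lborel)"
    by (intro nn_integral_cong) (use c in \<open>auto simp: indicator_def\<close>)
  also have "\<dots> = (\<integral>\<^sup>+x. h x * indicator {c..<2*pi} x \<partial>lborel) + (\<integral>\<^sup>+x. h x * indicator {2*pi..c+2*pi} x \<partial>lborel)"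
    using mi by (intro nn_integral_add) auto
  also have "(\<integral>\<^sup>+x. h x * indicator {2*pi..c+2*pi} x \<partial>lborel)
      = (\<integral>\<^sup>+x. h (x + 2*pi) * indicator {2*pi..c+2*pi} (x + 2*pi) \<partial>lborel)"
    by (rule nn_integral_shift[OF mi, symmetric]) simp
  also have "\<dots> = (\<integral>\<^sup>+x. h x * indicator {0..c} x \<partial>lborel)"
    by (intro nn_integral_cong) (auto simp: indicator_def per)
  also have "(\<integral>\<^sup>+x. h x * indicator {c..<2*pi} x \<partial>lborel) + (\<integral>\<^sup>+x. h x * indicator {0..c} x \<partial>lborel)
      = (\<integral>\<^sup>+x. h x * indicator {c..<2*pi} x + h x * indicator {0..c} x \<partial>lborel)"
    using mi by (intro nn_integral_add[symmetric]) auto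
  also have "\<dots> = (\<integral>\<^sup>+x\<in>{0..2*pi}. h x \<partial>lborel)"
  proof (rule nn_integral_cong_AE)
    show "AE x in lborel. h x * indicator {c..<2*pi} x + h x * indicator {0..c} x = h x * indicator {0..2*pi} x"
      using AE_lborel_singleton[of c] AE_lborel_singleton[of "2*pi"]
      by eventually_elim (use c in \<open>auto simp: indicator_def\<close>)
  qed
  finally show ?thesis .
qed

lemma L1_torus_dist_shift:
  assumes "f \<in> borel_measurable borel" "g \<in> borel_measurable borel"
    and "\<And>x. f (x + 2*pi) = f x" "\<And>x. g (x + 2*pi) = g x" "0 \<le> c" "c \<le> 2*pi"
  shows "L1_torus_dist (\<lambda>x. f (x + c)) (\<lambda>x. g (x + c)) = L1_torus_dist f g"
  unfolding L1_torus_dist_def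
  by (rule nn_integral_periodic_shift[where h = "\<lambda>x. ennreal \<bar>f x - g x\<bar>"]) (use assms in auto)

lemma nonneg_test_fun_shift:
  assumes "nonneg_test_fun ph phx pht"
  shows "nonneg_test_fun (\<lambda>x. ph (x - c)) (\<lambda>x. phx (x - c)) (\<lambda>x. pht (x - c))"
proof -
  note a = assms[unfolded nonneg_test_fun_def]
  obtain a0 R where R: "0 < a0" "\<And>x t. ph x t \<noteq> 0 \<Longrightarrow> \<bar>x\<bar> \<le> R \<and> a0 \<le> t \<and> t \<le> R" using a by blast
  have sh: "continuous_on UNIV (\<lambda>p. f (fst p - c) (snd p))"
    if "continuous_on UNIV (\<lambda>p. f (fst p) (snd p))" for f :: "real \<Rightarrow> real \<Rightarrow> real"
    using continuous_on_compose2[OF that, of UNIV "\<lambda>p. (fst p - c, snd p)"]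
    by (simp add: continuous_intros)
  show ?thesis
    unfolding nonneg_test_fun_def
  proof (intro conjI allI)
    fix x t
    have "((\<lambda>y. ph y t) has_real_derivative phx (x - c) t) (at (x - c))" using a by blast
    moreover have "((\<lambda>y. y - c) has_real_derivative 1) (at x)" by (auto intro!: derivative_eq_intros)
    ultimately show "((\<lambda>y. ph (y - c) t) has_real_derivative phx (x - c) t) (at x)"
      using DERIV_chain2[of "\<lambda>y. ph y t" _ "\<lambda>y. y - c"] by fastforce
    show "\<exists>a R'. 0 < a \<and> (\<forall>x t. ph (x - c) t \<noteq> 0 \<longrightarrow> \<bar>x\<bar> \<le> R' \<and> a \<le> t \<and> t \<le> R')"
    proof (rule exI[of _ a0], rule exI[of _ "R + \<bar>c\<bar>"], intro conjI allI impI R(1))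
      fix x t assume "ph (x - c) t \<noteq> 0"
      from R(2)[OF this] show "\<bar>x\<bar> \<le> R + \<bar>c\<bar>" "a0 \<le> t" "t \<le> R + \<bar>c\<bar>" by auto
    qed
  qed (use a sh[of phx] sh[of pht] in auto)
qed

text \<open>The equation is invariant under translation, and test functions live on the whole line,
  so they can be translated along with \<open>u\<close>.\<close>

lemma burgers_solution_shift:
  assumes sol: "burgers_entropy_solution (burg_init \<xi>) u" and xi: "0 \<le> \<xi>" "\<xi> \<le> 2*pi"
  shows "\<exists>M. burgers_solution (\<lambda>x t. u (x + \<xi>) t) M"
proof -
  note s = sol[unfolded burgers_entropy_solution_def]
  obtain M where M: "\<And>x t. 0 \<le> t \<Longrightarrow> \<bar>u x t\<bar> \<le> M" using s by blast
  have per: "u (x + 2*pi) t = u x t" for x t using s by blast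
  have um: "(\<lambda>p. u (fst p) (snd p)) \<in> borel_measurable borel" using s by simp
  have us: "(\<lambda>x. u x t) \<in> borel_measurable borel" for t using s by simp
  have um': "(\<lambda>p. u (fst p + \<xi>) (snd p)) \<in> borel_measurable borel"
  proof -
    have "(\<lambda>p. (fst p + \<xi>, snd p)) \<in> borel_measurable (borel :: (real \<times> real) measure)"
      by (intro borel_measurable_continuous_onI continuous_intros)
    from measurable_compose[OF this um] show ?thesis by simp
  qed
  have ent: "0 \<le> (\<integral>p. \<bar>u (fst p + \<xi>) (snd p) - k\<bar> * pht (fst p) (snd p)
            + kruzkov_flux (u (fst p + \<xi>) (snd p)) k * phx (fst p) (snd p) \<partial>lborel)"
    if t: "nonneg_test_fun ph phx pht" for ph phx pht k
  proof -
    note t' = nonneg_test_fun_shift[OF t, of \<xi>]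
    define G where "G p = \<bar>u (fst p) (snd p) - k\<bar> * pht (fst p - \<xi>) (snd p)
            + kruzkov_flux (u (fst p) (snd p)) k * phx (fst p - \<xi>) (snd p)" for p
    have "0 \<le> (\<integral>p. G p \<partial>lborel)"
    proof -
      from s have "\<forall>k ph phx pht. nonneg_test_fun ph phx pht \<longrightarrow>
        0 \<le> (\<integral>p. (let x = fst p; t = snd p in
                 \<bar>u x t - k\<bar> * pht x t
                 + sgn (u x t - k) * (burg_flux (u x t) - burg_flux k) * phx x t) \<partial>lborel)"
        by blast
      from this[rule_format, OF t', of k] show ?thesis by (simp add: G_def kruzkov_flux_def Let_def)
    qed
    also have "\<dots> = (\<integral>p. G p \<partial>distr lborel borel ((+) (\<xi>, 0)))" by (simp add: lborel_distr_plus)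
    also have "\<dots> = (\<integral>p. G ((\<xi>, 0) + p) \<partial>lborel)"
    proof (rule integral_distr)
      have c: "(\<lambda>p. phx (fst p - \<xi>) (snd p)) \<in> borel_measurable borel"
          "(\<lambda>p. pht (fst p - \<xi>) (snd p)) \<in> borel_measurable borel"
        using t' unfolding nonneg_test_fun_def by (auto intro: borel_measurable_continuous_onI)
      show "G \<in> borel_measurable borel"
        unfolding G_def [abs_def] kruzkov_flux_eq using um c by auto
    qed (auto intro: borel_measurable_continuous_onI continuous_intros)
    finally show ?thesis by (simp add: G_def add.commute)
  qed
  have shL: "L1_torus_dist (\<lambda>x. u (x + \<xi>) r) (\<lambda>x. g (x + \<xi>)) = L1_torus_dist (\<lambda>x. u x r) g"
    if "g \<in> borel_measurable borel" "\<And>x. g (x + 2*pi) = g x" for r g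
    by (rule L1_torus_dist_shift[OF us that(1) per that(2) xi])
  have bi: "burg_init \<xi> \<in> borel_measurable borel"
    unfolding burg_init_def [abs_def] by (intro borel_measurable_continuous_onI continuous_intros)
  have bp: "burg_init \<xi> (x + 2*pi) = burg_init \<xi> x" for x
    using sin_periodic[of "x - \<xi>"] by (simp add: burg_init_def algebra_simps)
  have "burg_init 0 = (\<lambda>x. burg_init \<xi> (x + \<xi>))" by (simp add: burg_init_def fun_eq_iff)
  hence L0: "L1_torus_dist (\<lambda>x. u (x + \<xi>) r) (burg_init 0) = L1_torus_dist (\<lambda>x. u x r) (burg_init \<xi>)" for r
    using shL[OF bi bp] by simp
  have "burgers_solution (\<lambda>x t. u (x + \<xi>) t) M"
  proof
    show "u (x + 2*pi + \<xi>) t = u (x + \<xi>) t" for x t using per[of "x + \<xi>" t] by (simp add: algebra_simps)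
    show "((\<lambda>s. L1_torus_dist (\<lambda>x. u (x + \<xi>) s) (\<lambda>x. u (x + \<xi>) t)) \<longlongrightarrow> 0) (at t within {0<..})" if "0 < t" for t
      unfolding shL[OF us per] using s that by blast
    show "((\<lambda>s. L1_torus_dist (\<lambda>x. u (x + \<xi>) s) (burg_init 0)) \<longlongrightarrow> 0) (at_right 0)"
      unfolding L0 using s by blast
  qed (use um' M ent in auto)
  thus ?thesis ..
qed

lemma entropy_solution_L1_dist:
  assumes sol: "burgers_entropy_solution (burg_init \<xi>) u" and xi: "0 \<le> \<xi>" "\<xi> \<le> 2*pi" and T: "0 < T"
    and g: "g \<in> borel_measurable borel" "\<And>x. g (x + 2*pi) = g x"
  shows "L1_torus_dist (\<lambda>x. u x T) g = (\<integral>\<^sup>+x\<in>{0..2*pi}. ennreal \<bar>burg_profile x T - g (x + \<xi>)\<bar> \<partial>lborel)"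
proof -
  obtain M where "burgers_solution (\<lambda>x t. u (x + \<xi>) t) M" using burgers_solution_shift[OF sol xi] by blast
  then interpret burgers_solution "\<lambda>x t. u (x + \<xi>) t" M .
  have "L1_torus_dist (\<lambda>x. u x T) g = L1_torus_dist (\<lambda>x. u (x + \<xi>) T) (\<lambda>x. g (x + \<xi>))"
    using sol unfolding burgers_entropy_solution_def
    by (intro L1_torus_dist_shift[symmetric] g xi) auto
  also have "\<dots> = (\<integral>\<^sup>+x\<in>{0..2*pi}. ennreal \<bar>burg_profile x T - g (x + \<xi>)\<bar> \<partial>lborel)"
    unfolding L1_torus_dist_def
  proof (rule nn_integral_cong_AE)
    show "AE x in lborel. ennreal \<bar>u (x + \<xi>) T - g (x + \<xi>)\<bar> * indicator {0..2*pi} x =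
        ennreal \<bar>burg_profile x T - g (x + \<xi>)\<bar> * indicator {0..2*pi} x"
      using entropy_solution_eq_profile[OF T] AE_lborel_singleton[of 0] AE_lborel_singleton[of "2*pi"]
      by eventually_elim (auto simp: indicator_def)
  qed
  finally show ?thesis .
qed

subsection \<open>Bisection with steep ReLU decisions\<close>

type_synonym cordic_state = "real \<times> real \<times> real"
text \<open>A parameter \<open>(a, d, \<mu>, \<nu>)\<close> tentatively rotates \<open>(C, S)\<close> by the constant angle \<open>a\<close> and shifts \<open>Z\<close> by \<open>d\<close>;
  the move is accepted iff \<open>\<mu> * Z + \<nu> * S > 0\<close> afterwards.  All of this is affine in the state, hence exact
  for a ReLU layer.\<close>

type_synonym cordic_param = "real \<times> real \<times> real \<times> real"

text \<open>The product of a bit \<open>b\<close> and a number \<open>x\<close> with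
  \<open>\<bar>x\<bar> \<le> 4\<close>: an open gate leaves \<open>relu x - relu (- x)\<close>, a
  closed one pushes both arguments below 0. The constant 4 bounds every increment that the algorithm
  uses.\<close>

definition relu_gate :: "real \<Rightarrow> real \<Rightarrow> real" where
  "relu_gate b x = relu (x + 4 * b - 4) - relu (- x + 4 * b - 4)"

definition steep_step :: "real \<Rightarrow> real \<Rightarrow> real" where
  "steep_step A y = relu (A * y) - relu (A * y - 1)"

definition heaviside :: "real \<Rightarrow> real" where
  "heaviside y = (if 0 < y then 1 else 0)"

fun cordic_step :: "(real \<Rightarrow> real) \<Rightarrow> cordic_param \<Rightarrow> cordic_state \<Rightarrow> cordic_state" where
  "cordic_step \<beta> (a, d, \<mu>, \<nu>) (C, S, Z) =
     (let b = \<beta> (\<mu> * (Z + d) + \<nu> * (S * cos a + C * sin a))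
      in (C + relu_gate b (C * (cos a - 1) - S * sin a),
          S + relu_gate b (S * (cos a - 1) + C * sin a),
          Z + relu_gate b d))"

text \<open>The rotation is backward and \<open>Z\<close> accumulates the angle removed; a move is
  accepted iff the sine of the remaining angle is positive.\<close>

definition angle_params :: "nat \<Rightarrow> cordic_param list" where
  "angle_params n = map (\<lambda>i. (- (pi / 2^(i+1)), pi / 2^(i+1), 0, 1)) [0..<n]"

text \<open>The vector is rotated forward by \<open>z\<close> while \<open>Z\<close> holds
  \<open>w - z\<close>, so that \<open>\<mu> * Z + \<nu> * S\<close> is
  \<open>w - z - T * sin z\<close> and its sign tells on which side of the root \<open>z\<close>
  lies. The angles start at \<open>pi/4\<close> because the root lies in
  \<open>[0, pi/2]\<close>.\<close>

definition solve_params :: "real \<Rightarrow> nat \<Rightarrow> cordic_param list" where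
  "solve_params T n = map (\<lambda>i. (pi / 2^(i+2), - (pi / 2^(i+2)), 1, - T)) [0..<n]"

definition restart :: "cordic_state \<Rightarrow> cordic_state" where
  "restart p = (1, 0, snd (snd p))"

text \<open>The start vector has the angle \<open>arccos (- cos \<theta>)\<close>, the distance of
  \<open>\<theta>\<close> from \<open>pi\<close>. The absolute value folds the two halves of the
  torus together; the sign is restored at the output.\<close>

definition cordic_run :: "(real \<Rightarrow> real) \<Rightarrow> real \<Rightarrow> nat \<Rightarrow> real \<Rightarrow> cordic_state" where
  "cordic_run \<beta> T n \<theta> = fold (cordic_step \<beta>) (solve_params T n)
     (restart (fold (cordic_step \<beta>) (angle_params n) (- cos \<theta>, \<bar>sin \<theta>\<bar>, 0)))"

definition clip01 :: "real \<Rightarrow> real" where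
  "clip01 y = relu y - relu (y - 1)"

text \<open>\<open>m\<close> is the modulus of the value. A steep penalty extinguishes the first
  term when \<open>sin \<theta> > 0\<close> and the second when \<open>sin \<theta> < 0\<close>,
  which multiplies \<open>m\<close> by \<open>- sgn (sin \<theta>)\<close>. Clipping provides a
  bound uniform in \<open>A\<close> even where a decision falls on the ramp of the step.\<close>

definition burg_net :: "real \<Rightarrow> real \<Rightarrow> nat \<Rightarrow> real \<Rightarrow> real" where
  "burg_net A T n \<theta> = (let m = clip01 (fst (snd (cordic_run (steep_step A) T n \<theta>))) in
     relu (m - A * relu (sin \<theta>)) - relu (m - A * relu (- sin \<theta>)))"

definition burg_exact :: "real \<Rightarrow> nat \<Rightarrow> real \<Rightarrow> real" where
  "burg_exact T n \<theta> = - sgn (sin \<theta>) * fst (snd (cordic_run heaviside T n \<theta>))"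

section \<open>Steep decisions are eventually exact\<close>

lemma continuous_on_relu [continuous_intros]:
  "continuous_on S f \<Longrightarrow> continuous_on S (\<lambda>x. relu (f x))"
  unfolding relu_def by (intro continuous_intros)

lemma relu_simps: "y \<le> 0 \<Longrightarrow> relu y = 0" "0 \<le> y \<Longrightarrow> relu y = y"
  by (auto simp: relu_def)

lemma relu_minus_relu: "relu y - relu (- y) = y"
  by (simp add: relu_def)

lemma relu_gate_simps:
  "\<bar>x\<bar> \<le> 4 \<Longrightarrow> relu_gate 1 x = x" "\<bar>x\<bar> \<le> 4 \<Longrightarrow> relu_gate 0 x = 0"
  by (auto simp: relu_gate_def relu_def)

lemma clip01_bounds: "0 \<le> clip01 y" "clip01 y \<le> 1"
  by (auto simp: clip01_def relu_def)

lemma clip01_id: "0 \<le> y \<Longrightarrow> y \<le> 1 \<Longrightarrow> clip01 y = y"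
  by (auto simp: clip01_def relu_def)

text \<open>The ramp starts at 0 and \<open>heaviside\<close> takes the value 0 there, so the
  agreement holds at every \<open>y\<close> and leaves no exceptional set.\<close>

lemma eventually_steep_step: "\<forall>\<^sub>F n in sequentially. steep_step (real n) y = heaviside y"
proof (cases "0 < y")
  case True
  obtain N :: nat where N: "1 / y < real N" using reals_Archimedean2 by blast
  show ?thesis
    unfolding eventually_sequentially
  proof (intro exI[of _ N] allI impI)
    fix n assume "N \<le> n"
    hence "1 / y < real n" using N by simp
    hence "1 \<le> real n * y" using True by (simp add: field_simps)
    thus "steep_step (real n) y = heaviside y" using True by (simp add: steep_step_def heaviside_def relu_def)
  qed
next
  case False
  have "steep_step (real n) y = 0" for n
  proof -
    have "real n * y \<le> 0" using False by (simp add: mult_nonneg_nonpos)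
    thus ?thesis by (simp add: steep_step_def relu_simps)
  qed
  thus ?thesis using False by (simp add: heaviside_def)
qed

lemma eventually_cordic_step:
  "\<forall>\<^sub>F n in sequentially. cordic_step (steep_step (real n)) p st = cordic_step heaviside p st"
proof -
  obtain a d \<mu> \<nu> C S Z where p: "p = (a, d, \<mu>, \<nu>)" "st = (C, S, Z)" by (cases p; cases st) auto
  show ?thesis
    using eventually_steep_step[of "\<mu> * (Z + d) + \<nu> * (S * cos a + C * sin a)"]
    by eventually_elim (simp add: p)
qed

text \<open>The states become equal, not merely close: once the earlier steps agree, the next one
  tests the exact state, and finitely many thresholds on the steepness can be met together.\<close>

lemma eventually_cordic_fold:
  "\<forall>\<^sub>F n in sequentially. fold (cordic_step (steep_step (real n))) ps st = fold (cordic_step heaviside) ps st"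
proof (induction ps arbitrary: st)
  case (Cons p ps)
  show ?case
    using eventually_cordic_step[of p st] Cons.IH[of "cordic_step heaviside p st"]
    by eventually_elim simp
qed simp

lemma eventually_cordic_run:
  "\<forall>\<^sub>F k in sequentially. cordic_run (steep_step (real k)) T n \<theta> = cordic_run heaviside T n \<theta>"
proof -
  let ?s = "(- cos \<theta>, \<bar>sin \<theta>\<bar>, 0)"
  show ?thesis
    unfolding cordic_run_def
    using eventually_cordic_fold[of "angle_params n" ?s]
      eventually_cordic_fold[of "solve_params T n" "restart (fold (cordic_step heaviside) (angle_params n) ?s)"]
    by eventually_elim simp
qed

section \<open>Error of the exact bisections\<close>

lemma rotation_gate_bounds:
  "\<bar>cos p * (cos a - 1) - sin p * sin a\<bar> \<le> (4::real)" "\<bar>sin p * (cos a - 1) + cos p * sin a\<bar> \<le> (4::real)"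
proof -
  have "cos p * (cos a - 1) - sin p * sin a = cos (p + a) - cos p" "sin p * (cos a - 1) + cos p * sin a = sin (p + a) - sin p"
    by (simp_all add: cos_add sin_add algebra_simps)
  moreover have "\<bar>cos (p + a) - cos p\<bar> \<le> 4"
    using cos_le_one[of "p + a"] cos_ge_minus_one[of "p + a"] cos_le_one[of p] cos_ge_minus_one[of p] by linarith
  moreover have "\<bar>sin (p + a) - sin p\<bar> \<le> 4"
    using sin_le_one[of "p + a"] sin_ge_minus_one[of "p + a"] sin_le_one[of p] sin_ge_minus_one[of p] by linarith
  ultimately show "\<bar>cos p * (cos a - 1) - sin p * sin a\<bar> \<le> (4::real)" "\<bar>sin p * (cos a - 1) + cos p * sin a\<bar> \<le> (4::real)"
    by (simp_all only:)
qed

lemma cordic_step_exact: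
  assumes "\<bar>d\<bar> \<le> 4"
  shows "cordic_step heaviside (a, d, \<mu>, \<nu>) (cos p, sin p, Z) =
    (if 0 < \<mu> * (Z + d) + \<nu> * sin (p + a) then (cos (p + a), sin (p + a), Z + d) else (cos p, sin p, Z))"
proof -
  have "sin p * cos a + cos p * sin a = sin (p + a)" by (simp add: sin_add)
  moreover have "cos p + (cos p * (cos a - 1) - sin p * sin a) = cos (p + a)"
    "sin p + (sin p * (cos a - 1) + cos p * sin a) = sin (p + a)"
    by (simp_all add: cos_add sin_add algebra_simps)
  ultimately show ?thesis
    using assms rotation_gate_bounds[of p a] by (simp add: heaviside_def relu_gate_simps Let_def)
qed

lemma pi_dyadic_le: "pi / 2 ^ Suc i \<le> 2"
proof -
  have "pi / 2 ^ Suc i \<le> pi / 2 ^ 1" by (intro divide_left_mono power_increasing) auto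
  also have "\<dots> \<le> 2" using pi_less_4 by simp
  finally show ?thesis .
qed

text \<open>A trial rotation by \<open>a\<close> leaves an angle in \<open>[-a, a]\<close> with
  \<open>a \<le> pi / 2\<close>. In this range the sign of the sine is the sign of the angle, so the
  vector itself answers the comparison.\<close>

lemma angle_phase:
  assumes "0 \<le> \<eta>" "\<eta> \<le> pi"
  shows "\<exists>z. fold (cordic_step heaviside) (angle_params n) (cos \<eta>, sin \<eta>, 0) = (cos (\<eta> - z), sin (\<eta> - z), z)
    \<and> 0 \<le> z \<and> z \<le> \<eta> \<and> \<eta> - z \<le> pi / 2 ^ n"
proof (induction n)
  case 0
  show ?case using assms by (intro exI[of _ 0]) (simp add: angle_params_def)
next
  case (Suc n)
  then obtain z where z: "fold (cordic_step heaviside) (angle_params n) (cos \<eta>, sin \<eta>, 0) = (cos (\<eta> - z), sin (\<eta> - z), z)"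
    "0 \<le> z" "z \<le> \<eta>" "\<eta> - z \<le> pi / 2 ^ n" by blast
  define a where "a = pi / 2 ^ Suc n"
  have a: "0 < a" "a \<le> 2" "pi / 2 ^ n = 2 * a" "a \<le> pi / 2"
  proof -
    show "a \<le> 2" using pi_dyadic_le by (simp add: a_def)
    have "pi / 2 ^ Suc n \<le> pi / 2 ^ 1" by (intro divide_left_mono power_increasing) auto
    thus "a \<le> pi / 2" by (simp add: a_def)
  qed (auto simp: a_def)
  have "fold (cordic_step heaviside) (angle_params (Suc n)) (cos \<eta>, sin \<eta>, 0)
      = cordic_step heaviside (- a, a, 0, 1) (cos (\<eta> - z), sin (\<eta> - z), z)"
    using z(1) by (simp add: angle_params_def a_def)
  also have "\<dots> = (if 0 < sin (\<eta> - z - a) then (cos (\<eta> - z - a), sin (\<eta> - z - a), z + a) else (cos (\<eta> - z), sin (\<eta> - z), z))"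
    using a by (subst cordic_step_exact) auto
  finally have eq: "fold (cordic_step heaviside) (angle_params (Suc n)) (cos \<eta>, sin \<eta>, 0) = \<dots>" .
  have r: "\<eta> - z - a \<le> a" "- a \<le> \<eta> - z - a" using z a by auto
  show ?case
  proof (cases "0 < \<eta> - z - a")
    case True
    hence "0 < sin (\<eta> - z - a)" using r a by (intro sin_gt_zero) auto
    thus ?thesis
      using eq True r z a by (intro exI[of _ "z + a"]) (auto simp: a_def[symmetric] algebra_simps)
  next
    case False
    hence "0 \<le> sin (- (\<eta> - z - a))" using r a by (intro sin_ge_zero) auto
    hence "sin (\<eta> - z - a) \<le> 0" by (simp only: sin_minus)
    thus ?thesis
      using eq False z a by (intro exI[of _ z]) (auto simp: a_def[symmetric])
  qed
qed

text \<open>Bisection for \<open>z + T * sin z = w\<close> on \<open>[0, pi/2]\<close>: the bracket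
  is \<open>[z, z + pi / 2 ^ Suc n]\<close>, and only its left end is stored.\<close>

lemma solve_phase:
  assumes "0 \<le> w" "w \<le> pi / 2 + T" "0 \<le> T"
  shows "\<exists>z. fold (cordic_step heaviside) (solve_params T n) (1, 0, w) = (cos z, sin z, w - z)
    \<and> 0 \<le> z \<and> z + pi / 2 ^ Suc n \<le> pi / 2 \<and> z + T * sin z \<le> w
    \<and> w \<le> (z + pi / 2 ^ Suc n) + T * sin (z + pi / 2 ^ Suc n)"
proof (induction n)
  case 0
  show ?case using assms by (intro exI[of _ 0]) (simp add: solve_params_def)
next
  case (Suc n)
  then obtain z where z: "fold (cordic_step heaviside) (solve_params T n) (1, 0, w) = (cos z, sin z, w - z)"
    "0 \<le> z" "z + pi / 2 ^ Suc n \<le> pi / 2" "z + T * sin z \<le> w"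
    "w \<le> (z + pi / 2 ^ Suc n) + T * sin (z + pi / 2 ^ Suc n)" by blast
  define a where "a = pi / 2 ^ Suc (Suc n)"
  have a: "0 < a" "a \<le> 2" "pi / 2 ^ Suc n = 2 * a"
    using pi_dyadic_le[of "Suc n"] by (auto simp: a_def)
  have "fold (cordic_step heaviside) (solve_params T (Suc n)) (1, 0, w)
      = cordic_step heaviside (a, - a, 1, - T) (cos z, sin z, w - z)"
    using z(1) by (simp add: solve_params_def a_def)
  also have "\<dots> = (if 0 < w - z - a - T * sin (z + a) then (cos (z + a), sin (z + a), w - z - a) else (cos z, sin z, w - z))"
    using a by (subst cordic_step_exact) auto
  finally have eq: "fold (cordic_step heaviside) (solve_params T (Suc n)) (1, 0, w) = \<dots>" .
  show ?case
    unfolding a_def[symmetric]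
  proof (cases "0 < w - z - a - T * sin (z + a)")
    case True
    thus "\<exists>z. fold (cordic_step heaviside) (solve_params T (Suc n)) (1, 0, w) = (cos z, sin z, w - z)
    \<and> 0 \<le> z \<and> z + a \<le> pi / 2 \<and> z + T * sin z \<le> w \<and> w \<le> (z + a) + T * sin (z + a)"
      using eq z a by (intro exI[of _ "z + a"]) (auto simp: algebra_simps)
  next
    case False
    thus "\<exists>z. fold (cordic_step heaviside) (solve_params T (Suc n)) (1, 0, w) = (cos z, sin z, w - z)
    \<and> 0 \<le> z \<and> z + a \<le> pi / 2 \<and> z + T * sin z \<le> w \<and> w \<le> (z + a) + T * sin (z + a)"
      using eq z a by (intro exI[of _ z]) (auto simp: algebra_simps)
  qed
qed

text \<open>On \<open>(0, pi]\<close> the substitution \<open>y = pi - z\<close> turns the equation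
  of the foot into \<open>z + T * sin z = pi - \<theta>\<close>. At \<open>z = pi/2\<close> the left
  side is \<open>pi/2 + T\<close>, hence at least \<open>pi\<close>, so a root lies in
  \<open>[0, pi/2]\<close>. The other half follows by oddness about \<open>pi\<close>; at
  \<open>pi\<close> itself \<open>sgn\<close> is 0 and so is the root.\<close>

lemma burg_profile_solve:
  assumes "pi / 2 \<le> T" "0 < \<theta>" "\<theta> < 2*pi"
  shows "\<exists>z. 0 \<le> z \<and> z \<le> pi/2 \<and> z + T * sin z = arccos (- cos \<theta>) \<and> burg_profile \<theta> T = - sgn (sin \<theta>) * sin z"
proof -
  have T: "0 \<le> T" using assms pi_gt_zero by linarith
  have *: "\<exists>z. 0 \<le> z \<and> z \<le> pi/2 \<and> z + T * sin z = arccos (- cos \<theta>) \<and> burg_profile \<theta> T = - sin z"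
    if th: "0 < \<theta>" "\<theta> \<le> pi" for \<theta>
  proof -
    have ac: "arccos (- cos \<theta>) = pi - \<theta>"
      using arccos_cos[of "pi - \<theta>"] th by (simp add: cos_diff)
    have "\<exists>z\<ge>0. z \<le> pi/2 \<and> z + T * sin z = pi - \<theta>"
      by (rule IVT'[of "\<lambda>z. z + T * sin z"]) (use th assms in \<open>auto intro!: continuous_intros\<close>)
    then obtain z where z: "0 \<le> z" "z \<le> pi/2" "z + T * sin z = pi - \<theta>" by blast
    have cp: "char_pos (pi - z) T = \<theta>" using z(3) by (simp add: char_pos_def sin_diff)
    have "char_foot (char_pos (pi - z) T) T = pi - z"
    proof (rule char_foot_unique[OF T])
      have "z < pi" using z pi_gt_zero by linarith
      thus "char_alive T (pi - z)" unfolding char_alive_def cp using z th by auto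
    qed
    hence "burg_profile \<theta> T = - sin z" using th T cp by (simp add: burg_profile_eq sin_diff)
    thus ?thesis using z ac by auto
  qed
  show ?thesis
  proof (cases "\<theta> < pi")
    case True
    hence "sgn (sin \<theta>) = 1" using sin_gt_zero[of \<theta>] assms by simp
    thus ?thesis using *[of \<theta>] assms True by simp
  next
    case False
    obtain z where z: "0 \<le> z" "z \<le> pi/2" "z + T * sin z = arccos (- cos (2*pi - \<theta>))" "burg_profile (2*pi - \<theta>) T = - sin z"
      using *[of "2*pi - \<theta>"] assms False by auto
    have c: "cos (2*pi - \<theta>) = cos \<theta>" by (simp add: cos_diff)
    have "burg_profile \<theta> T = sin z" using burg_profile_reflect[OF T, of \<theta>] assms z(4) by simp
    show ?thesis
    proof (cases "\<theta> = pi")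
      case True
      have "arccos (- cos \<theta>) = 0" using True by simp
      hence "z + T * sin z = 0" using z c by simp
      moreover have "0 \<le> T * sin z" using z T by (intro mult_nonneg_nonneg sin_ge_zero) auto
      ultimately have "z = 0" using z by linarith
      thus ?thesis using z c \<open>burg_profile \<theta> T = sin z\<close> True by (intro exI[of _ 0]) simp
    next
      case F: False
      hence "0 < sin (2*pi - \<theta>)" using False assms by (intro sin_gt_zero) auto
      hence "sgn (sin \<theta>) = -1" by (simp add: sin_diff)
      thus ?thesis using z c \<open>burg_profile \<theta> T = sin z\<close> by (intro exI[of _ z]) simp
    qed
  qed
qed

text \<open>With \<open>h = pi / 2 ^ Suc n\<close>, the angle phase loses at most
  \<open>2*h\<close>, and a bracket of length \<open>h\<close> changes \<open>z + T * sin z\<close>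
  by at most \<open>(1 + T) * h\<close>. Together these give the factor
  \<open>3 + T\<close>.\<close>

lemma cordic_run_heaviside:
  assumes "pi / 2 \<le> T"
  obtains z where "fst (snd (cordic_run heaviside T n \<theta>)) = sin z" "0 \<le> z" "z \<le> pi/2"
    "z + T * sin z \<le> arccos (- cos \<theta>)" "arccos (- cos \<theta>) \<le> z + T * sin z + (3 + T) * (pi / 2 ^ Suc n)"
proof -
  have T: "0 \<le> T" using assms pi_gt_zero by linarith
  define \<eta> where "\<eta> = arccos (- cos \<theta>)"
  have \<eta>: "0 \<le> \<eta>" "\<eta> \<le> pi" "cos \<eta> = - cos \<theta>" "sin \<eta> = \<bar>sin \<theta>\<bar>"
  proof -
    show "0 \<le> \<eta>" "\<eta> \<le> pi" "cos \<eta> = - cos \<theta>"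
      unfolding \<eta>_def by (auto intro!: arccos_lbound arccos_ubound)
    have "sin \<eta> = sqrt (1 - (cos \<theta>)\<^sup>2)" unfolding \<eta>_def by (simp add: sin_arccos)
    also have "1 - (cos \<theta>)\<^sup>2 = (sin \<theta>)\<^sup>2" by (simp add: sin_squared_eq)
    finally show "sin \<eta> = \<bar>sin \<theta>\<bar>" by simp
  qed
  obtain w where w: "fold (cordic_step heaviside) (angle_params n) (cos \<eta>, sin \<eta>, 0) = (cos (\<eta> - w), sin (\<eta> - w), w)"
    "0 \<le> w" "w \<le> \<eta>" "\<eta> - w \<le> pi / 2 ^ n" using angle_phase[OF \<eta>(1,2)] by blast
  have "w \<le> pi/2 + T" using w(3) \<eta>(2) assms by linarith
  then obtain z where z: "fold (cordic_step heaviside) (solve_params T n) (1, 0, w) = (cos z, sin z, w - z)"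
    "0 \<le> z" "z + pi / 2 ^ Suc n \<le> pi / 2" "z + T * sin z \<le> w"
    "w \<le> (z + pi / 2 ^ Suc n) + T * sin (z + pi / 2 ^ Suc n)" using solve_phase[OF w(2) _ T] by blast
  define h where "h = pi / 2 ^ Suc n"
  have h: "0 < h" "pi / 2 ^ n = 2 * h" by (auto simp: h_def)
  show ?thesis
  proof (rule that)
    show "fst (snd (cordic_run heaviside T n \<theta>)) = sin z"
      unfolding cordic_run_def \<eta>(3,4)[symmetric] w(1) restart_def by (simp add: z(1))
    have "T * (sin (z + h) - sin z) \<le> T * h"
      using abs_sin_diff_le[of "z + h" z] h T by (intro mult_left_mono) auto
    thus "arccos (- cos \<theta>) \<le> z + T * sin z + (3 + T) * (pi / 2 ^ Suc n)"
      using z(5) w(4) h(2) unfolding \<eta>_def[symmetric] h_def[symmetric] by (simp add: algebra_simps)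
    show "0 \<le> z" "z \<le> pi/2" "z + T * sin z \<le> arccos (- cos \<theta>)"
      using z w(3) h unfolding \<eta>_def[symmetric] h_def[symmetric] by auto
  qed
qed

text \<open>The computed \<open>z\<close> never exceeds the true root, and
  \<open>z + T * sin z\<close> has slope at least 1 on \<open>[0, pi/2]\<close>, so the residual
  bounds the error in \<open>z\<close> and hence in its sine.\<close>

lemma burg_exact_error:
  assumes "pi / 2 \<le> T" "0 < \<theta>" "\<theta> < 2*pi"
  shows "\<bar>burg_profile \<theta> T - burg_exact T n \<theta>\<bar> \<le> (3 + T) * (pi / 2 ^ Suc n)"
proof -
  have T: "0 \<le> T" using assms pi_gt_zero by linarith
  obtain z where z: "fst (snd (cordic_run heaviside T n \<theta>)) = sin z" "0 \<le> z" "z \<le> pi/2"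
    "z + T * sin z \<le> arccos (- cos \<theta>)" "arccos (- cos \<theta>) \<le> z + T * sin z + (3 + T) * (pi / 2 ^ Suc n)"
    using cordic_run_heaviside[OF assms(1)] by blast
  obtain y where y: "0 \<le> y" "y \<le> pi/2" "y + T * sin y = arccos (- cos \<theta>)" "burg_profile \<theta> T = - sgn (sin \<theta>) * sin y"
    using burg_profile_solve[OF assms] by blast
  have "z \<le> y"
  proof (rule ccontr)
    assume "\<not> z \<le> y"
    moreover from this have "T * sin y \<le> T * sin z" using z y T by (intro mult_left_mono sin_monotone_2pi_le) auto
    ultimately show False using z(4) y(3) by linarith
  qed
  hence s: "sin z \<le> sin y" using z y by (intro sin_monotone_2pi_le) auto
  hence "T * sin z \<le> T * sin y" using T by (intro mult_left_mono)
  hence "y - z \<le> (3 + T) * (pi / 2 ^ Suc n)" using z(5) y(3) by linarith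
  hence d: "\<bar>sin y - sin z\<bar> \<le> (3 + T) * (pi / 2 ^ Suc n)" using abs_sin_diff_le[of y z] \<open>z \<le> y\<close> by linarith
  have "\<bar>burg_profile \<theta> T - burg_exact T n \<theta>\<bar> = \<bar>sgn (sin \<theta>)\<bar> * \<bar>sin y - sin z\<bar>"
    unfolding burg_exact_def z(1) y(4) abs_mult[symmetric] by (subst abs_minus_commute) (simp add: algebra_simps)
  also have "\<dots> \<le> 1 * \<bar>sin y - sin z\<bar>"
    by (intro mult_right_mono) (auto simp: abs_sgn_eq)
  also have "\<dots> \<le> (3 + T) * (pi / 2 ^ Suc n)" using d by simp
  finally show ?thesis .
qed

lemma eventually_burg_net:
  assumes "pi / 2 \<le> T"
  shows "\<forall>\<^sub>F k in sequentially. burg_net (real k) T n \<theta> = burg_exact T n \<theta>"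
proof -
  obtain z where z: "fst (snd (cordic_run heaviside T n \<theta>)) = sin z" "0 \<le> z" "z \<le> pi/2"
    using cordic_run_heaviside[OF assms] by blast
  have s: "0 \<le> sin z" "sin z \<le> 1" using z by (auto intro!: sin_ge_zero)
  \<comment> \<open>As soon as \<open>real k * \<bar>sin \<theta>\<bar>\<close> exceeds 1, the
    penalty exceeds \<open>sin z\<close> and only one term is left. If
    \<open>sin \<theta> = 0\<close> the two terms cancel, in accordance with
    \<open>sgn 0 = 0\<close>.\<close>
  have fin: "\<forall>\<^sub>F k in sequentially. relu (sin z - real k * relu (sin \<theta>)) - relu (sin z - real k * relu (- sin \<theta>))
       = - sgn (sin \<theta>) * sin z"
  proof (cases "sin \<theta> = 0")
    case False
    obtain N :: nat where N: "1 / \<bar>sin \<theta>\<bar> < real N" using reals_Archimedean2 by blast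
    show ?thesis
      unfolding eventually_sequentially
    proof (intro exI[of _ N] allI impI)
      fix k assume "N \<le> k"
      hence "1 / \<bar>sin \<theta>\<bar> < real k" using N by simp
      hence k: "1 < real k * \<bar>sin \<theta>\<bar>" using False by (simp add: field_simps)
      show "relu (sin z - real k * relu (sin \<theta>)) - relu (sin z - real k * relu (- sin \<theta>)) = - sgn (sin \<theta>) * sin z"
      proof (cases "0 < sin \<theta>")
        case True
        hence "1 < real k * sin \<theta>" using k by simp
        hence "sin z - real k * sin \<theta> \<le> 0" using s(2) by linarith
        hence "relu (sin z - real k * sin \<theta>) = 0" by (rule relu_simps)
        thus ?thesis using True s by (simp add: relu_simps)
      next
        case neg: False
        hence "1 < real k * - sin \<theta>" using k by simp
        hence "sin z - real k * - sin \<theta> \<le> 0" using s(2) by linarith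
        hence "relu (sin z - real k * - sin \<theta>) = 0" by (rule relu_simps)
        thus ?thesis using neg False s by (simp add: relu_simps)
      qed
    qed
  qed simp
  show ?thesis
    using eventually_cordic_run[of T n \<theta>] fin
    by eventually_elim (simp add: burg_net_def burg_exact_def z(1) clip01_id[OF s])
qed

lemma burg_net_bound: "\<bar>burg_net A T n \<theta>\<bar> \<le> 1" if "0 \<le> A"
proof -
  define m where "m = clip01 (fst (snd (cordic_run (steep_step A) T n \<theta>)))"
  have m: "0 \<le> m" "m \<le> 1" unfolding m_def by (rule clip01_bounds)+
  have "0 \<le> relu (m - A * relu y) \<and> relu (m - A * relu y) \<le> 1" for y
  proof -
    have "0 \<le> A * relu y" using that by (simp add: relu_def)
    thus ?thesis using m by (auto simp: relu_def)
  qed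
  from this[of "sin \<theta>"] this[of "- sin \<theta>"] show ?thesis
    unfolding burg_net_def m_def[symmetric] Let_def by linarith
qed

section \<open>Measurability of the network and choice of the steepness\<close>

lemma continuous_on_cordic_step:
  assumes "continuous_on UNIV \<beta>" "continuous_on S f"
  shows "continuous_on S (\<lambda>x. cordic_step \<beta> p (f x))"
proof -
  obtain a d \<mu> \<nu> where p: "p = (a, d, \<mu>, \<nu>)" by (cases p)
  have "cordic_step \<beta> p (f x) = (let C = fst (f x); S = fst (snd (f x)); Z = snd (snd (f x));
      b = \<beta> (\<mu> * (Z + d) + \<nu> * (S * cos a + C * sin a))
      in (C + relu_gate b (C * (cos a - 1) - S * sin a),
          S + relu_gate b (S * (cos a - 1) + C * sin a),
          Z + relu_gate b d))" for x
    by (cases "f x") (simp add: p Let_def)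
  thus ?thesis
    unfolding Let_def relu_gate_def
    by (simp only:) (intro continuous_intros continuous_on_compose2[OF assms(1)] assms(2); simp)
qed

lemma continuous_on_cordic_fold:
  assumes "continuous_on UNIV \<beta>" "continuous_on S f"
  shows "continuous_on S (\<lambda>x. fold (cordic_step \<beta>) ps (f x))"
  using assms(2)
proof (induction ps arbitrary: f)
  case (Cons p ps)
  from Cons.IH[OF continuous_on_cordic_step[OF assms(1) Cons.prems, of p]] show ?case by simp
qed simp

lemma continuous_on_burg_net: "continuous_on UNIV (burg_net A T n)"
proof -
  have s: "continuous_on UNIV (steep_step A)" unfolding steep_step_def by (intro continuous_intros)
  have 1: "continuous_on UNIV (\<lambda>\<theta>. fold (cordic_step (steep_step A)) (angle_params n) (- cos \<theta>, \<bar>sin \<theta>\<bar>, 0))"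
    by (intro continuous_on_cordic_fold s continuous_intros)
  have "continuous_on UNIV (\<lambda>\<theta>. cordic_run (steep_step A) T n \<theta>)"
    unfolding cordic_run_def restart_def by (intro continuous_on_cordic_fold s continuous_intros 1)
  thus ?thesis unfolding burg_net_def clip01_def Let_def by (intro continuous_intros)
qed

lemma burg_net_periodic: "burg_net A T n (\<theta> + 2*pi) = burg_net A T n \<theta>"
  by (simp add: burg_net_def cordic_run_def)

text \<open>The errors converge to that of the exact algorithm, which is strictly below the target
  because of the slack \<open>e\<close>; hence some steepness already meets it.\<close>

lemma burg_net_L1:
  assumes "pi / 2 \<le> T" "0 < e"
  shows "\<exists>A. (\<integral>\<^sup>+x\<in>{0..2*pi}. ennreal \<bar>burg_profile x T - burg_net A T n x\<bar> \<partial>lborel)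
     \<le> ennreal (2 * pi * (3 + T) * (pi / 2 ^ Suc n) + e)"
proof -
  define f where "f k x = ennreal \<bar>burg_profile x T - burg_net (real k) T n x\<bar> * indicator {0..2*pi} x" for k :: nat and x :: real
  define g where "g x = ennreal \<bar>burg_profile x T - burg_exact T n x\<bar> * indicator {0..2*pi} x" for x
  have T: "0 \<le> T" using assms pi_gt_zero by linarith
  have bm: "(\<lambda>x. burg_profile x T) \<in> borel_measurable borel"
  proof -
    have "(\<lambda>x. (x, T)) \<in> borel_measurable borel"
      by (intro borel_measurable_continuous_onI continuous_intros)
    from measurable_compose[OF this burg_profile_measurable] show ?thesis by simp
  qed
  have nm: "burg_net A T n \<in> borel_measurable borel" for A
    by (rule borel_measurable_continuous_onI[OF continuous_on_burg_net])
  have lim: "(\<lambda>k. burg_net (real k) T n x) \<longlonglongrightarrow> burg_exact T n x" for x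
    by (rule tendsto_eventually[OF eventually_burg_net[OF assms(1)]])
  have em: "burg_exact T n \<in> borel_measurable borel"
    by (rule borel_measurable_LIMSEQ_real[OF lim nm])
  have "(\<lambda>k. \<integral>\<^sup>+x. f k x \<partial>lborel) \<longlonglongrightarrow> (\<integral>\<^sup>+x. g x \<partial>lborel)"
  proof (rule nn_integral_dominated_convergence[where w = "\<lambda>x. 2 * indicator {0..2*pi} x"])
    show "f k \<in> borel_measurable lborel" for k unfolding f_def using bm nm by simp
    show "g \<in> borel_measurable lborel" unfolding g_def using bm em by simp
    show "AE x in lborel. f k x \<le> 2 * indicator {0..2*pi} x" for k
    proof (rule AE_I2)
      fix x
      have "\<bar>burg_profile x T - burg_net (real k) T n x\<bar> \<le> 2"
        using burg_profile_bound[of x T] burg_net_bound[of "real k" T n x] by auto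
      hence "ennreal \<bar>burg_profile x T - burg_net (real k) T n x\<bar> \<le> ennreal 2" by (rule ennreal_leI)
      thus "f k x \<le> 2 * indicator {0..2*pi} x" by (simp add: f_def indicator_def)
    qed
    show "AE x in lborel. (\<lambda>k. f k x) \<longlonglongrightarrow> g x"
    proof (rule AE_I2)
      fix x
      have "\<forall>\<^sub>F k in sequentially. f k x = g x"
        using eventually_burg_net[OF assms(1), of n x] by eventually_elim (simp add: f_def g_def)
      thus "(\<lambda>k. f k x) \<longlonglongrightarrow> g x" by (rule tendsto_eventually)
    qed
    show "(\<integral>\<^sup>+x. 2 * indicator {0..2*pi} x \<partial>lborel) < \<infinity>"
      by (simp add: nn_integral_cmult ennreal_mult_less_top)
  qed simp
  moreover have gle: "(\<integral>\<^sup>+x. g x \<partial>lborel) \<le> ennreal (2 * pi * (3 + T) * (pi / 2 ^ Suc n))"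
  proof -
    have "(\<integral>\<^sup>+x. g x \<partial>lborel) \<le> (\<integral>\<^sup>+x. ennreal ((3 + T) * (pi / 2 ^ Suc n)) * indicator {0..2*pi} x \<partial>lborel)"
    proof (rule nn_integral_mono_AE)
      show "AE x in lborel. g x \<le> ennreal ((3 + T) * (pi / 2 ^ Suc n)) * indicator {0..2*pi} x"
        using AE_lborel_singleton[of 0] AE_lborel_singleton[of "2*pi"]
      proof eventually_elim
        case (elim x)
        thus ?case using burg_exact_error[OF assms(1), of x n]
          by (auto simp: g_def indicator_def intro!: ennreal_leI)
      qed
    qed
    also have "\<dots> = ennreal ((3 + T) * (pi / 2 ^ Suc n)) * ennreal (2 * pi)"
      by (simp add: nn_integral_cmult)
    also have "\<dots> = ennreal (2 * pi * (3 + T) * (pi / 2 ^ Suc n))"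
      using T by (subst ennreal_mult[symmetric]) (auto simp: mult_ac)
    finally show ?thesis .
  qed
  have "ennreal (2 * pi * (3 + T) * (pi / 2 ^ Suc n)) < ennreal (2 * pi * (3 + T) * (pi / 2 ^ Suc n) + e)"
    using T assms by (intro ennreal_lessI) (auto intro!: add_nonneg_pos)
  with gle have "(\<integral>\<^sup>+x. g x \<partial>lborel) < ennreal (2 * pi * (3 + T) * (pi / 2 ^ Suc n) + e)" by (rule le_less_trans)
  from order_tendstoD(2)[OF calculation this]
  obtain k where "(\<integral>\<^sup>+x. f k x \<partial>lborel) < ennreal (2 * pi * (3 + T) * (pi / 2 ^ Suc n) + e)"
    using eventually_happens[of _ sequentially] by auto
  thus ?thesis unfolding f_def by (intro exI[of _ "real k"]) (auto intro: less_imp_le)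
qed

subsection \<open>The Fourier neural operator\<close>

type_synonym row = "(nat \<Rightarrow> real) \<times> real"

text \<open>Fourteen channels: signed pairs for \<open>C\<close>, \<open>S\<close>, \<open>Z\<close>
  and for the sine of the input angle, and three pairs of gates.\<close>

definition lin :: "(nat \<Rightarrow> real) \<Rightarrow> (nat \<Rightarrow> real) \<Rightarrow> real" where
  "lin w v = (\<Sum>j<14. w j * v j)"

text \<open>Missing rows give channels equal to 0. The registers rely on this: after a layer without
  gates their gate channels contribute nothing.\<close>

definition relu_layer :: "row list \<Rightarrow> (nat \<Rightarrow> real) \<Rightarrow> nat \<Rightarrow> real" where
  "relu_layer rs v i = (if i < length rs then relu (lin (fst (rs ! i)) v + snd (rs ! i)) else 0)"

definition unit_row :: "nat \<Rightarrow> nat \<Rightarrow> real" where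
  "unit_row k j = (if j = k then 1 else 0)"

definition signed_pair :: "(nat \<Rightarrow> real) \<Rightarrow> real \<Rightarrow> row list" where
  "signed_pair w b = [(w, b), (\<lambda>j. - w j, - b)]"

text \<open>A real register is stored as a difference of two nonnegative channels, plus, after a
  gate, the two channels of the gate.\<close>

definition reg_C :: "nat \<Rightarrow> real" where
  "reg_C j = unit_row 0 j - unit_row 1 j + unit_row 8 j - unit_row 9 j"
definition reg_S :: "nat \<Rightarrow> real" where
  "reg_S j = unit_row 2 j - unit_row 3 j + unit_row 10 j - unit_row 11 j"
definition reg_Z :: "nat \<Rightarrow> real" where
  "reg_Z j = unit_row 4 j - unit_row 5 j + unit_row 12 j - unit_row 13 j"
definition reg_s :: "nat \<Rightarrow> real" where
  "reg_s j = unit_row 6 j - unit_row 7 j"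

text \<open>A relation, since many channel vectors represent the same registers. The extra value
  \<open>s\<close> is the sine of the input angle, carried along for the final sign.\<close>

definition enc :: "(nat \<Rightarrow> real) \<Rightarrow> cordic_state \<Rightarrow> real \<Rightarrow> bool" where
  "enc v st s \<longleftrightarrow> (lin reg_C v, lin reg_S v, lin reg_Z v) = st \<and> lin reg_s v = s"

lemma lin_unit [simp]: "k < 14 \<Longrightarrow> lin (unit_row k) v = v k"
  by (simp add: lin_def unit_row_def if_distrib[of "\<lambda>x. x * _"] cong: if_cong)

lemma lin_add: "lin (\<lambda>j. f j + g j) v = lin f v + lin g v"
  by (simp add: lin_def algebra_simps sum.distrib)

lemma lin_diff: "lin (\<lambda>j. f j - g j) v = lin f v - lin g v"
  by (simp add: lin_def algebra_simps sum_subtractf)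

lemma lin_uminus: "lin (\<lambda>j. - f j) v = - lin f v"
  by (simp add: lin_def sum_negf)

lemma lin_cmult: "lin (\<lambda>j. c * f j) v = c * lin f v"
  by (simp add: lin_def sum_distrib_left mult.assoc)

lemma lin_zero: "lin (\<lambda>j. 0) v = 0"
  by (simp add: lin_def)

lemmas lin_simps = lin_add lin_diff lin_uminus lin_cmult lin_zero

lemma lin_reg:
  "lin reg_C v = v 0 - v 1 + v 8 - v 9" "lin reg_S v = v 2 - v 3 + v 10 - v 11"
  "lin reg_Z v = v 4 - v 5 + v 12 - v 13" "lin reg_s v = v 6 - v 7"
  unfolding reg_C_def [abs_def] reg_S_def [abs_def] reg_Z_def [abs_def] reg_s_def [abs_def]
  by (simp_all only: lin_simps lin_unit numeral_less_iff) simp_all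

text \<open>Gate channels are merged back into the signed pairs, which frees channels 8 and 9 for
  the two halves of the step function; their difference is the decision bit.\<close>

definition decide_layer :: "real \<Rightarrow> cordic_param \<Rightarrow> row list" where
  "decide_layer A p = (case p of (a, d, \<mu>, \<nu>) \<Rightarrow>
     let w = (\<lambda>j. A * (\<mu> * reg_Z j + (\<nu> * cos a * reg_S j + \<nu> * sin a * reg_C j))) in
     signed_pair reg_C 0 @ signed_pair reg_S 0 @ signed_pair reg_Z 0 @ signed_pair reg_s 0 @
     [(w, A * (\<mu> * d)), (w, A * (\<mu> * d) - 1)])"

definition gate_pair :: "(nat \<Rightarrow> real) \<Rightarrow> real \<Rightarrow> row list" where
  "gate_pair w c = [(\<lambda>j. w j + 4 * (unit_row 8 j - unit_row 9 j), c - 4),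
     (\<lambda>j. - w j + 4 * (unit_row 8 j - unit_row 9 j), - c - 4)]"

text \<open>Reads a bare pair. Right after a decision the full register functionals would misread,
  as channels 8 and 9 then hold the bit.\<close>

definition diff_row :: "nat \<Rightarrow> nat \<Rightarrow> real" where
  "diff_row k j = unit_row k j - unit_row (Suc k) j"

definition update_layer :: "cordic_param \<Rightarrow> row list" where
  "update_layer p = (case p of (a, d, \<mu>, \<nu>) \<Rightarrow>
     signed_pair (diff_row 0) 0 @ signed_pair (diff_row 2) 0 @ signed_pair (diff_row 4) 0 @ signed_pair (diff_row 6) 0 @
     gate_pair (\<lambda>j. (cos a - 1) * diff_row 0 j - sin a * diff_row 2 j) 0 @
     gate_pair (\<lambda>j. (cos a - 1) * diff_row 2 j + sin a * diff_row 0 j) 0 @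
     gate_pair (\<lambda>j. 0) d)"

text \<open>The incoming channels are the positive and negative parts of the cosine and the sine.
  Adding the two parts of the sine gives its absolute value.\<close>

definition init_layer :: "row list" where
  "init_layer = signed_pair (\<lambda>j. unit_row 1 j - unit_row 0 j) 0 @
     signed_pair (\<lambda>j. unit_row 2 j + unit_row 3 j) 0 @ signed_pair (\<lambda>j. 0) 0 @ signed_pair (diff_row 2) 0"

definition restart_layer :: "row list" where
  "restart_layer = signed_pair (\<lambda>j. 0) 1 @ signed_pair (\<lambda>j. 0) 0 @ signed_pair reg_Z 0 @ signed_pair reg_s 0"

definition clip_layer :: "row list" where
  "clip_layer = [(reg_S, 0), (reg_S, - 1), (reg_s, 0), (\<lambda>j. - reg_s j, 0)]"

definition output_layer :: "real \<Rightarrow> row list" where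
  "output_layer A = [(\<lambda>j. diff_row 0 j - A * unit_row 2 j, 0), (\<lambda>j. diff_row 0 j - A * unit_row 3 j, 0)]"

definition cordic_layers :: "real \<Rightarrow> cordic_param list \<Rightarrow> row list list" where
  "cordic_layers A ps = concat (map (\<lambda>p. [decide_layer A p, update_layer p]) ps)"

definition burg_layers :: "real \<Rightarrow> real \<Rightarrow> nat \<Rightarrow> row list list" where
  "burg_layers A T n = init_layer # cordic_layers A (angle_params n) @ restart_layer #
     cordic_layers A (solve_params T n) @ [clip_layer, output_layer A]"

lemma lin_diff_row: "k < 13 \<Longrightarrow> lin (diff_row k) v = v k - v (Suc k)"
  unfolding diff_row_def [abs_def] by (simp add: lin_simps)

text \<open>One layer computes the bit, the next gates the three increments with it. The agreement
  is exact for every steepness and every state.\<close>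

lemma cordic_layers_step:
  assumes "enc v st s"
  shows "enc (relu_layer (update_layer p) (relu_layer (decide_layer A p) v)) (cordic_step (steep_step A) p st) s"
proof -
  obtain a d \<mu> \<nu> C S Z where p: "p = (a, d, \<mu>, \<nu>)" "st = (C, S, Z)" by (cases p; cases st) auto
  have e: "lin reg_C v = C" "lin reg_S v = S" "lin reg_Z v = Z" "lin reg_s v = s"
    using assms by (auto simp: enc_def p)
  define v1 where "v1 = relu_layer (decide_layer A p) v"
  define l where "l = \<mu> * (Z + d) + \<nu> * (S * cos a + C * sin a)"
  define b where "b = steep_step A l"
  note rl = relu_layer_def decide_layer_def signed_pair_def p Let_def lin_simps e
  have v1: "v1 0 = relu C" "v1 1 = relu (- C)" "v1 2 = relu S" "v1 3 = relu (- S)"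
    "v1 4 = relu Z" "v1 5 = relu (- Z)" "v1 6 = relu s" "v1 7 = relu (- s)"
    unfolding v1_def by (simp_all add: rl)
  have "v1 8 = relu (A * l)" "v1 9 = relu (A * l - 1)"
    unfolding v1_def l_def by (simp_all add: rl) (simp_all add: algebra_simps)
  hence b: "v1 8 - v1 9 = b" by (simp add: b_def steep_step_def)
  hence b': "v1 8 = b + v1 9" by simp
  have dr: "lin (diff_row 0) v1 = C" "lin (diff_row 2) v1 = S" "lin (diff_row 4) v1 = Z" "lin (diff_row 6) v1 = s"
    by (simp_all add: lin_diff_row v1 relu_minus_relu eval_nat_numeral) (use v1 relu_minus_relu in \<open>simp_all add: eval_nat_numeral\<close>)
  define v2 where "v2 = relu_layer (update_layer p) v1"
  note rl2 = relu_layer_def update_layer_def signed_pair_def gate_pair_def p lin_simps dr b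
  have v2: "v2 0 = relu C" "v2 1 = relu (- C)" "v2 2 = relu S" "v2 3 = relu (- S)"
    "v2 4 = relu Z" "v2 5 = relu (- Z)" "v2 6 = relu s" "v2 7 = relu (- s)"
    unfolding v2_def by (simp_all add: rl2)
  have "v2 8 - v2 9 = relu_gate b (C * (cos a - 1) - S * sin a)"
    "v2 10 - v2 11 = relu_gate b (S * (cos a - 1) + C * sin a)"
    "v2 12 - v2 13 = relu_gate b d"
    unfolding v2_def relu_gate_def by (simp_all add: rl2) (simp_all add: algebra_simps b')
  hence "v2 0 - v2 1 + v2 8 - v2 9 = C + relu_gate b (C * (cos a - 1) - S * sin a)"
    "v2 2 - v2 3 + v2 10 - v2 11 = S + relu_gate b (S * (cos a - 1) + C * sin a)"
    "v2 4 - v2 5 + v2 12 - v2 13 = Z + relu_gate b d" "v2 6 - v2 7 = s"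
    using v2 relu_minus_relu[of C] relu_minus_relu[of S] relu_minus_relu[of Z] relu_minus_relu[of s] by linarith+
  moreover have "cordic_step (steep_step A) p st = (C + relu_gate b (C * (cos a - 1) - S * sin a),
      S + relu_gate b (S * (cos a - 1) + C * sin a), Z + relu_gate b d)"
    by (simp add: p b_def l_def Let_def)
  ultimately have "enc v2 (cordic_step (steep_step A) p st) s" unfolding enc_def lin_reg by simp
  thus ?thesis by (simp only: v2_def v1_def)
qed

lemma cordic_layers_run:
  assumes "enc v st s"
  shows "enc (fold relu_layer (cordic_layers A ps) v) (fold (cordic_step (steep_step A)) ps st) s"
  using assms
proof (induction ps arbitrary: v st)
  case (Cons p ps)
  from Cons.IH[OF cordic_layers_step[OF Cons.prems]] show ?case by (simp add: cordic_layers_def)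
qed (simp add: cordic_layers_def)

lemma restart_layer_enc:
  assumes "enc v st s"
  shows "enc (relu_layer restart_layer v) (restart st) s"
  using assms relu_minus_relu[of "snd (snd st)"] relu_minus_relu[of s]
  unfolding enc_def lin_reg
  by (auto simp: restart_def relu_layer_def restart_layer_def signed_pair_def lin_simps lin_reg relu_simps)

lemma init_layer_enc:
  assumes "v 0 = relu (cos \<theta>)" "v 1 = relu (- cos \<theta>)" "v 2 = relu (sin \<theta>)" "v 3 = relu (- sin \<theta>)"
  shows "enc (relu_layer init_layer v) (- cos \<theta>, \<bar>sin \<theta>\<bar>, 0) (sin \<theta>)"
proof -
  have c: "v (Suc 0) - v 0 = - cos \<theta>" "v 0 - v (Suc 0) = cos \<theta>" "v 2 + v 3 = \<bar>sin \<theta>\<bar>"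
    "- v 2 - v 3 = - \<bar>sin \<theta>\<bar>" "v 2 - v 3 = sin \<theta>"
    using assms by (auto simp: relu_def)
  have d: "lin (diff_row 2) v = sin \<theta>" using c(5) by (simp add: lin_diff_row eval_nat_numeral)
  show ?thesis
    using relu_minus_relu[of "- cos \<theta>"] relu_minus_relu[of "\<bar>sin \<theta>\<bar>"] relu_minus_relu[of "sin \<theta>"]
    unfolding enc_def lin_reg
    by (simp add: relu_layer_def init_layer_def signed_pair_def lin_simps c d relu_simps)
qed

lemma burg_layers_output:
  assumes "v 0 = relu (cos \<theta>)" "v 1 = relu (- cos \<theta>)" "v 2 = relu (sin \<theta>)" "v 3 = relu (- sin \<theta>)"
  shows "fold relu_layer (burg_layers A T n) v 0 - fold relu_layer (burg_layers A T n) v 1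
     = burg_net A T n \<theta>"
proof -
  define w where "w = fold relu_layer (cordic_layers A (solve_params T n)) (relu_layer restart_layer
      (fold relu_layer (cordic_layers A (angle_params n)) (relu_layer init_layer v)))"
  have "enc w (cordic_run (steep_step A) T n \<theta>) (sin \<theta>)"
    unfolding w_def cordic_run_def
    by (intro cordic_layers_run restart_layer_enc init_layer_enc assms)
  hence e: "lin reg_S w = fst (snd (cordic_run (steep_step A) T n \<theta>))" "lin reg_s w = sin \<theta>"
    unfolding enc_def by (metis fst_conv snd_conv)+
  define m where "m = clip01 (fst (snd (cordic_run (steep_step A) T n \<theta>)))"
  define w1 where "w1 = relu_layer clip_layer w"
  have w1: "w1 0 - w1 1 = m" "w1 2 = relu (sin \<theta>)" "w1 3 = relu (- sin \<theta>)"
    unfolding w1_def m_def clip01_def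
    by (simp_all add: relu_layer_def clip_layer_def lin_simps e)
  have o: "fold relu_layer (burg_layers A T n) v = relu_layer (output_layer A) w1"
    by (simp add: burg_layers_def w1_def w_def)
  have "lin (diff_row 0) w1 = m" using w1(1) by (simp add: lin_diff_row)
  thus ?thesis
    unfolding o burg_net_def m_def[symmetric] Let_def
    by (simp add: relu_layer_def output_layer_def lin_simps w1)
qed

text \<open>The lifting copies the input into channel 0 as \<open>relu u - relu (- u)\<close>. Layer
  0 is the only one with a Fourier kernel: the coefficient is
  \<open>\<i> / 2 * cis (- \<xi>)\<close>, so the multipliers \<open>- 2 * \<i>\<close> and
  \<open>-2\<close> produce cosine and sine of \<open>x - \<xi>\<close> as real parts. All later
  layers act pointwise, with constant biases placed at frequency 0.\<close>

definition burg_fno :: "row list list \<Rightarrow> fno" where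
  "burg_fno ls = \<lparr>fno_dv = 14, fno_kmax = 1, fno_depth = Suc (length ls), fno_width = 2,
     fno_R1 = (\<lambda>i j. if j = 0 then (if i = 0 then 1 else -1) else 0),
     fno_c1 = (\<lambda>i. 0),
     fno_R2 = (\<lambda>i j. if i = 0 then (if j = 0 then 1 else -1) else 0),
     fno_c2 = (\<lambda>i. 0),
     fno_W = (\<lambda>l i j. if 0 < l \<and> i < length (ls ! (l - 1)) then fst (ls ! (l - 1) ! i) j else 0),
     fno_P = (\<lambda>l k i j. if l = 0 \<and> k = 1 \<and> j = 0 then
        (if i = 0 then - 2 * \<i> else if i = 1 then 2 * \<i> else if i = 2 then -2 else if i = 3 then 2 else 0) else 0),
     fno_bhat = (\<lambda>l k i. if 0 < l \<and> k = 0 \<and> i < length (ls ! (l - 1)) then complex_of_real (snd (ls ! (l - 1) ! i)) else 0),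
     fno_Q = (\<lambda>i. if i = 0 then 1 else if i = 1 then -1 else 0)\<rparr>"

text \<open>Writing the sine with exponentials, the frequency 1 part is constant over the grid, and
  the other part is a geometric sum with ratio \<open>cis (- (4 * pi / real N))\<close>. The ratio
  is an \<open>N\<close>-th root of unity and equals 1 only if \<open>N\<close> divides 2.\<close>

lemma dft_burg_init:
  assumes "3 \<le> N"
  shows "dft N (burg_init \<xi>) 1 = \<i> / 2 * cis (- \<xi>)"
proof -
  define w where "w = cis (- (4 * pi / real N))"
  have "w \<noteq> 1"
  proof
    assume "w = 1"
    hence "cos (4 * pi / real N) = 1" by (simp add: w_def complex_eq_iff)
    then obtain k :: int where k: "4 * pi / real N = of_int k * 2 * pi" by (auto simp: cos_one_2pi_int)
    hence "2 = real_of_int k * real N" using assms by (simp add: field_simps)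
    hence "real_of_int 2 = real_of_int (k * int N)" by simp
    hence "2 = k * int N" by (simp only: of_int_eq_iff)
    hence "int N dvd 2" by (metis dvd_triv_right)
    hence "int N \<le> 2" by (rule zdvd_imp_le) simp
    thus False using assms by simp
  qed
  have wN: "w ^ N = 1"
  proof -
    have "w ^ N = cis (real N * - (4 * pi / real N))" unfolding w_def by (rule Complex.DeMoivre)
    also have "real N * - (4 * pi / real N) = - (2 * pi * 2)" using assms by simp
    finally show ?thesis using cis_multiple_2pi[of "-2"] by simp
  qed
  have summand: "complex_of_real (burg_init \<xi> (grid_pt N j)) * cis (- real_of_int 1 * grid_pt N j)
      = \<i> / 2 * cis (- \<xi>) - \<i> / 2 * cis \<xi> * w ^ j" for j
  proof -
    have "real j * - (4 * pi / real N) = - (2 * grid_pt N j)" by (simp add: grid_pt_def)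
    hence wj: "w ^ j = cis (- (2 * grid_pt N j))" unfolding w_def Complex.DeMoivre by (simp only:)
    have "complex_of_real (burg_init \<xi> x) * cis (- x) = \<i> / 2 * cis (- \<xi>) - \<i> / 2 * (cis \<xi> * cis (- (2 * x)))" for x
    proof -
      have "complex_of_real (burg_init \<xi> x) = \<i> / 2 * (cis (x - \<xi>) - cis (- (x - \<xi>)))"
        by (simp add: burg_init_def complex_eq_iff sin_diff cos_diff)
      hence "complex_of_real (burg_init \<xi> x) * cis (- x) = \<i> / 2 * (cis (x - \<xi>) * cis (- x) - cis (- (x - \<xi>)) * cis (- x))"
        by (simp only: left_diff_distrib mult.assoc)
      also have "cis (x - \<xi>) * cis (- x) = cis (- \<xi>)" by (simp add: cis_mult)
      also have "cis (- (x - \<xi>)) * cis (- x) = cis \<xi> * cis (- (2 * x))" by (simp add: cis_mult algebra_simps)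
      finally show ?thesis by (simp add: algebra_simps)
    qed
    thus ?thesis unfolding wj by simp
  qed
  have geo: "(\<Sum>j=1..N. w ^ j) = 0"
  proof -
    have "(\<Sum>j=1..N. w ^ j) = w * (\<Sum>j<N. w ^ j)"
      by (simp add: sum.atLeast1_atMost_eq sum_distrib_left)
    also have "(\<Sum>j<N. w ^ j) = (w ^ N - 1) / (w - 1)" by (rule geometric_sum[OF \<open>w \<noteq> 1\<close>])
    finally show ?thesis using wN by simp
  qed
  have "(\<Sum>j=1..N. complex_of_real (burg_init \<xi> (grid_pt N j)) * cis (- real_of_int 1 * grid_pt N j))
     = of_nat N * (\<i> / 2 * cis (- \<xi>))"
    unfolding summand sum_subtractf sum_distrib_left[symmetric] geo by simp
  thus ?thesis unfolding dft_def using assms by simp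
qed

lemma sum_pm1: "(\<Sum>k\<in>{- int 1..int 1}. f k) = f (-1) + f 0 + f (1::int)" for f :: "int \<Rightarrow> complex"
proof -
  have "{- int 1..int 1} = {-1, 0, 1}" by auto
  thus ?thesis by simp
qed

lemma burg_fno_first_layer:
  assumes "3 \<le> N"
  shows "fno_hidden N (burg_fno ls) (burg_init \<xi>) (Suc 0) x 0 = relu (cos (x - \<xi>))"
    "fno_hidden N (burg_fno ls) (burg_init \<xi>) (Suc 0) x 1 = relu (- cos (x - \<xi>))"
    "fno_hidden N (burg_fno ls) (burg_init \<xi>) (Suc 0) x 2 = relu (sin (x - \<xi>))"
    "fno_hidden N (burg_fno ls) (burg_init \<xi>) (Suc 0) x 3 = relu (- sin (x - \<xi>))"
proof -
  have lift: "fno_lift (burg_fno ls) (burg_init \<xi>) y 0 = burg_init \<xi> y" for y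
    using relu_minus_relu[of "burg_init \<xi> y"]
    by (simp add: fno_lift_def burg_fno_def eval_nat_numeral)
  have d: "dft N (\<lambda>y. fno_lift (burg_fno ls) (burg_init \<xi>) y 0) 1 = \<i> / 2 * cis (- \<xi>)"
    unfolding lift using dft_burg_init[OF assms] by simp
  have *: "fno_hidden N (burg_fno ls) (burg_init \<xi>) (Suc 0) x i
     = relu (Re (fno_P (burg_fno ls) 0 1 i 0 * (\<i> / 2 * cis (- \<xi>)) * cis x))" for i
  proof -
    have psum: "(\<Sum>k\<in>{- int (fno_kmax (burg_fno ls))..int (fno_kmax (burg_fno ls))}. \<Sum>j<fno_dv (burg_fno ls).
            fno_P (burg_fno ls) 0 k i j * dft N (\<lambda>y. fno_lift (burg_fno ls) (burg_init \<xi>) y j) k * cis (real_of_int k * x))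
       = fno_P (burg_fno ls) 0 1 i 0 * (\<i> / 2 * cis (- \<xi>)) * cis x"
    proof -
      have k: "fno_kmax (burg_fno ls) = 1" "fno_dv (burg_fno ls) = 14" by (simp_all add: burg_fno_def)
      have z: "fno_P (burg_fno ls) 0 k i j = 0" if "k \<noteq> 1 \<or> j \<noteq> 0" for k j
        using that by (auto simp: burg_fno_def)
      define F where "F k j = fno_P (burg_fno ls) 0 k i j * dft N (\<lambda>y. fno_lift (burg_fno ls) (burg_init \<xi>) y j) k * cis (real_of_int k * x)" for k j
      have "(\<Sum>j<14. F 1 j) = (\<Sum>j\<in>{0}. F 1 j)"
        by (rule sum.mono_neutral_right) (auto simp: F_def z)
      moreover have "(\<Sum>j<14. F k j) = 0" if "k \<noteq> 1" for k using that by (simp add: F_def z)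
      ultimately have "(\<Sum>k\<in>{- int 1..int 1}. \<Sum>j<14. F k j) = F 1 0" unfolding sum_pm1 by simp
      thus ?thesis unfolding k F_def by (simp add: d)
    qed
    have "fno_W (burg_fno ls) 0 i j = 0" "fno_bhat (burg_fno ls) 0 k i = 0" for j k by (simp_all add: burg_fno_def)
    thus ?thesis unfolding fno_hidden.simps fno_layer_def psum by simp
  qed
  have c: "\<i> / 2 * cis (- \<xi>) * cis x = \<i> / 2 * cis (x - \<xi>)" by (simp add: cis_mult mult.assoc)
  show "fno_hidden N (burg_fno ls) (burg_init \<xi>) (Suc 0) x 0 = relu (cos (x - \<xi>))"
    "fno_hidden N (burg_fno ls) (burg_init \<xi>) (Suc 0) x 1 = relu (- cos (x - \<xi>))"
    "fno_hidden N (burg_fno ls) (burg_init \<xi>) (Suc 0) x 2 = relu (sin (x - \<xi>))"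
    "fno_hidden N (burg_fno ls) (burg_init \<xi>) (Suc 0) x 3 = relu (- sin (x - \<xi>))"
    unfolding * mult.assoc[of "fno_P _ _ _ _ _"] c by (simp_all add: burg_fno_def)
qed

text \<open>The index is shifted by one because layer 0 is the Fourier layer.\<close>

lemma burg_fno_layer:
  assumes "l < length ls"
  shows "fno_layer N (burg_fno ls) (Suc l) v x = relu_layer (ls ! l) (v x)"
proof
  fix i
  have k: "fno_kmax (burg_fno ls) = 1" "fno_dv (burg_fno ls) = 14" by (simp_all add: burg_fno_def)
  have P: "fno_P (burg_fno ls) (Suc l) k i j = 0" for k j by (simp add: burg_fno_def)
  show "fno_layer N (burg_fno ls) (Suc l) v x i = relu_layer (ls ! l) (v x) i"
    unfolding fno_layer_def k sum_pm1 P
    by (simp add: burg_fno_def relu_layer_def lin_def relu_def)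
qed

lemma burg_fno_hidden:
  "m \<le> length ls \<Longrightarrow> fno_hidden N (burg_fno ls) ub (Suc m) x
     = fold relu_layer (take m ls) (fno_hidden N (burg_fno ls) ub (Suc 0) x)"
proof (induction m)
  case (Suc m)
  hence "fno_hidden N (burg_fno ls) ub (Suc (Suc m)) x = relu_layer (ls ! m) (fno_hidden N (burg_fno ls) ub (Suc m) x)"
    using burg_fno_layer[of m ls N "fno_hidden N (burg_fno ls) ub (Suc m)" x] by simp
  also have "\<dots> = fold relu_layer (take (Suc m) ls) (fno_hidden N (burg_fno ls) ub (Suc 0) x)"
    using Suc by (simp add: take_Suc_conv_app_nth del: fno_hidden.simps)
  finally show ?case .
qed (simp del: fno_hidden.simps)

lemma burg_fno_eval:
  assumes "3 \<le> N"
  shows "fno_eval N (burg_fno (burg_layers A T n)) (burg_init \<xi>) x = burg_net A T n (x - \<xi>)"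
proof -
  let ?ls = "burg_layers A T n"
  let ?v = "fno_hidden N (burg_fno ?ls) (burg_init \<xi>) (Suc 0) x"
  have d: "fno_depth (burg_fno ?ls) = Suc (length ?ls)" "fno_dv (burg_fno ?ls) = 14" by (simp_all add: burg_fno_def)
  have Q: "(\<Sum>i<14. fno_Q (burg_fno ?ls) i * w i) = w 0 - w 1" for w :: "nat \<Rightarrow> real"
  proof -
    have "(\<Sum>i<14. fno_Q (burg_fno ?ls) i * w i) = (\<Sum>i\<in>{0, 1}. fno_Q (burg_fno ?ls) i * w i)"
      by (rule sum.mono_neutral_right) (auto simp: burg_fno_def)
    thus ?thesis by (simp add: burg_fno_def)
  qed
  have "fno_eval N (burg_fno ?ls) (burg_init \<xi>) x = fold relu_layer ?ls ?v 0 - fold relu_layer ?ls ?v 1"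
    unfolding fno_eval_def d burg_fno_hidden[OF order_refl] take_all[OF order_refl] Q ..
  also have "\<dots> = burg_net A T n (x - \<xi>)"
    by (rule burg_layers_output[OF burg_fno_first_layer[OF assms]])
  finally show ?thesis .
qed

section \<open>Parameter count and choice of constants\<close>

lemma length_burg_layers: "length (burg_layers A T n) = 4 * n + 4"
proof -
  have "length (cordic_layers A ps) = 2 * length ps" for ps
    by (induction ps) (auto simp: cordic_layers_def)
  thus ?thesis by (simp add: burg_layers_def angle_params_def solve_params_def)
qed

text \<open>Each layer has \<open>14^2 + 6 * 14^2 + 6 * 14 = 1456\<close> real parameters; lifting
  and projection add \<open>6 + 42 + 14 = 62\<close>. A digit costs two layers in each of the two
  phases, and five layers are fixed: Fourier, initial, restart, clip and output.\<close>

lemma burg_fno_size: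
  "fno_depth (burg_fno (burg_layers A T n)) = 4 * n + 5"
  "fno_size (burg_fno (burg_layers A T n)) = 62 + (4 * n + 5) * 1456"
  by (simp_all add: burg_fno_def length_burg_layers fno_size_def Let_def)

theorem theorem3p6:
  fixes T :: real
  assumes "T > pi"
  shows "\<exists>C>0. \<forall>(\<epsilon>::real) (N::nat). 0 < \<epsilon> \<and> \<epsilon> \<le> 1/2 \<and> 3 \<le> N \<longrightarrow>
           (\<exists>net. fno_kmax net = 1
              \<and> real (fno_dv net) \<le> C
              \<and> real (fno_depth net) \<le> C * (ln (1/\<epsilon>))^2
              \<and> real (fno_size net) \<le> C * (ln (1/\<epsilon>))^2
              \<and> (\<forall>U. (\<forall>\<xi>. burgers_entropy_solution (burg_init \<xi>) (U \<xi>)) \<longrightarrow>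
                   (\<integral>\<^sup>+ \<xi>\<in>{0..2*pi}.
                      L1_torus_dist (\<lambda>x. U \<xi> x T) (fno_eval N net (burg_init \<xi>)) \<partial>lborel)
                     / ennreal (2*pi) \<le> ennreal \<epsilon>))"
proof -
  have T: "pi / 2 \<le> T" "0 < T" using assms pi_gt_zero by linarith+
  \<comment> \<open>The bisection error integrates to \<open>K / 2 ^ n / 2\<close> over the torus.
    Thus \<open>n \<ge> log 2 K + log 2 (1/\<epsilon>)\<close> makes it at most
    \<open>\<epsilon> / 2\<close>, and \<open>D\<close> is the size with \<open>n\<close> replaced
    by \<open>B + 2\<close>.\<close>
  define K where "K = 2 * pi * (3 + T) * pi"
  define B where "B = log 2 K"
  define D where "D = 62 + (4 * (B + 2) + 5) * 1456"
  define C where "C = D / (ln 2)\<^sup>2"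
  have K: "1 \<le> K"
  proof -
    have "1 * 1 * 1 * 1 \<le> 2 * pi * (3 + T) * pi"
      using pi_gt3 T by (intro mult_mono) auto
    thus ?thesis by (simp add: K_def)
  qed
  hence B: "0 \<le> B" by (simp add: B_def)
  have ln2: "0 < ln (2::real)" "ln (2::real) \<le> 1" using ln_le_minus_one[of 2] by auto
  have D: "62 \<le> D" using B by (simp add: D_def)
  have C: "14 \<le> C"
  proof -
    have "14 * (ln 2)\<^sup>2 \<le> 14 * (1::real)" using ln2 by (intro mult_left_mono power_le_one) auto
    thus ?thesis using D ln2 by (simp add: C_def field_simps)
  qed
  show ?thesis
  proof (rule exI[of _ C], intro conjI allI impI)
    show "0 < C" using C by simp
    fix \<epsilon> :: real and N :: nat
    assume eN: "0 < \<epsilon> \<and> \<epsilon> \<le> 1/2 \<and> 3 \<le> N"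
    define q where "q = ln (1/\<epsilon>) / ln 2"
    have q: "1 \<le> q" "q = log 2 (1/\<epsilon>)"
    proof -
      have "2 \<le> 1 / \<epsilon>" using eN by (simp add: field_simps)
      hence "ln 2 \<le> ln (1/\<epsilon>)" by (subst ln_le_cancel_iff) (use eN in auto)
      thus "1 \<le> q" using ln2 by (simp add: q_def)
      show "q = log 2 (1/\<epsilon>)" by (simp add: q_def log_def)
    qed
    have qsq: "q \<le> q\<^sup>2" "1 \<le> q\<^sup>2" using q by (auto simp: power2_eq_square mult_le_cancel_left1 intro: order_trans)
    have Cq: "C * (ln (1/\<epsilon>))\<^sup>2 = D * q\<^sup>2" using ln2 by (simp add: C_def q_def power_divide)
    define n where "n = nat \<lceil>B + q\<rceil>"
    have n: "B + q \<le> real n" "real n \<le> B + q + 1"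
      using B q by (auto simp: n_def)
    \<comment> \<open>Since \<open>\<epsilon> \<le> 1/2\<close>, \<open>q\<close> is at least 1, so
      both the linear growth of \<open>n\<close> and the additive constants are dominated by the
      square.\<close>
    have nq: "real n \<le> (B + 2) * q\<^sup>2"
    proof -
      have "B * 1 \<le> B * q\<^sup>2" using qsq B by (intro mult_left_mono)
      thus ?thesis using n(2) qsq by (simp add: algebra_simps)
    qed
    have pow: "K / \<epsilon> \<le> 2 ^ n"
    proof -
      have "K / \<epsilon> = 2 powr (B + q)"
        using K eN by (simp add: powr_add B_def q(2))
      also have "\<dots> \<le> 2 powr real n" using n by (intro powr_mono) auto
      finally show ?thesis by (simp add: powr_realpow)
    qed
    obtain A where A: "(\<integral>\<^sup>+x\<in>{0..2*pi}. ennreal \<bar>burg_profile x T - burg_net A T n x\<bar> \<partial>lborel)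
     \<le> ennreal (2 * pi * (3 + T) * (pi / 2 ^ Suc n) + \<epsilon> / 2)"
      using burg_net_L1[OF T(1), of "\<epsilon> / 2" n] eN by auto
    have err: "2 * pi * (3 + T) * (pi / 2 ^ Suc n) + \<epsilon> / 2 \<le> \<epsilon>"
    proof -
      have "2 * pi * (3 + T) * (pi / 2 ^ Suc n) = K / 2 ^ n / 2" by (simp add: K_def)
      moreover have "K / 2 ^ n \<le> \<epsilon>" using pow eN by (simp add: field_simps)
      hence "K / 2 ^ n / 2 + \<epsilon> / 2 \<le> \<epsilon>" by simp
      ultimately show ?thesis by (simp only:)
    qed
    define net where "net = burg_fno (burg_layers A T n)"
    have size: "real (fno_depth net) \<le> D * q\<^sup>2" "real (fno_size net) \<le> D * q\<^sup>2"
    proof -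
      have d: "real (4 * n + 5) \<le> (4 * (B + 2) + 5) * q\<^sup>2" using nq qsq by (simp add: algebra_simps)
      have "D * q\<^sup>2 = 62 * q\<^sup>2 + ((4 * (B + 2) + 5) * q\<^sup>2) * 1456" by (simp add: D_def algebra_simps)
      with d qsq show "real (fno_depth net) \<le> D * q\<^sup>2" "real (fno_size net) \<le> D * q\<^sup>2"
        unfolding net_def burg_fno_size by simp_all
    qed
    have L1: "L1_torus_dist (\<lambda>x. u x T) (fno_eval N net (burg_init \<xi>)) \<le> ennreal \<epsilon>"
      if "burgers_entropy_solution (burg_init \<xi>) u" "0 \<le> \<xi>" "\<xi> \<le> 2*pi" for \<xi> u
    proof -
      have ev: "fno_eval N net (burg_init \<xi>) = (\<lambda>x. burg_net A T n (x - \<xi>))"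
        using eN by (simp add: fun_eq_iff net_def burg_fno_eval)
      have "L1_torus_dist (\<lambda>x. u x T) (\<lambda>x. burg_net A T n (x - \<xi>))
        = (\<integral>\<^sup>+x\<in>{0..2*pi}. ennreal \<bar>burg_profile x T - burg_net A T n (x + \<xi> - \<xi>)\<bar> \<partial>lborel)"
      proof (rule entropy_solution_L1_dist[OF that T(2)])
        show "(\<lambda>x. burg_net A T n (x - \<xi>)) \<in> borel_measurable borel"
          by (intro borel_measurable_continuous_onI continuous_on_compose2[OF continuous_on_burg_net] continuous_intros) auto
        show "burg_net A T n (x + 2*pi - \<xi>) = burg_net A T n (x - \<xi>)" for x
          using burg_net_periodic[of A T n "x - \<xi>"] by (simp add: algebra_simps)
      qed
      also have "\<dots> \<le> ennreal (2 * pi * (3 + T) * (pi / 2 ^ Suc n) + \<epsilon> / 2)" using A by simp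
      also have "\<dots> \<le> ennreal \<epsilon>" by (rule ennreal_leI[OF err])
      finally show ?thesis unfolding ev .
    qed
    show "\<exists>net. fno_kmax net = 1
              \<and> real (fno_dv net) \<le> C
              \<and> real (fno_depth net) \<le> C * (ln (1/\<epsilon>))^2
              \<and> real (fno_size net) \<le> C * (ln (1/\<epsilon>))^2
              \<and> (\<forall>U. (\<forall>\<xi>. burgers_entropy_solution (burg_init \<xi>) (U \<xi>)) \<longrightarrow>
                   (\<integral>\<^sup>+ \<xi>\<in>{0..2*pi}.
                      L1_torus_dist (\<lambda>x. U \<xi> x T) (fno_eval N net (burg_init \<xi>)) \<partial>lborel)
                     / ennreal (2*pi) \<le> ennreal \<epsilon>)"
      unfolding Cq
    proof (rule exI[of _ net], intro conjI size allI impI)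
      show "fno_kmax net = 1" by (simp add: net_def burg_fno_def)
      show "real (fno_dv net) \<le> C" using C by (simp add: net_def burg_fno_def)
      fix U :: "real \<Rightarrow> real \<Rightarrow> real \<Rightarrow> real"
      assume U: "\<forall>\<xi>. burgers_entropy_solution (burg_init \<xi>) (U \<xi>)"
      \<comment> \<open>The bound holds for each phase separately, so averaging over phases needs
        only monotonicity of the integral.\<close>
      have "(\<integral>\<^sup>+ \<xi>\<in>{0..2*pi}. L1_torus_dist (\<lambda>x. U \<xi> x T) (fno_eval N net (burg_init \<xi>)) \<partial>lborel)
         \<le> (\<integral>\<^sup>+ \<xi>. ennreal \<epsilon> * indicator {0..2*pi} \<xi> \<partial>lborel)"
        using L1 U by (intro nn_integral_mono) (auto simp: indicator_def)
      also have "\<dots> = ennreal \<epsilon> * ennreal (2 * pi)" by (simp add: nn_integral_cmult)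
      finally have "(\<integral>\<^sup>+ \<xi>\<in>{0..2*pi}. L1_torus_dist (\<lambda>x. U \<xi> x T) (fno_eval N net (burg_init \<xi>)) \<partial>lborel) / ennreal (2*pi)
         \<le> ennreal \<epsilon> * ennreal (2 * pi) / ennreal (2 * pi)" by (rule divide_right_mono_ennreal)
      also have "\<dots> = ennreal \<epsilon>" using eN by (simp add: ennreal_mult[symmetric] divide_ennreal)
      finally show "(\<integral>\<^sup>+ \<xi>\<in>{0..2*pi}. L1_torus_dist (\<lambda>x. U \<xi> x T) (fno_eval N net (burg_init \<xi>)) \<partial>lborel) / ennreal (2*pi) \<le> ennreal \<epsilon>" .
    qed
  qed
qed

end
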